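(* There exists a (Borel) purely unrectifiable set $P\subseteq[0,1]^2$ such that for the typical function $f\in\mathrm{Lip}_1([0,1]^2)$ (that is, for all $f$ in a residual subset of $\mathrm{Lip}_1([0,1]^2)$) the function $f$ has points of differentiability in $P$, and moreover the set $\mathrm{Diff}(f)\cap P$ satisfies: (a) $\mathrm{Diff}(f)\cap P$ has non-$\sigma$-finite one-dimensional Hausdorff measure; (b) $\mathcal{L}\left(\{\langle x,e\rangle : x\in \mathrm{Diff}(f)\cap P\}\right)>0$ for every $e\in S^1$.
   Context: $\mathrm{Lip}_1([0,1]^2)$ is the complete metric space of functions $f:[0,1]^2\to\mathbb{R}$ with Lipschitz constant at most $1$ (Euclidean norm), equipped with the supremum metric $d_\infty(f,g)=\|f-g\|_\infty$. "The typical function has a property" means that the set of functions having this property is residual (contains a countable intersection of dense open sets) in $\mathrm{Lip}_1([0,1]^2)$. $\mathrm{Diff}(f)$ denotes the set of points at which $f$ is differentiable. A $\mathcal{C}^1$ curve is a $\mathcal{C}^1$ mapping $\gamma:I\to\mathbb{R}^2$ from a closed bounded interval $I$ with $|\gamma'(t)|=1$ for all $t\in I$ (one-sided derivatives at endpoints). A Borel set $P\subseteq\mathbb{R}^2$ is purely unrectifiable if $\gamma^{-1}(P)$ has Lebesgue measure zero for every $\mathcal{C}^1$ curve $\gamma$. $\mathcal{L}$ is one-dimensional Lebesgue measure, $S^1$ the Euclidean unit circle and $\langle\cdot,\cdot\rangle$ the standard inner product of $\mathbb{R}^2$. *)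

theory Defs
  imports "HOL-Analysis.Analysis"
begin

definition residual_in :: "'a topology \<Rightarrow> 'a set \<Rightarrow> bool" where
  "residual_in X A \<longleftrightarrow> A \<subseteq> topspace X \<and>
     (\<exists>U :: nat \<Rightarrow> 'a set. (\<forall>n. openin X (U n) \<and> X closure_of (U n) = topspace X) \<and> (\<Inter>n. U n) \<subseteq> A)"

definition unit_square :: "(real^2) set" where
  "unit_square = cbox 0 1"

text \<open>Functions on the square are represented by total functions that are extensional, i.e. equal to
  \<^const>\<open>undefined\<close> outside the square; \<^const>\<open>funspace\<close> carries the supremum metric.\<close>

definition Lip1 :: "((real^2) \<Rightarrow> real) metric" where
  "Lip1 = submetric (funspace unit_square euclidean_metric) {f. 1-lipschitz_on unit_square f}"

lemma mspace_Lip1: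
  "mspace Lip1 = {f \<in> extensional unit_square. 1-lipschitz_on unit_square f}"
proof -
  have "bounded (f ` unit_square)" if "1-lipschitz_on unit_square f" for f :: "real^2 \<Rightarrow> real"
    using compact_continuous_image[OF lipschitz_on_continuous_on[OF that]] compact_cbox compact_imp_bounded
    unfolding unit_square_def by blast
  then show ?thesis
    unfolding Lip1_def mspace_submetric mspace_funspace mspace_euclidean_metric mdist_euclidean_metric
      Met_TC.fspace_def mbounded_iff_bounded
    by blast
qed

lemma mdist_Lip1:
  assumes "f \<in> mspace Lip1" "g \<in> mspace Lip1"
  shows "mdist Lip1 f g = (SUP x\<in>unit_square. dist (f x) (g x))"
proof -
  have "(0 :: real^2) \<in> unit_square"
    by (simp add: unit_square_def mem_box_cart)
  then have "unit_square \<noteq> {}"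
    by blast
  moreover have "f \<in> Met_TC.fspace unit_square" "g \<in> Met_TC.fspace unit_square"
    using assms unfolding Lip1_def mspace_submetric mspace_funspace mspace_euclidean_metric
      mdist_euclidean_metric by blast+
  ultimately show ?thesis
    unfolding Lip1_def mdist_submetric mdist_funspace mspace_euclidean_metric
      mdist_euclidean_metric Met_TC.fdist_def by simp
qed

text \<open>Differentiability is taken relative to the square. At interior points this is ordinary
  differentiability.\<close>

definition Diff :: "((real^2) \<Rightarrow> real) \<Rightarrow> (real^2) set" where
  "Diff f = {x \<in> unit_square. f differentiable (at x within unit_square)}"

definition C1_curve :: "real \<Rightarrow> real \<Rightarrow> (real \<Rightarrow> real^2) \<Rightarrow> bool" where
  "C1_curve a b \<gamma> \<longleftrightarrow> a < b \<and>
     (\<exists>\<gamma>'. continuous_on {a..b} \<gamma>' \<and>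
        (\<forall>t\<in>{a..b}. (\<gamma> has_vector_derivative \<gamma>' t) (at t within {a..b}) \<and> norm (\<gamma>' t) = 1))"

definition purely_unrectifiable :: "(real^2) set \<Rightarrow> bool" where
  "purely_unrectifiable P \<longleftrightarrow> P \<in> sets borel \<and>
     (\<forall>a b \<gamma>. C1_curve a b \<gamma> \<longrightarrow> {t \<in> {a..b}. \<gamma> t \<in> P} \<in> null_sets lebesgue)"

text \<open>One-dimensional Hausdorff (outer) measure. Boundedness of the covering sets is stated separately
  because \<^const>\<open>diameter\<close> is an unspecified real number on unbounded sets.\<close>

definition hausdorff1_delta :: "real \<Rightarrow> 'a::metric_space set \<Rightarrow> ennreal" where
  "hausdorff1_delta \<delta> A =
     (INF E \<in> {E :: nat \<Rightarrow> 'a set. A \<subseteq> (\<Union>i. E i) \<and> (\<forall>i. bounded (E i) \<and> diameter (E i) \<le> \<delta>)}.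
        \<Sum>i. ennreal (diameter (E i)))"

definition hausdorff1 :: "'a::metric_space set \<Rightarrow> ennreal" where
  "hausdorff1 A = (SUP \<delta>\<in>{0<..}. hausdorff1_delta \<delta> A)"

text \<open>Measurability of the pieces is not required. For Borel \<open>A\<close> requiring it gives the same notion,
  because Hausdorff measure is Borel regular.\<close>

definition sigma_finite_hausdorff1 :: "'a::metric_space set \<Rightarrow> bool" where
  "sigma_finite_hausdorff1 A \<longleftrightarrow>
     (\<exists>B :: nat \<Rightarrow> 'a set. A = (\<Union>i. B i) \<and> (\<forall>i. hausdorff1 (B i) < \<infinity>))"

end

theory Submission
  imports Defs
begin

text \<open>
  A function with Lipschitz constant 1 is differentiable wherever it grows at full speed in some direction \<open>u\<close>.
  Level \<open>m\<close> of the construction is a finite set of very short segments parallel to \<open>u\<close> whose mutual distances are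
  about \<open>2 ^ m\<close> times their length, yet whose projections cover everything in all directions of a double cone around
  \<open>u\<close>, with different subfamilies responsible for different directions. The points lying close to a segment of
  infinitely many levels form a purely unrectifiable set, because a curve spends a summable proportion of its time
  near level \<open>m\<close> (Borel--Cantelli).

  If \<open>f\<close> grows almost at full speed along a segment, a small perturbation makes it grow exactly at full speed on
  pieces of a thin neighbourhood; by a discrete maximal inequality most points of the segment see, at all smaller
  scales, almost full speed. Every sufficiently fine level has segments in these pieces whose projections cover
  nearly the whole projection of the given segment. Growing at almost full speed is an open condition, so for typical
  \<open>f\<close> the refinement can be iterated for ever. For every direction in the cone the nested limit is a compact set of
  points of differentiability with positive projection, and the limits for different directions are disjoint. Two
  perpendicular choices of \<open>u\<close> serve all directions, and uncountably many disjoint compact sets of positive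
  one-dimensional measure exclude \<open>\<sigma>\<close>-finiteness.
\<close>

section \<open>Lipschitz functions, differentiability and projections\<close>

text \<open>The set must be fixed before the function, whereas the refinement depends on the
  function. Hence the segments are laid out once and for all, and a function only selects among
  them. A stage of the selection is a pair of a level and a subset of its finite index set; there
  are countably many such pairs, so countably many dense open conditions suffice.

  Sparse segments and full projections pull in opposite directions. With columns much farther apart
  than the segment length, the shadows of consecutive columns overlap only if they advance by at
  most one segment length per column. A slanted layout achieves this for a range of directions of
  width \<open>1 / lev m\<close>, which is why about \<open>2 * lev m\<close> layouts occur at each
  level.

  The image of a Borel set under a continuous map need not be Borel, and \<open>emeasure\<close> is
  0 on nonmeasurable sets. So the statement on projections also requires Lebesgue measurability of
  the images; it comes from a capacitability argument for countable intersections of countable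
  unions of compact sets.\<close>

lemma lipschitz1_clamp_extension:
  fixes f \<phi> :: "'a::metric_space \<Rightarrow> real"
  assumes f: "1-lipschitz_on S f" and RS: "R \<subseteq> S" and \<phi>: "1-lipschitz_on R \<phi>"
    and d: "\<And>p. p \<in> R \<Longrightarrow> \<bar>\<phi> p - f p\<bar> \<le> d" and "0 \<le> d"
  obtains g where "1-lipschitz_on S g" "\<And>p. p \<in> R \<Longrightarrow> g p = \<phi> p"
    "\<And>p. p \<in> S \<Longrightarrow> \<bar>g p - f p\<bar> \<le> d"
proof (cases "R = {}")
  case True
  then show ?thesis using that[of f] f \<open>0 \<le> d\<close> by simp
next
  case False
  \<comment> \<open>The infimal convolution of \<open>\<phi>\<close> with the distance is the
    McShane extension of \<open>\<phi>\<close>. Clamping it between \<open>f - d\<close> and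
    \<open>f + d\<close> keeps it 1-Lipschitz and close to \<open>f\<close>, and does not touch the
    values on \<open>R\<close>.\<close>
  define U where "U y = (INF q\<in>R. \<phi> q + dist y q)" for y
  have \<phi>D: "\<bar>\<phi> p - \<phi> q\<bar> \<le> dist p q" if "p \<in> R" "q \<in> R" for p q
    using lipschitz_onD[OF \<phi> that] by (simp add: dist_real_def)
  have fD: "\<bar>f p - f q\<bar> \<le> dist p q" if "p \<in> S" "q \<in> S" for p q
    using lipschitz_onD[OF f that] by (simp add: dist_real_def)
  obtain q0 where q0: "q0 \<in> R" using False by blast
  have bdd: "bdd_below ((\<lambda>q. \<phi> q + dist y q) ` R)" for y
  proof (rule bdd_belowI2)
    fix q assume "q \<in> R"
    then show "\<phi> q0 - dist y q0 \<le> \<phi> q + dist y q"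
      using \<phi>D[OF q0 \<open>q \<in> R\<close>] dist_triangle3[of q0 q y] by linarith
  qed
  have U_le: "U y \<le> \<phi> q + dist y q" if "q \<in> R" for y q
    unfolding U_def by (rule cINF_lower[OF bdd that])
  have U_ge: "c \<le> U y" if "\<And>q. q \<in> R \<Longrightarrow> c \<le> \<phi> q + dist y q" for c y
    unfolding U_def by (rule cINF_greatest[OF False that])
  have U_lip: "U y \<le> U z + dist y z" for y z
  proof -
    have "U y - dist y z \<le> U z"
    proof (rule U_ge)
      fix q assume "q \<in> R"
      then show "U y - dist y z \<le> \<phi> q + dist z q"
        using U_le[OF \<open>q \<in> R\<close>, of y] dist_triangle[of y q z] by linarith
    qed
    then show ?thesis by linarith
  qed
  have U_eq: "U p = \<phi> p" if "p \<in> R" for p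
  proof (rule antisym)
    show "U p \<le> \<phi> p" using U_le[OF that, of p] by simp
    show "\<phi> p \<le> U p"
    proof (rule U_ge)
      fix q assume "q \<in> R"
      then show "\<phi> p \<le> \<phi> q + dist p q" using \<phi>D[OF that \<open>q \<in> R\<close>] by linarith
    qed
  qed
  define g where "g y = max (f y - d) (min (f y + d) (U y))" for y
  show ?thesis
  proof (rule that[of g])
    have g_le: "g y \<le> g z + dist y z" if "y \<in> S" "z \<in> S" for y z
    proof -
      have "f y \<le> f z + dist y z" using fD[OF that] by linarith
      then show ?thesis using U_lip[of y z] unfolding g_def by (simp add: max_def min_def)
    qed
    show "1-lipschitz_on S g"
    proof (rule lipschitz_onI)
      fix y z assume "y \<in> S" "z \<in> S"
      then show "dist (g y) (g z) \<le> 1 * dist y z"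
        using g_le[of y z] g_le[of z y] by (simp add: dist_real_def dist_commute abs_le_iff)
    qed simp
    show "g p = \<phi> p" if "p \<in> R" for p
      using d[OF that] U_eq[OF that] unfolding g_def by (auto simp: max_def min_def abs_le_iff)
    show "\<bar>g p - f p\<bar> \<le> d" if "p \<in> S" for p
      using \<open>0 \<le> d\<close> unfolding g_def by (auto simp: max_def min_def abs_le_iff)
  qed
qed

section \<open>Discrete maximal inequality\<close>

lemma card_left_heavy:
  fixes h :: "nat \<Rightarrow> real"
  assumes h: "\<And>k. 0 \<le> h k" and c: "0 \<le> c"
  shows "c * card {k. k < n \<and> (\<exists>i\<le>k. c * (real k + 1 - real i) < sum h {i..k})} \<le> sum h {..<n}"
    (is "c * card (?B n) \<le> _")
proof (induction n rule: less_induct)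
  case (less n)
  have fin: "finite (?B k)" for k by (rule finite_subset[of _ "{..<k}"]) auto
  show ?case
  proof (cases n)
    case 0
    then show ?thesis by simp
  next
    case (Suc k)
    show ?thesis
    proof (cases "k \<in> ?B n")
      case True
      \<comment> \<open>If the last index is heavy, its whole witnessing block \<open>{i..k}\<close>
        is discarded: the sum over the block pays for its \<open>k + 1 - i\<close> indices, and
        heaviness of the indices below \<open>i\<close> does not look to the right.\<close>
      then obtain i where i: "i \<le> k" "c * (real k + 1 - real i) < sum h {i..k}" by blast
      have "?B n \<subseteq> ?B i \<union> {i..k}" using Suc by auto
      then have "card (?B n) \<le> card (?B i) + card {i..k}"
        using card_mono[of "?B i \<union> {i..k}" "?B n"] card_Un_le[of "?B i" "{i..k}"] fin[of i] by auto
      moreover have "real (card {i..k}) = real k + 1 - real i" using i(1) by (simp add: of_nat_diff)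
      ultimately have "real (card (?B n)) \<le> card (?B i) + (real k + 1 - real i)"
        by linarith
      then have "c * card (?B n) \<le> c * card (?B i) + c * (real k + 1 - real i)"
        using mult_left_mono[OF _ c] by (simp only: distrib_left[symmetric])
      also have "\<dots> \<le> sum h {..<i} + sum h {i..k}"
        using less.IH[of i] i Suc by linarith
      also have "\<dots> = sum h ({..<i} \<union> {i..k})"
        by (rule sum.union_disjoint[symmetric]) auto
      also have "{..<i} \<union> {i..k} = {..<n}" using i Suc by auto
      finally show ?thesis .
    next
      case False
      then have "?B n = ?B k" using Suc by (auto simp: less_Suc_eq)
      then show ?thesis using less.IH[of k] Suc h[of k] by simp
    qed
  qed
qed

text \<open>Reversing the order of \<open>{..<n}\<close> turns intervals extending to the right into
  intervals extending to the left.\<close>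

lemma card_right_heavy:
  fixes h :: "nat \<Rightarrow> real"
  assumes h: "\<And>k. 0 \<le> h k" and c: "0 \<le> c"
  shows "c * card {k. k < n \<and> (\<exists>j>k. j \<le> n \<and> c * (real j - real k) < sum h {k..<j})} \<le> sum h {..<n}"
    (is "c * card ?R \<le> _")
proof -
  define h' where "h' k = h (n - 1 - k)" for k
  let ?L = "{k. k < n \<and> (\<exists>i\<le>k. c * (real k + 1 - real i) < sum h' {i..k})}"
  have refl_sum: "sum h' {i..k} = sum h {n - 1 - k..<n - i}" if "i \<le> k" "k < n" for i k
    by (rule sum.reindex_bij_witness[of _ "\<lambda>j. n - 1 - j" "\<lambda>j. n - 1 - j"])
       (use that in \<open>auto simp: h'_def\<close>)
  have "?R \<subseteq> (\<lambda>k. n - 1 - k) ` ?L"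
  proof
    fix k assume "k \<in> ?R"
    then obtain j where j: "k < n" "k < j" "j \<le> n" "c * (real j - real k) < sum h {k..<j}" by blast
    have "c * (real (n - 1 - k) + 1 - real (n - j)) < sum h' {n - j..n - 1 - k}"
      using j refl_sum[of "n - j" "n - 1 - k"] by (simp add: of_nat_diff)
    moreover have "n - j \<le> n - 1 - k" "n - 1 - k < n" using j by auto
    ultimately have "n - 1 - k \<in> ?L" by blast
    then show "k \<in> (\<lambda>k. n - 1 - k) ` ?L" using j by (intro image_eqI[of _ _ "n - 1 - k"]) auto
  qed
  moreover have "finite ?L" by (rule finite_subset[of _ "{..<n}"]) auto
  ultimately have "card ?R \<le> card ?L" by (meson card_image_le card_mono finite_imageI order_trans)
  then have "c * card ?R \<le> c * card ?L" using c by (simp add: mult_left_mono)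
  also have "\<dots> \<le> sum h' {..<n}" by (rule card_left_heavy) (auto simp: h'_def h c)
  also have "\<dots> = sum h {..<n}"
    by (rule sum.reindex_bij_witness[of _ "\<lambda>j. n - 1 - j" "\<lambda>j. n - 1 - j"]) (auto simp: h'_def)
  finally show ?thesis .
qed

text \<open>An interval through \<open>k\<close> splits into a part ending at \<open>k\<close> and a
  part starting at \<open>k\<close>, one of which has a large average. Both contain
  \<open>k\<close>, so their lengths add up to \<open>j - i + 1\<close>, at most
  \<open>2 * (j - i)\<close>; hence the factor 2 in the threshold.\<close>

lemma card_heavy:
  fixes h :: "nat \<Rightarrow> real"
  assumes h: "\<And>k. 0 \<le> h k" and c: "0 \<le> c"
  shows "c * card {k. k < n \<and> (\<exists>i\<le>k. \<exists>j>k. j \<le> n \<and> 2 * c * (real j - real i) < sum h {i..<j})}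
    \<le> 2 * sum h {..<n}" (is "c * card ?B \<le> _")
proof -
  let ?L = "{k. k < n \<and> (\<exists>i\<le>k. c * (real k + 1 - real i) < sum h {i..k})}"
  let ?R = "{k. k < n \<and> (\<exists>j>k. j \<le> n \<and> c * (real j - real k) < sum h {k..<j})}"
  have "?B \<subseteq> ?L \<union> ?R"
  proof
    fix k assume "k \<in> ?B"
    then obtain i j where ij: "k < n" "i \<le> k" "k < j" "j \<le> n"
      "2 * c * (real j - real i) < sum h {i..<j}" by blast
    have "sum h {i..<j} \<le> sum h {i..k} + sum h {k..<j}"
    proof -
      have "{i..k} \<union> {k..<j} = {i..<j}" using ij by auto
      then show ?thesis using sum.union_inter[of "{i..k}" "{k..<j}" h] 
        sum_nonneg[of "{i..k} \<inter> {k..<j}" h] h by simp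
    qed
    moreover have "c * (real k + 1 - real i) + c * (real j - real k) \<le> 2 * c * (real j - real i)"
    proof -
      have "real k + 1 - real i + (real j - real k) \<le> 2 * (real j - real i)" using ij by simp
      then show ?thesis using c by (metis distrib_left mult.assoc mult.left_commute mult_left_mono)
    qed
    ultimately have "c * (real k + 1 - real i) < sum h {i..k} \<or> c * (real j - real k) < sum h {k..<j}"
      using ij(5) by linarith
    then show "k \<in> ?L \<union> ?R" using ij by blast
  qed
  moreover have "finite ?L" "finite ?R" by (rule finite_subset[of _ "{..<n}"]; auto)+
  ultimately have "card ?B \<le> card ?L + card ?R"
    by (meson card_Un_le card_mono finite_UnI order_trans)
  then have "c * card ?B \<le> c * (real (card ?L) + real (card ?R))"
    using c by (intro mult_left_mono) linarith+
  also have "\<dots> = c * card ?L + c * card ?R" by (simp add: distrib_left)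
  also have "\<dots> \<le> 2 * sum h {..<n}"
    using card_left_heavy[where h=h and c=c and n=n, OF h c]
      card_right_heavy[where h=h and c=c and n=n, OF h c] by linarith
  finally show ?thesis .
qed

section \<open>Differentiability from maximal growth\<close>

lemma norm_plus_scaled_unit_le:
  fixes u v :: "'a::real_inner"
  assumes "norm u = 1" "0 < t" "norm v \<le> t"
  shows "norm (v + t *\<^sub>R u) \<le> t + v \<bullet> u + (norm v)\<^sup>2 / (2 * t)"
proof (rule power2_le_imp_le)
  let ?q = "(norm v)\<^sup>2 / (2 * t)"
  have uu: "u \<bullet> u = 1" using assms(1) by (simp add: norm_eq_1)
  have "(norm (v + t *\<^sub>R u))\<^sup>2 = (norm v)\<^sup>2 + 2 * t * (v \<bullet> u) + t\<^sup>2"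
    unfolding power2_norm_eq_inner by (simp add: inner_add uu inner_commute power2_eq_square)
  \<comment> \<open>Completing the square: \<open>2 * t * ?q\<close> is
    \<open>(norm v)\<^sup>2\<close>, so the term to be discarded is itself a square.\<close>
  also have "\<dots> = (t + v \<bullet> u + ?q)\<^sup>2 - (v \<bullet> u + ?q)\<^sup>2"
    using assms(2) by (simp add: power2_eq_square field_simps)
  finally show "(norm (v + t *\<^sub>R u))\<^sup>2 \<le> (t + v \<bullet> u + ?q)\<^sup>2" by simp
  have "\<bar>v \<bullet> u\<bar> \<le> t" using Cauchy_Schwarz_ineq2[of v u] assms by simp
  moreover have "0 \<le> ?q" using assms by simp
  ultimately show "0 \<le> t + v \<bullet> u + ?q" by linarith
qed

text \<open>A function with Lipschitz constant 1 cannot deviate from a direction in which it grows at full speed: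
  the cones with apex \<open>x \<plusminus> t u\<close>, for \<open>t\<close> much larger than \<open>norm v\<close>, pin down \<open>f (x + v)\<close>.\<close>

lemma has_derivative_of_maximal_slope:
  fixes f :: "'a::euclidean_space \<Rightarrow> real"
  assumes f: "1-lipschitz_on S f" and x: "x \<in> interior S" and u: "norm u = 1"
    and slope: "\<And>e. 0 < e \<Longrightarrow> \<exists>r>0. \<forall>t. 0 < t \<and> t \<le> r \<longrightarrow> 2 * t * (1 - e) \<le> f (x + t *\<^sub>R u) - f (x - t *\<^sub>R u)"
  shows "(f has_derivative (\<lambda>v. v \<bullet> u)) (at x)"
  unfolding has_derivative_at_alt
proof (intro conjI allI impI)
  show "bounded_linear (\<lambda>v. v \<bullet> u)" by (rule bounded_linear_inner_left)
  fix e :: real assume "0 < e"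
  define \<delta> where "\<delta> = min e 1"
  have \<delta>: "0 < \<delta>" "\<delta> \<le> 1" "\<delta> \<le> e" using \<open>0 < e\<close> by (auto simp: \<delta>_def)
  obtain r where r: "0 < r" "\<And>t. 0 < t \<Longrightarrow> t \<le> r \<Longrightarrow>
      2 * t * (1 - \<delta>\<^sup>2 / 4) \<le> f (x + t *\<^sub>R u) - f (x - t *\<^sub>R u)"
    using slope[of "\<delta>\<^sup>2 / 4"] \<delta> by auto
  obtain s where s: "0 < s" "ball x s \<subseteq> S" using x by (auto simp: mem_interior)
  have fD: "\<bar>f p - f q\<bar> \<le> norm (p - q)" if "p \<in> S" "q \<in> S" for p q
    using lipschitz_onD[OF f that] by (simp add: dist_real_def dist_norm)
  define \<rho> where "\<rho> = \<delta> * min r (s / 2)"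
  have "0 < \<rho>" using \<delta> r s by (simp add: \<rho>_def)
  moreover have "norm (f y - f x - (y - x) \<bullet> u) \<le> e * norm (y - x)" if "norm (y - x) < \<rho>" for y
  proof (cases "y = x")
    case True
    then show ?thesis by simp
  next
    case False
    define v where "v = y - x"
    \<comment> \<open>At this distance two errors balance: the slope defect
      \<open>2 * t * (\<delta>\<^sup>2 / 4)\<close> and the second-order term
      \<open>(norm v)\<^sup>2 / (2 * t)\<close> both equal \<open>\<delta>\<^sup>2 * t / 2\<close>,
      and together they make \<open>\<delta> * norm v\<close>.\<close>
    define t where "t = norm v / \<delta>"
    have v: "0 < norm v" "norm v < \<rho>" using False that by (auto simp: v_def)
    have t: "0 < t" using v \<delta> by (simp add: t_def)
    have "t < min r (s / 2)" using v(2) \<delta>(1) unfolding t_def \<rho>_def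
      by (metis mult.commute pos_divide_less_eq)
    then have tr: "t \<le> r" "t < s" using s by auto
    have vt: "norm v = \<delta> * t" using \<delta> by (simp add: t_def)
    then have vlt: "norm v \<le> t" using \<delta> t by (simp add: mult_left_le_one_le)
    have inS: "x \<in> S" "y \<in> S" "x + t *\<^sub>R u \<in> S" "x - t *\<^sub>R u \<in> S"
      using s tr t u vlt by (auto simp: subset_iff dist_norm v_def norm_minus_commute)
    have sl: "2 * t - \<delta>\<^sup>2 * t / 2 \<le> f (x + t *\<^sub>R u) - f (x - t *\<^sub>R u)"
      using r(2)[OF t tr(1)] by (simp add: algebra_simps)
    have a1: "f (x + t *\<^sub>R u) - f x \<le> t" "f x - f (x - t *\<^sub>R u) \<le> t"
      using fD[OF inS(3,1)] fD[OF inS(1,4)] u t by auto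
    have b1: "f y - f (x - t *\<^sub>R u) \<le> norm (v + t *\<^sub>R u)"
      using fD[OF inS(2,4)] by (simp add: v_def algebra_simps)
    have b2: "f (x + t *\<^sub>R u) - f y \<le> norm (- v + t *\<^sub>R u)"
      using fD[OF inS(3,2)] by (simp add: v_def algebra_simps)
    have q: "(norm v)\<^sup>2 / (2 * t) = \<delta>\<^sup>2 * t / 2"
      using t by (simp add: vt power2_eq_square field_simps)
    have c1: "norm (v + t *\<^sub>R u) \<le> t + v \<bullet> u + \<delta>\<^sup>2 * t / 2"
      using norm_plus_scaled_unit_le[OF u t vlt] q by simp
    have c2: "norm (- v + t *\<^sub>R u) \<le> t - v \<bullet> u + \<delta>\<^sup>2 * t / 2"
      using norm_plus_scaled_unit_le[OF u t, of "-v"] vlt q by simp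
    have "\<bar>f y - f x - v \<bullet> u\<bar> \<le> \<delta>\<^sup>2 * t"
      unfolding abs_le_iff using sl a1 b1 b2 c1 c2 by argo
    also have "\<delta>\<^sup>2 * t = \<delta> * norm v" by (simp add: vt power2_eq_square)
    also have "\<dots> \<le> e * norm v" using \<delta> by (simp add: mult_right_mono)
    finally show ?thesis by (simp add: v_def)
  qed
  ultimately show "\<exists>d>0. \<forall>y. norm (y - x) < d \<longrightarrow> norm (f y - f x - (y - x) \<bullet> u) \<le> e * norm (y - x)"
    by blast
qed

section \<open>The topology of \<open>Lip1\<close> through pointwise bounds\<close>

lemma mspace_Lip1_iff: "f \<in> mspace Lip1 \<longleftrightarrow> f \<in> extensional unit_square \<and> 1-lipschitz_on unit_square f"
  by (simp add: mspace_Lip1)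

lemma compact_unit_square: "compact unit_square"
  by (simp add: unit_square_def)

lemma unit_square_nonempty: "unit_square \<noteq> {}"
proof -
  have "(0 :: real^2) \<in> unit_square" by (simp add: unit_square_def mem_box_cart)
  then show ?thesis by blast
qed

lemma bdd_above_dist_Lip1:
  assumes "f \<in> mspace Lip1" "g \<in> mspace Lip1"
  shows "bdd_above ((\<lambda>x. dist (f x) (g x)) ` unit_square)"
proof -
  have "continuous_on unit_square (\<lambda>x. dist (f x) (g x))"
    using assms by (intro continuous_intros lipschitz_on_continuous_on) (auto simp: mspace_Lip1_iff)
  then show ?thesis
    by (intro bounded_imp_bdd_above compact_imp_bounded compact_continuous_image compact_unit_square)
qed

lemma openin_Lip1I:
  assumes "U \<subseteq> mspace Lip1"
    and "\<And>f. f \<in> U \<Longrightarrow> \<exists>r>0. \<forall>g\<in>mspace Lip1. (\<forall>x\<in>unit_square. \<bar>g x - f x\<bar> < r) \<longrightarrow> g \<in> U"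
  shows "openin (mtopology_of Lip1) U"
  unfolding mtopology_of_def Metric_space.openin_mtopology[OF Metric_space_mspace_mdist]
proof (intro conjI allI impI)
  show "U \<subseteq> mspace Lip1" by fact
  fix f assume f: "f \<in> U"
  then obtain r where r: "r > 0" "\<And>g. g \<in> mspace Lip1 \<Longrightarrow> (\<forall>x\<in>unit_square. \<bar>g x - f x\<bar> < r) \<Longrightarrow> g \<in> U"
    using assms(2) by metis
  have "g \<in> U" if g: "g \<in> mspace Lip1" "mdist Lip1 f g < r" for g
  proof (rule r(2)[OF g(1)], intro ballI)
    fix x assume "x \<in> unit_square"
    then have "dist (f x) (g x) \<le> (SUP x\<in>unit_square. dist (f x) (g x))"
      using bdd_above_dist_Lip1[of f g] g f assms(1) by (intro cSUP_upper) auto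
    then show "\<bar>g x - f x\<bar> < r"
      using g mdist_Lip1[of f g] f assms(1) by (auto simp: dist_real_def abs_minus_commute)
  qed
  then show "\<exists>r>0. Metric_space.mball (mspace Lip1) (mdist Lip1) f r \<subseteq> U"
    using r(1) by (auto simp: Metric_space.in_mball[OF Metric_space_mspace_mdist])
qed

lemma openin_Lip1D:
  assumes "openin (mtopology_of Lip1) U" "f \<in> U"
  obtains r where "r > 0" "\<And>g. g \<in> mspace Lip1 \<Longrightarrow> (\<And>x. x \<in> unit_square \<Longrightarrow> \<bar>g x - f x\<bar> \<le> r) \<Longrightarrow> g \<in> U"
proof -
  obtain r where r: "r > 0" "Metric_space.mball (mspace Lip1) (mdist Lip1) f r \<subseteq> U" and U: "U \<subseteq> mspace Lip1"
    using assms unfolding mtopology_of_def Metric_space.openin_mtopology[OF Metric_space_mspace_mdist] by metis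
  show ?thesis
  \<comment> \<open>Pointwise bounds by \<open>r\<close> bound the supremum only by \<open>r\<close>
    itself, which could leave \<open>g\<close> outside the open ball; hence half the radius.\<close>
  proof (rule that[of "r/2"])
    show "r / 2 > 0" using r by simp
    fix g assume g: "g \<in> mspace Lip1" "\<And>x. x \<in> unit_square \<Longrightarrow> \<bar>g x - f x\<bar> \<le> r / 2"
    have f: "f \<in> mspace Lip1" using U assms by auto
    have "mdist Lip1 f g \<le> r / 2"
      unfolding mdist_Lip1[OF f g(1)]
      by (rule cSUP_least[OF unit_square_nonempty]) (use g(2) in \<open>auto simp: dist_real_def abs_minus_commute\<close>)
    then show "g \<in> U" using r g(1) f by (auto simp: Metric_space.in_mball[OF Metric_space_mspace_mdist])
  qed
qed

section \<open>Measurability of projections\<close>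

lemma image_INT_decseq_compact:
  fixes p :: "'a::heine_borel \<Rightarrow> 'b::t1_space"
  assumes p: "continuous_on UNIV p" and B: "\<And>n. compact (B n)" "decseq B"
  shows "p ` (\<Inter>n. B n) = (\<Inter>n. p ` B n)"
proof (intro equalityI subsetI)
  fix z assume z: "z \<in> (\<Inter>n. p ` B n)"
  have "closed (p -` {z})" using continuous_closed_vimage[of "{z}" p] p by (simp add: continuous_on_eq_continuous_at)
  moreover have "B n \<inter> p -` {z} \<noteq> {}" for n using z by auto
  moreover have "B n \<inter> p -` {z} \<subseteq> B m \<inter> p -` {z}" if "m \<le> n" for m n
    using B(2) that by (auto simp: decseq_def)
  ultimately have "\<Inter> (range (\<lambda>n. B n \<inter> p -` {z})) \<noteq> {}"
    using compact_nest[of "\<lambda>n. B n \<inter> p -` {z}"] B(1) by (simp add: compact_Int_closed)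
  then show "z \<in> p ` (\<Inter>n. B n)" by auto
qed auto

text \<open>Choquet's capacitability argument. Outer measure is continuous along increasing
  sequences of arbitrary sets, so at each \<open>n\<close> a finite union of the
  \<open>C n k\<close> already keeps it above \<open>\<alpha>\<close>. Intersecting successively
  gives nested compact sets whose intersection lies in the given set, and the measure of their
  images passes to the limit. Outer measure is used because the images of the noncompact sets are
  not yet known to be measurable.\<close>

lemma inner_regular_image_Fsigma_delta:
  fixes p :: "'a::heine_borel \<Rightarrow> 'b::euclidean_space"
  assumes p: "continuous_on UNIV p" and C: "\<And>n k. compact (C n k)" and T: "compact T" "\<And>n k. C n k \<subseteq> T"
    and \<alpha>: "\<alpha> < outer_measure_of lborel (p ` (\<Inter>n::nat. \<Union>k::nat. C n k))"
  obtains K where "compact K" "K \<subseteq> (\<Inter>n. \<Union>k. C n k)" "\<alpha> \<le> emeasure lborel (p ` K)"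
proof -
  define A where "A = (\<Inter>n. \<Union>k::nat. C n k)"
  define D where "D n k = (\<Union>j\<le>k. C n j)" for n k :: nat
  have D: "compact (D n k)" for n k unfolding D_def by (intro compact_UN) (auto simp: C)
  have "\<exists>B. \<forall>n. (compact (B n) \<and> \<alpha> < outer_measure_of lborel (p ` (A \<inter> B n))) \<and>
      (\<exists>k. B (Suc n) = B n \<inter> D n k)"
  proof (rule dependent_nat_choice)
    have "A \<inter> T = A" using T(2) by (fastforce simp: A_def)
    then show "\<exists>B. compact B \<and> \<alpha> < outer_measure_of lborel (p ` (A \<inter> B))"
      using T \<alpha> by (intro exI[of _ T]) (auto simp: A_def)
  next
    fix B n assume B: "compact B \<and> \<alpha> < outer_measure_of lborel (p ` (A \<inter> B))"
    have "(SUP k. outer_measure_of lborel (p ` (A \<inter> (B \<inter> D n k)))) =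
        outer_measure_of lborel (\<Union>k. p ` (A \<inter> (B \<inter> D n k)))"
      by (rule SUP_outer_measure_of_incseq) (auto simp: incseq_def D_def intro: order_trans)
    also have "(\<Union>k. p ` (A \<inter> (B \<inter> D n k))) = p ` (A \<inter> B)"
    proof -
      have "A \<subseteq> (\<Union>k. D n k)" by (auto simp: A_def D_def)
      then have "A \<inter> B = (\<Union>k. A \<inter> (B \<inter> D n k))" by auto
      then show ?thesis by (metis image_UN)
    qed
    finally have "\<alpha> < (SUP k. outer_measure_of lborel (p ` (A \<inter> (B \<inter> D n k))))" using B by simp
    then obtain k where "\<alpha> < outer_measure_of lborel (p ` (A \<inter> (B \<inter> D n k)))"
      unfolding less_SUP_iff by auto
    then show "\<exists>B'. (compact B' \<and> \<alpha> < outer_measure_of lborel (p ` (A \<inter> B'))) \<and> (\<exists>k. B' = B \<inter> D n k)"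
      using B D by (intro exI[of _ "B \<inter> D n k"]) (auto simp: compact_Int)
  qed
  then obtain B where B: "\<And>n. compact (B n)" "\<And>n. \<alpha> < outer_measure_of lborel (p ` (A \<inter> B n))"
    "\<And>n. \<exists>k. B (Suc n) = B n \<inter> D n k" by blast
  have dec: "decseq B" using B(3) by (intro decseq_SucI) (metis Int_lower1)
  have comp: "compact (p ` B n)" for n using B(1) p by (meson compact_continuous_image continuous_on_subset subset_UNIV)
  show ?thesis
  proof (rule that)
    show "compact (\<Inter>n. B n)" using compact_Inter[of "range B"] B(1) by auto
    show "(\<Inter>n. B n) \<subseteq> (\<Inter>n. \<Union>k. C n k)"
    proof
      fix x assume x: "x \<in> (\<Inter>n. B n)"
      have "x \<in> (\<Union>k. C n k)" for n
      proof -
        obtain k where "B (Suc n) = B n \<inter> D n k" using B(3) by blast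
        then have "x \<in> D n k" using x by blast
        then show ?thesis by (auto simp: D_def)
      qed
      then show "x \<in> (\<Inter>n. \<Union>k. C n k)" by blast
    qed
    have "emeasure lborel (p ` (\<Inter>n. B n)) = emeasure lborel (\<Inter>n. p ` B n)"
      using image_INT_decseq_compact[OF p B(1) dec] by simp
    also have "\<dots> = (INF n. emeasure lborel (p ` B n))"
    proof (rule INF_emeasure_decseq[symmetric])
      show "range (\<lambda>n. p ` B n) \<subseteq> sets lborel" using comp by (auto intro: borel_compact)
      show "decseq (\<lambda>n. p ` B n)" using dec by (auto simp: decseq_def)
      show "emeasure lborel (p ` B n) \<noteq> \<infinity>" for n
        using emeasure_compact_finite[OF comp] by (simp add: less_top)
    qed
    also have "\<dots> \<ge> \<alpha>"
    proof (rule INF_greatest)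
      fix n
      have "\<alpha> \<le> outer_measure_of lborel (p ` (A \<inter> B n))" using B(2) by (simp add: less_imp_le)
      also have "\<dots> \<le> outer_measure_of lborel (p ` B n)" by (rule outer_measure_of_mono) auto
      also have "\<dots> = emeasure lborel (p ` B n)" using comp by (simp add: borel_compact)
      finally show "\<alpha> \<le> emeasure lborel (p ` B n)" .
    qed
    finally show "\<alpha> \<le> emeasure lborel (p ` (\<Inter>n. B n))" .
  qed
qed

text \<open>Images of compact sets from inside and a measurable hull from outside reach the same
  finite measure, so the image differs from a Borel set by a subset of a null set.\<close>

lemma sets_lebesgue_image_Fsigma_delta:
  fixes p :: "'a::heine_borel \<Rightarrow> 'b::euclidean_space"
  assumes p: "continuous_on UNIV p" and C: "\<And>n k. compact (C n k)" and T: "compact T" "\<And>n k. C n k \<subseteq> T"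
  shows "p ` (\<Inter>n::nat. \<Union>k::nat. C n k) \<in> sets lebesgue"
proof -
  define A where "A = (\<Inter>n. \<Union>k. C n k)"
  have comp: "compact (p ` K)" if "compact K" for K
    using that p by (meson compact_continuous_image continuous_on_subset subset_UNIV)
  obtain E where E: "E \<in> sets lborel" "p ` A \<subseteq> E" "outer_measure_of lborel (p ` A) = emeasure lborel E"
    using outer_measure_of_attain[of "p ` A" lborel] by auto
  have "A \<subseteq> T" using T(2) by (fastforce simp: A_def)
  then have "outer_measure_of lborel (p ` A) \<le> emeasure lborel (p ` T)"
    using outer_measure_of_mono[of "p ` A" "p ` T" lborel] comp[OF T(1)] by (simp add: borel_compact image_mono)
  then have fin: "emeasure lborel E < \<infinity>" using emeasure_compact_finite[OF comp[OF T(1)]] E by auto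
  define \<K> where "\<K> = {K. compact K \<and> K \<subseteq> A}"
  have "\<K> \<noteq> {}" by (auto simp: \<K>_def)
  then obtain g where g: "range g \<subseteq> (\<lambda>K. emeasure lborel (p ` K)) ` \<K>"
      "(SUP K\<in>\<K>. emeasure lborel (p ` K)) = (SUP i::nat. g i)"
    using ennreal_SUP_countable_SUP[of \<K> "\<lambda>K. emeasure lborel (p ` K)"] by blast
  then have "\<forall>i. \<exists>K\<in>\<K>. g i = emeasure lborel (p ` K)" by blast
  then obtain K where K: "\<And>i. K i \<in> \<K>" "\<And>i. g i = emeasure lborel (p ` K i)" by metis
  define F where "F = (\<Union>i. p ` K i)"
  have F: "F \<in> sets lborel" unfolding F_def using K(1) comp
    by (intro sets.countable_UN) (auto simp: \<K>_def intro: borel_compact)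
  have FA: "F \<subseteq> p ` A" using K(1) by (auto simp: F_def \<K>_def)
  have "emeasure lborel E \<le> (SUP K\<in>\<K>. emeasure lborel (p ` K))"
  proof (rule dense_le)
    fix \<alpha> assume "\<alpha> < emeasure lborel E"
    then have "\<alpha> < outer_measure_of lborel (p ` (\<Inter>n. \<Union>k. C n k))" using E by (simp add: A_def)
    then obtain K where "compact K" "K \<subseteq> (\<Inter>n. \<Union>k. C n k)" "\<alpha> \<le> emeasure lborel (p ` K)"
      by (rule inner_regular_image_Fsigma_delta[OF p C T])
    then show "\<alpha> \<le> (SUP K\<in>\<K>. emeasure lborel (p ` K))"
      by (intro SUP_upper2[of K]) (auto simp: \<K>_def A_def)
  qed
  also have "\<dots> \<le> emeasure lborel F"
    unfolding g(2) K(2) by (intro SUP_least emeasure_mono F) (auto simp: F_def)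
  finally have le: "emeasure lborel E \<le> emeasure lborel F" .
  have "F \<subseteq> E" using FA E(2) by blast
  then have "emeasure lborel F < \<infinity>" using fin E(1) emeasure_mono[of F E lborel] by (simp add: less_le_trans)
  then have "emeasure lborel (E - F) = 0"
    using le F E(1) \<open>F \<subseteq> E\<close> by (subst emeasure_Diff) (auto simp: diff_eq_0_iff_ennreal)
  then have "E - F \<in> null_sets lborel" using E F by auto
  then have "E - F \<in> null_sets lebesgue" by (rule null_sets_completionI)
  then have "p ` A - F \<in> sets lebesgue"
    using E(2) by (meson Diff_mono null_sets_completion_subset null_setsD2 order_refl)
  moreover have "F \<in> sets lebesgue" using F by simp
  moreover have "p ` A = F \<union> (p ` A - F)" using FA by auto
  ultimately show ?thesis unfolding A_def[symmetric] by (metis sets.Un)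
qed

text \<open>The vector \<open>L\<close> may depend on \<open>n\<close>. Bounding it makes the sets closed, and a limit point of the \<open>L\<close> for
  \<open>n \<rightarrow> \<infinity>\<close> is a gradient.\<close>

definition approx_diff :: "('a::euclidean_space \<Rightarrow> real) \<Rightarrow> 'a set \<Rightarrow> nat \<Rightarrow> nat \<Rightarrow> 'a set" where
  "approx_diff f S n k = {x \<in> S. \<exists>L\<in>cball 0 2. \<forall>y\<in>S. dist x y < 1 / (real k + 1) \<longrightarrow>
     \<bar>f y - f x - L \<bullet> (y - x)\<bar> \<le> dist x y / (real n + 1)}"

text \<open>The set is the first projection of the compact set of pairs \<open>(x, L)\<close> that
  satisfy the condition for every \<open>y\<close>. For fixed \<open>y\<close> the condition is a
  union of two closed alternatives, since the strict inequality in its premise has a closed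
  negation.\<close>

lemma compact_approx_diff:
  fixes f :: "'a::euclidean_space \<Rightarrow> real"
  assumes f: "continuous_on S f" and S: "compact S"
  shows "compact (approx_diff f S n k)"
proof -
  define Q where "Q y = {z \<in> S \<times> cball 0 2. 1 / (real k + 1) \<le> dist (fst z) y} \<union>
    {z \<in> S \<times> cball 0 2. \<bar>f y - f (fst z) - snd z \<bullet> (y - fst z)\<bar> \<le> dist (fst z) y / (real n + 1)}" for y :: 'a
  have cl: "closed (S \<times> cball (0::'a) 2)" using S by (intro closed_Times compact_imp_closed closed_cball)
  have cf: "continuous_on (S \<times> cball (0::'a) 2) (\<lambda>z. f (fst z))"
    by (rule continuous_on_compose2[OF f continuous_on_fst[OF continuous_on_id]]) auto
  have "closed (Q y)" for y
    unfolding Q_def by (intro closed_Un continuous_on_closed_Collect_le continuous_intros cf cl ballI) auto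
  then have "compact ((S \<times> cball (0::'a) 2) \<inter> (\<Inter>y\<in>S. Q y))"
    using S by (intro compact_Int_closed compact_Times compact_cball closed_INT) auto
  then have "compact (fst ` ((S \<times> cball (0::'a) 2) \<inter> (\<Inter>y\<in>S. Q y)))"
    by (intro compact_continuous_image continuous_on_fst continuous_on_id)
  also have "fst ` ((S \<times> cball (0::'a) 2) \<inter> (\<Inter>y\<in>S. Q y)) = approx_diff f S n k"
  proof (intro equalityI subsetI)
    fix x assume "x \<in> fst ` ((S \<times> cball (0::'a) 2) \<inter> (\<Inter>y\<in>S. Q y))"
    then obtain L where L: "x \<in> S" "L \<in> cball 0 2" "\<And>y. y \<in> S \<Longrightarrow> (x, L) \<in> Q y" by auto
    have "\<bar>f y - f x - L \<bullet> (y - x)\<bar> \<le> dist x y / (real n + 1)"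
      if "y \<in> S" "dist x y < 1 / (real k + 1)" for y
      using L(3)[OF that(1)] that(2) by (simp add: Q_def)
    then show "x \<in> approx_diff f S n k" using L unfolding approx_diff_def by blast
  next
    fix x assume "x \<in> approx_diff f S n k"
    then obtain L where "x \<in> S" "L \<in> cball 0 2" "\<And>y. y\<in>S \<Longrightarrow> dist x y < 1 / (real k + 1) \<Longrightarrow>
     \<bar>f y - f x - L \<bullet> (y - x)\<bar> \<le> dist x y / (real n + 1)" by (auto simp: approx_diff_def)
    then show "x \<in> fst ` ((S \<times> cball (0::'a) 2) \<inter> (\<Inter>y\<in>S. Q y))"
      by (intro image_eqI[of _ _ "(x, L)"]) (auto simp: Q_def not_less[symmetric])
  qed
  finally show ?thesis .
qed

lemma differentiable_approx_diff:
  fixes f :: "'a::euclidean_space \<Rightarrow> real"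
  assumes "x \<in> (\<Inter>n. \<Union>k. approx_diff f S n k)"
  shows "f differentiable (at x within S)"
proof -
  have "\<forall>n. \<exists>k L. L \<in> cball 0 2 \<and> (\<forall>y\<in>S. dist x y < 1 / (real k + 1) \<longrightarrow>
     \<bar>f y - f x - L \<bullet> (y - x)\<bar> \<le> dist x y / (real n + 1))"
    using assms by (fastforce simp: approx_diff_def)
  then obtain k L where kL: "\<And>n. L n \<in> cball 0 2" "\<And>n y. y \<in> S \<Longrightarrow> dist x y < 1 / (real (k n) + 1) \<Longrightarrow>
     \<bar>f y - f x - L n \<bullet> (y - x)\<bar> \<le> dist x y / (real n + 1)" by metis
  obtain l r where lr: "strict_mono (r :: nat \<Rightarrow> nat)" "(L \<circ> r) \<longlonglongrightarrow> l"
    using compact_cball[of "0::'a" 2] kL(1) unfolding compact_def by metis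
  have "(f has_derivative (\<lambda>v. l \<bullet> v)) (at x within S)"
    unfolding has_derivative_within_alt
  proof (intro conjI allI impI)
    show "bounded_linear (\<lambda>v. l \<bullet> v)" by (rule bounded_linear_inner_right)
    fix e :: real assume "0 < e"
    have "\<forall>\<^sub>F n in sequentially. dist (L (r n)) l < e / 2"
      using tendstoD[OF lr(2), of "e/2"] \<open>0 < e\<close> by simp
    moreover have "\<forall>\<^sub>F n in sequentially. 1 / (real n + 1) < e / 2"
    proof -
      have "\<forall>\<^sub>F n in sequentially. inverse (real (Suc n)) < e / 2"
        using order_tendstoD(2)[OF LIMSEQ_inverse_real_of_nat, of "e / 2"] \<open>0 < e\<close> by simp
      then show ?thesis by (simp add: inverse_eq_divide add.commute)
    qed
    ultimately have "\<forall>\<^sub>F n in sequentially. dist (L (r n)) l < e / 2 \<and> 1 / (real n + 1) < e / 2"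
      by (rule eventually_conj)
    then obtain n where n: "dist (L (r n)) l < e / 2" "1 / (real n + 1) < e / 2"
      using eventually_happens by fastforce
    have "1 / (real (r n) + 1) \<le> 1 / (real n + 1)"
      using seq_suble[OF lr(1), of n] by (intro divide_left_mono) auto
    then have rn: "1 / (real (r n) + 1) < e / 2" using n by linarith
    show "\<exists>d>0. \<forall>y\<in>S. norm (y - x) < d \<longrightarrow> norm (f y - f x - l \<bullet> (y - x)) \<le> e * norm (y - x)"
    proof (intro exI[of _ "1 / (real (k (r n)) + 1)"] conjI ballI impI)
      fix y assume y: "y \<in> S" "norm (y - x) < 1 / (real (k (r n)) + 1)"
      then have "\<bar>f y - f x - L (r n) \<bullet> (y - x)\<bar> \<le> dist x y / (real (r n) + 1)"
        using kL(2)[of y "r n"] by (simp add: dist_norm norm_minus_commute)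
      also have "\<dots> = (1 / (real (r n) + 1)) * norm (y - x)" by (simp add: dist_norm norm_minus_commute)
      also have "\<dots> \<le> e / 2 * norm (y - x)" using rn by (intro mult_right_mono) auto
      finally have 1: "\<bar>f y - f x - L (r n) \<bullet> (y - x)\<bar> \<le> e / 2 * norm (y - x)" .
      have "\<bar>(L (r n) - l) \<bullet> (y - x)\<bar> \<le> norm (L (r n) - l) * norm (y - x)"
        by (rule Cauchy_Schwarz_ineq2)
      also have "\<dots> \<le> e / 2 * norm (y - x)" using n by (intro mult_right_mono) (auto simp: dist_norm)
      finally have 2: "\<bar>(L (r n) - l) \<bullet> (y - x)\<bar> \<le> e / 2 * norm (y - x)" .
      have "f y - f x - l \<bullet> (y - x) = (f y - f x - L (r n) \<bullet> (y - x)) + (L (r n) - l) \<bullet> (y - x)"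
        by (simp add: inner_diff_left)
      then have "\<bar>f y - f x - l \<bullet> (y - x)\<bar> \<le> e / 2 * norm (y - x) + e / 2 * norm (y - x)"
        using 1 2 by linarith
      then show "norm (f y - f x - l \<bullet> (y - x)) \<le> e * norm (y - x)"
        by (simp add: distrib_right[symmetric])
    qed simp
  qed
  then show ?thesis by (auto simp: differentiable_def)
qed

lemma approx_diff_differentiable:
  fixes f :: "'a::euclidean_space \<Rightarrow> real"
  assumes f: "1-lipschitz_on S f" and x: "x \<in> interior S" and diff: "f differentiable (at x)"
  shows "x \<in> (\<Inter>n. \<Union>k. approx_diff f S n k)"
proof -
  obtain f' where f': "(f has_derivative f') (at x)" using diff by (auto simp: differentiable_def)
  define L where "L = (\<Sum>b\<in>Basis. f' b *\<^sub>R b)"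
  have lin: "linear f'" using f' by (rule has_derivative_linear)
  have f'L: "f' v = L \<bullet> v" for v
  proof -
    have "f' v = f' (\<Sum>b\<in>Basis. (v \<bullet> b) *\<^sub>R b)" by (simp add: euclidean_representation)
    also have "\<dots> = (\<Sum>b\<in>Basis. (v \<bullet> b) * f' b)"
      using lin by (simp add: linear_sum linear_cmul)
    also have "\<dots> = L \<bullet> v" by (simp add: L_def inner_sum_left inner_commute[of v] mult.commute)
    finally show ?thesis .
  qed
  have alt: "\<And>e. 0 < e \<Longrightarrow> \<exists>d>0. \<forall>y. norm (y - x) < d \<longrightarrow> norm (f y - f x - L \<bullet> (y - x)) \<le> e * norm (y - x)"
    using f' unfolding has_derivative_at_alt f'L by blast
  obtain s where s: "0 < s" "ball x s \<subseteq> S" using x by (auto simp: mem_interior)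
  have "x \<in> S" using x interior_subset by blast
  have "norm L \<le> 2"
  proof (rule ccontr)
    assume L2: "\<not> norm L \<le> 2"
    \<comment> \<open>The radius 2 in \<open>approx_diff\<close> comes from tolerance 1 here: along
      \<open>L\<close> the increment of \<open>f\<close> is at most \<open>t * norm L\<close>, and
      the linear part \<open>t * (norm L)\<^sup>2\<close> differs from it by no more than
      that.\<close>
    obtain d where d: "d > 0" "\<And>y. norm (y - x) < d \<Longrightarrow> norm (f y - f x - L \<bullet> (y - x)) \<le> 1 * norm (y - x)"
      using alt[of 1] by auto
    define t where "t = min d s / (2 * norm L)"
    have t: "0 < t" "t * norm L < d" "t * norm L < s" 
    proof -
      have L: "0 < norm L" using L2 by linarith
      show "0 < t" using d s L unfolding t_def by (intro divide_pos_pos) auto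
      have "t * norm L = min d s / 2" using L by (simp add: t_def)
      then show "t * norm L < d" "t * norm L < s" using d s by auto
    qed
    define y where "y = x + t *\<^sub>R L"
    have ny: "norm (y - x) = t * norm L" using t(1) by (simp add: y_def)
    have "y \<in> S" using s(2) t(3) ny by (auto simp: subset_iff dist_norm norm_minus_commute)
    then have 1: "\<bar>f y - f x\<bar> \<le> t * norm L"
      using lipschitz_onD[OF f \<open>y \<in> S\<close> \<open>x \<in> S\<close>] ny by (simp add: dist_real_def dist_norm)
    have "L \<bullet> (y - x) = t * (norm L)\<^sup>2" by (simp add: y_def power2_norm_eq_inner)
    then have 2: "\<bar>f y - f x - t * (norm L)\<^sup>2\<bar> \<le> t * norm L"
      using d(2)[of y] unfolding ny using t(2) by simp
    from 1 2 have "t * (norm L)\<^sup>2 \<le> t * (2 * norm L)" by (simp add: abs_le_iff)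
    then have "(norm L)\<^sup>2 \<le> 2 * norm L" using t(1) by simp
    then have "norm L * norm L \<le> 2 * norm L" by (simp add: power2_eq_square)
    then show False using L2 mult_right_le_imp_le[of "norm L" "norm L" 2] by linarith
  qed
  have "x \<in> (\<Union>k. approx_diff f S n k)" for n
  proof -
    obtain d where d: "d > 0" "\<And>y. norm (y - x) < d \<Longrightarrow>
        norm (f y - f x - L \<bullet> (y - x)) \<le> 1 / (real n + 1) * norm (y - x)"
      using alt[of "1 / (real n + 1)"] by auto
    obtain k where "1 / (real k + 1) < d" using d(1) by (metis add.commute nat_approx_posE of_nat_Suc)
    then have "x \<in> approx_diff f S n k"
      unfolding approx_diff_def using d(2) \<open>x \<in> S\<close> \<open>norm L \<le> 2\<close>
      by (auto simp: dist_norm norm_minus_commute intro!: bexI[of _ L])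
    then show ?thesis by blast
  qed
  then show ?thesis by blast
qed

section \<open>Lipschitz projections and Hausdorff measure\<close>

lemma outer_measure_of_UN_null:
  assumes "\<And>n::nat. outer_measure_of M (A n) = 0" "\<And>n. A n \<subseteq> space M"
  shows "outer_measure_of M (\<Union>n. A n) = 0"
proof -
  have "\<forall>n. \<exists>E\<in>sets M. A n \<subseteq> E \<and> emeasure M E = 0"
    using outer_measure_of_attain[OF assms(2)] assms(1) by metis
  then obtain E where E: "\<And>n. E n \<in> sets M" "\<And>n. A n \<subseteq> E n" "\<And>n. emeasure M (E n) = 0" by metis
  have "outer_measure_of M (\<Union>n. A n) \<le> outer_measure_of M (\<Union>n. E n)"
    using E by (intro outer_measure_of_mono) blast
  also have "\<dots> = emeasure M (\<Union>n. E n)" using E by auto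
  also have "\<dots> = 0" using E by (intro emeasure_UN_eq_0) auto
  finally show ?thesis by simp
qed

lemma emeasure_lborel_cball_real: "0 \<le> r \<Longrightarrow> emeasure lborel (cball (x::real) r) = ennreal (2 * r)"
  by (simp add: cball_eq_atLeastAtMost)

lemma finite_disjoint_compact_separated:
  fixes A :: "'i \<Rightarrow> 'a::heine_borel set"
  assumes F: "finite F" and A: "\<And>i. i \<in> F \<Longrightarrow> compact (A i)" "disjoint_family_on A F"
  obtains \<delta> where "\<delta> > 0" "\<And>i j x y. i \<in> F \<Longrightarrow> j \<in> F \<Longrightarrow> i \<noteq> j \<Longrightarrow> x \<in> A i \<Longrightarrow> y \<in> A j \<Longrightarrow> \<delta> < dist x y"
proof -
  have "\<exists>d>0. \<forall>x\<in>A i. \<forall>y\<in>A j. d < dist x y" if "i \<in> F" "j \<in> F" "i \<noteq> j" for i j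
  proof -
    have "\<exists>d>0. \<forall>x\<in>A i. \<forall>y\<in>A j. d \<le> dist x y"
      using that A by (intro separate_compact_closed) (auto simp: disjoint_family_on_def intro: compact_imp_closed)
    then obtain d where "d > 0" "\<And>x y. x \<in> A i \<Longrightarrow> y \<in> A j \<Longrightarrow> d \<le> dist x y" by blast
    then show ?thesis by (intro exI[of _ "d/2"]) force
  qed
  then obtain d where d: "\<And>i j. i \<in> F \<Longrightarrow> j \<in> F \<Longrightarrow> i \<noteq> j \<Longrightarrow> d i j > (0::real)"
    "\<And>i j x y. i \<in> F \<Longrightarrow> j \<in> F \<Longrightarrow> i \<noteq> j \<Longrightarrow> x \<in> A i \<Longrightarrow> y \<in> A j \<Longrightarrow> d i j < dist x y" by metis
  define P where "P = {(i, j). i \<in> F \<and> j \<in> F \<and> i \<noteq> j}"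
  have P: "finite P" unfolding P_def using F by (rule_tac finite_subset[of _ "F \<times> F"]) auto
  \<comment> \<open>The inserted 1 keeps the minimum defined when there is no pair of distinct
    indices.\<close>
  define \<delta> where "\<delta> = Min (insert 1 ((\<lambda>(i, j). d i j) ` P))"
  show ?thesis
  proof (rule that[of \<delta>])
    show "\<delta> > 0" unfolding \<delta>_def using P d(1) by (subst Min_gr_iff) (auto simp: P_def)
    fix i j x y assume *: "i \<in> F" "j \<in> F" "i \<noteq> j" "x \<in> A i" "y \<in> A j"
    have "\<delta> \<le> d i j" unfolding \<delta>_def using P *
      by (intro Min_le) (auto simp: P_def intro!: image_eqI[of _ _ "(i, j)"])
    then show "\<delta> < dist x y" using d(2)[OF *] by simp
  qed
qed

text \<open>Each covering set that meets \<open>B\<close> is replaced by an interval around the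
  image of one of its points, with radius \<open>L\<close> times the diameter. Sets that miss
  \<open>B\<close> cost nothing, which lets one cover be shared among separated pieces.\<close>

lemma outer_measure_image_le_cover:
  fixes q :: "'a::heine_borel \<Rightarrow> real" and E :: "nat \<Rightarrow> 'a set"
  assumes q: "\<And>x y. dist (q x) (q y) \<le> L * dist x y" and L: "0 \<le> L"
    and E: "B \<subseteq> (\<Union>k. E k)" "\<And>k. bounded (E k)"
  shows "outer_measure_of lborel (q ` B) \<le>
    (\<Sum>k. if E k \<inter> B = {} then 0 else ennreal (2 * L * diameter (E k)))"
proof -
  have "\<forall>k. \<exists>z. E k \<inter> B \<noteq> {} \<longrightarrow> z \<in> E k" by blast
  then obtain z where z: "\<And>k. E k \<inter> B \<noteq> {} \<Longrightarrow> z k \<in> E k" by metis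
  define I where "I k = (if E k \<inter> B = {} then {} else cball (q (z k)) (L * diameter (E k)))" for k
  have "q ` B \<subseteq> (\<Union>k. I k)"
  proof
    fix y assume "y \<in> q ` B"
    then obtain x where x: "x \<in> B" "y = q x" by blast
    then obtain k where k: "x \<in> E k" using E by blast
    have "dist (q (z k)) (q x) \<le> L * dist (z k) x" by (rule q)
    also have "\<dots> \<le> L * diameter (E k)"
      using k x z[of k] E(2)[of k] L by (intro mult_left_mono diameter_bounded_bound) auto
    finally show "y \<in> (\<Union>k. I k)" using k x by (auto simp: I_def)
  qed
  then have "outer_measure_of lborel (q ` B) \<le> outer_measure_of lborel (\<Union>k. I k)"
    by (rule outer_measure_of_mono)
  also have I: "range I \<subseteq> sets lborel" by (auto simp: I_def)
  then have "outer_measure_of lborel (\<Union>k. I k) = emeasure lborel (\<Union>k. I k)"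
    by (intro outer_measure_of_eq sets.countable_UN) 
  also have "\<dots> \<le> (\<Sum>k. emeasure lborel (I k))"
    using I by (rule emeasure_subadditive_countably)
  also have "\<dots> = (\<Sum>k. if E k \<inter> B = {} then 0 else ennreal (2 * L * diameter (E k)))"
    using L E(2) by (intro suminf_cong)
      (auto simp: I_def emeasure_lborel_cball_real diameter_ge_0 mult.assoc)
  finally show ?thesis .
qed

text \<open>Finitely many of the compact sets \<open>A i\<close> are a positive distance apart, so a fine cover of a set splits
  into disjoint subcovers of its parts in the \<open>A i\<close>.\<close>

lemma sum_outer_measure_image_le_hausdorff1:
  fixes A :: "'i \<Rightarrow> 'a::heine_borel set" and p :: "'i \<Rightarrow> 'a \<Rightarrow> real"
  assumes F: "finite F" and A: "\<And>i. i \<in> F \<Longrightarrow> compact (A i)" "disjoint_family_on A F"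
    and p: "\<And>i x y. i \<in> F \<Longrightarrow> dist (p i x) (p i y) \<le> L * dist x y" and L: "0 < L"
  shows "(\<Sum>i\<in>F. outer_measure_of lborel (p i ` (A i \<inter> B))) / ennreal (2 * L) \<le> hausdorff1 B"
proof -
  obtain \<delta> where \<delta>: "\<delta> > 0"
    "\<And>i j x y. i \<in> F \<Longrightarrow> j \<in> F \<Longrightarrow> i \<noteq> j \<Longrightarrow> x \<in> A i \<Longrightarrow> y \<in> A j \<Longrightarrow> \<delta> < dist x y"
    using finite_disjoint_compact_separated[OF F A] by blast
  have key: "(\<Sum>i\<in>F. outer_measure_of lborel (p i ` (A i \<inter> B))) \<le> ennreal (2 * L) * (\<Sum>k. ennreal (diameter (E k)))"
    if E: "B \<subseteq> (\<Union>k. E k)" "\<And>k. bounded (E k)" "\<And>k. diameter (E k) \<le> \<delta>" for E :: "nat \<Rightarrow> 'a set"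
  proof -
    define c where "c i k = (if E k \<inter> (A i \<inter> B) = {} then 0 else ennreal (2 * L * diameter (E k)))" for i k
    have "(\<Sum>i\<in>F. outer_measure_of lborel (p i ` (A i \<inter> B))) \<le> (\<Sum>i\<in>F. \<Sum>k. c i k)"
      unfolding c_def using E p less_imp_le[OF L] by (intro sum_mono outer_measure_image_le_cover) auto
    also have "\<dots> = (\<Sum>k. \<Sum>i\<in>F. c i k)" by (simp add: suminf_sum)
    also have "\<dots> \<le> (\<Sum>k. ennreal (2 * L * diameter (E k)))"
    proof (intro suminf_le)
      fix k
      show "(\<Sum>i\<in>F. c i k) \<le> ennreal (2 * L * diameter (E k))"
      proof (cases "\<exists>i\<in>F. E k \<inter> (A i \<inter> B) \<noteq> {}")
        case True
        then obtain i where i: "i \<in> F" "E k \<inter> (A i \<inter> B) \<noteq> {}" by blast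
        have "c j k = 0" if j: "j \<in> F - {i}" for j
        proof (rule ccontr)
          assume "c j k \<noteq> 0"
          then obtain x y where "x \<in> E k" "x \<in> A i" "y \<in> E k" "y \<in> A j"
            using i by (auto simp: c_def split: if_splits)
          then show False
            using \<delta>(2)[of i j x y] i j diameter_bounded_bound[OF E(2)[of k], of x y] E(3)[of k] by auto
        qed
        then have "(\<Sum>i\<in>F. c i k) = c i k" using F i(1) by (simp add: sum.remove)
        then show ?thesis by (simp add: c_def)
      qed (simp add: c_def)
    qed auto
    also have "\<dots> = (\<Sum>k. ennreal (2 * L) * ennreal (diameter (E k)))"
      using L E(2) by (intro suminf_cong) (simp add: ennreal_mult diameter_ge_0)
    also have "\<dots> = ennreal (2 * L) * (\<Sum>k. ennreal (diameter (E k)))" by simp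
    finally show ?thesis .
  qed
  have "(\<Sum>i\<in>F. outer_measure_of lborel (p i ` (A i \<inter> B))) / ennreal (2 * L) \<le> hausdorff1_delta \<delta> B"
    unfolding hausdorff1_delta_def using key L
    by (intro INF_greatest divide_le_posI_ennreal) auto
  also have "\<dots> \<le> hausdorff1 B"
    unfolding hausdorff1_def using \<delta>(1) by (intro SUP_upper) auto
  finally show ?thesis .
qed

text \<open>Pigeonhole: among countably many pieces of finite measure, one piece \<open>B n\<close>
  would meet uncountably many \<open>A i\<close> in sets whose projections have outer measure at
  least a fixed \<open>1 / (m + 1)\<close>. Sufficiently many of these already exceed the measure of
  \<open>B n\<close>.\<close>

lemma not_sigma_finite_hausdorff1I:
  fixes A :: "'i \<Rightarrow> 'a::heine_borel set" and p :: "'i \<Rightarrow> 'a \<Rightarrow> real"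
  assumes I: "uncountable I" and A: "\<And>i. i \<in> I \<Longrightarrow> compact (A i)" "disjoint_family_on A I" "\<And>i. i \<in> I \<Longrightarrow> A i \<subseteq> D"
    and p: "\<And>i x y. i \<in> I \<Longrightarrow> dist (p i x) (p i y) \<le> L * dist x y" and L: "0 < L"
    and pos: "\<And>i. i \<in> I \<Longrightarrow> outer_measure_of lborel (p i ` A i) \<noteq> 0"
  shows "\<not> sigma_finite_hausdorff1 D"
proof
  assume "sigma_finite_hausdorff1 D"
  then obtain B where B: "D = (\<Union>n::nat. B n)" "\<And>n. hausdorff1 (B n) < \<infinity>"
    by (auto simp: sigma_finite_hausdorff1_def)
  define J where "J n m = {i \<in> I. ennreal (1 / (real m + 1)) \<le> outer_measure_of lborel (p i ` (A i \<inter> B n))}" for n m :: nat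
  have "I \<subseteq> (\<Union>n. \<Union>m. J n m)"
  proof
    fix i assume i: "i \<in> I"
    have "\<exists>n. outer_measure_of lborel (p i ` (A i \<inter> B n)) \<noteq> 0"
    proof (rule ccontr)
      assume "\<nexists>n. outer_measure_of lborel (p i ` (A i \<inter> B n)) \<noteq> 0"
      then have "outer_measure_of lborel (\<Union>n. p i ` (A i \<inter> B n)) = 0"
        by (intro outer_measure_of_UN_null) auto
      moreover have "(\<Union>n. p i ` (A i \<inter> B n)) = p i ` A i" using A(3)[OF i] B(1) by blast
      ultimately show False using pos[OF i] by simp
    qed
    then obtain n where "0 < outer_measure_of lborel (p i ` (A i \<inter> B n))" by (auto simp: zero_less_iff_neq_zero)
    then obtain m :: nat where "ennreal (1 / (real m + 1)) \<le> outer_measure_of lborel (p i ` (A i \<inter> B n))"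
    proof (cases "outer_measure_of lborel (p i ` (A i \<inter> B n))")
      case (real r)
      then have "0 < r" using \<open>0 < outer_measure_of lborel (p i ` (A i \<inter> B n))\<close> by simp
      then obtain m where "1 / (real (Suc m)) < r" using nat_approx_posE by blast
      then show ?thesis using real that[of m] by (simp add: ennreal_leI add.commute)
    qed simp
    then show "i \<in> (\<Union>n. \<Union>m. J n m)" using i by (auto simp: J_def)
  qed
  then have "uncountable (\<Union>n. \<Union>m. J n m)" using I countable_subset by blast
  then obtain n m where "uncountable (J n m)" by (meson countable_UN countableI_type)
  then have inf: "infinite (J n m)" using uncountable_infinite by blast
  define H where "H = enn2real (hausdorff1 (B n))"
  have H: "hausdorff1 (B n) = ennreal H" "0 \<le> H" using B(2)[of n] by (auto simp: H_def)
  obtain N :: nat where N: "2 * L * H * (real m + 1) < real N" using reals_Archimedean2 by blast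
  obtain F where F: "F \<subseteq> J n m" "finite F" "card F = N"
    using infinite_arbitrarily_large[OF inf] by blast
  then have FI: "F \<subseteq> I" by (auto simp: J_def)
  have dF: "disjoint_family_on A F" using A(2) FI by (auto simp: disjoint_family_on_def)
  have "ennreal (real N / (real m + 1)) = (\<Sum>i\<in>F. ennreal (1 / (real m + 1)))"
    using F by (simp add: ennreal_of_nat_eq_real_of_nat ennreal_mult[symmetric])
  also have "\<dots> \<le> (\<Sum>i\<in>F. outer_measure_of lborel (p i ` (A i \<inter> B n)))"
    using F by (intro sum_mono) (auto simp: J_def)
  finally have "ennreal (real N / (real m + 1)) / ennreal (2 * L) \<le>
      (\<Sum>i\<in>F. outer_measure_of lborel (p i ` (A i \<inter> B n))) / ennreal (2 * L)"
    by (rule divide_right_mono_ennreal)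
  also have "\<dots> \<le> hausdorff1 (B n)"
    using FI F(2) A(1) p L dF by (intro sum_outer_measure_image_le_hausdorff1) auto
  finally have "real N / (real m + 1) / (2 * L) \<le> H"
    using H L by (simp add: divide_ennreal ennreal_le_iff)
  then have "real N / ((real m + 1) * (2 * L)) \<le> H" by simp
  then have "real N \<le> H * ((real m + 1) * (2 * L))" using L by (subst (asm) pos_divide_le_eq) auto
  then show False using N by (simp add: algebra_simps)
qed

section \<open>The pattern of segments\<close>

text \<open>Level \<open>m\<close> consists of columns at distance \<open>gap m\<close>, each carrying vertical segments of length \<open>len m\<close> with
  period \<open>per m\<close>. Strips of \<open>(lev m)\<^sup>2\<close> consecutive columns are of a kind \<open>l\<close> that runs cyclically through
  \<open>0, \<dots>, 2 lev m\<close>; within a strip of kind \<open>l\<close> the segments lie along lines of slope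
  \<open>1 / lev m - slp m l\<close>, which suits the projections along \<open>y + \<mu> x\<close> with \<open>slp m l \<le> \<mu> \<le> slp m l + 1 / lev m\<close>.\<close>

definition lev :: "nat \<Rightarrow> nat" where "lev m = 2 ^ (m + 3)"
definition gap :: "nat \<Rightarrow> real" where "gap m = 1 / real (lev m) ^ 4"
definition len :: "nat \<Rightarrow> real" where "len m = 2 / real (lev m) ^ 5"
definition per :: "nat \<Rightarrow> real" where "per m = 1 / real (lev m) ^ 3"
definition slp :: "nat \<Rightarrow> nat \<Rightarrow> real" where "slp m l = real l / real (lev m) - 1"
definition sector :: "nat \<Rightarrow> real \<Rightarrow> nat" where "sector m \<mu> = nat \<lfloor>(\<mu> + 1) * real (lev m)\<rfloor>"
definition kind :: "nat \<Rightarrow> nat \<Rightarrow> nat" where "kind m i = (i div (lev m)\<^sup>2) mod (2 * lev m + 1)"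
definition xpos :: "nat \<Rightarrow> nat \<Rightarrow> real" where "xpos m i = real i * gap m"
definition ypos :: "nat \<Rightarrow> nat \<Rightarrow> int \<Rightarrow> real" where
  "ypos m i j = real (i mod (lev m)\<^sup>2) * gap m * (1 / real (lev m) - slp m (kind m i)) + per m * of_int j"
text \<open>The margins keep the tripled segment, from \<open>ypos m i j - len m\<close> to
  \<open>ypos m i j + 2 * len m\<close>, and a strip of half width \<open>len m\<close> around it
  inside the open square.\<close>

definition idx :: "nat \<Rightarrow> (nat \<times> int) set" where
  "idx m = {(i, j). 0 < xpos m i - len m \<and> xpos m i + len m < 1 \<and> 0 < ypos m i j - len m \<and> ypos m i j + 2 * len m < 1}"

abbreviation "xc m s \<equiv> xpos m (fst s)"
abbreviation "yc m s \<equiv> ypos m (fst s) (snd s)"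

lemma lev_ge_8: "8 \<le> lev m"
proof -
  have "(2::nat) ^ 3 \<le> 2 ^ (m + 3)" by (rule power_increasing) auto
  then show ?thesis by (simp add: lev_def)
qed

lemma lev_pos [simp]: "0 < lev m" by (simp add: lev_def)

lemma lev_ge_8_real: "8 \<le> real (lev m)"
  using lev_ge_8[of m] by (metis of_nat_le_iff of_nat_numeral)

lemma gap_pos [simp]: "0 < gap m" and len_pos [simp]: "0 < len m" and per_pos [simp]: "0 < per m"
  by (auto simp: gap_def len_def per_def)

text \<open>The exponents are chosen for these ratios. As \<open>gap m\<close> is
  \<open>lev m / 2\<close> times \<open>len m\<close>, a curve spends a proportion of order
  \<open>1 / lev m\<close> of its time near level \<open>m\<close>, which is summable; and
  \<open>(lev m)\<^sup>2\<close> steps of size \<open>gap m / lev m\<close> make one period.\<close>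

lemma len_eq: "len m = 2 * gap m / real (lev m)" and per_eq: "per m = gap m * real (lev m)"
  by (simp_all add: gap_def len_def per_def field_simps eval_nat_numeral)

lemma gap_le: "8 * gap m \<le> per m"
  unfolding per_eq using lev_ge_8_real[of m] by (simp add: mult.commute)

lemma len_le: "4 * len m \<le> gap m"
proof -
  have "8 / real (lev m) \<le> 1" using lev_ge_8_real[of m] by simp
  then have "gap m * (8 / real (lev m)) \<le> gap m * 1" by (intro mult_left_mono) (auto intro: less_imp_le)
  then show ?thesis by (simp add: len_eq mult.commute)
qed

lemma per_le_1: "per m \<le> 1"
  using lev_ge_8_real[of m] unfolding per_def by simp

lemma len_le_inverse_lev: "len m \<le> 1 / real (lev m)"
proof -
  have "gap m * 2 \<le> 1" using gap_le[of m] per_le_1[of m] gap_pos[of m] by linarith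
  then have "2 * gap m / real (lev m) \<le> 1 / real (lev m)" by (intro divide_right_mono) auto
  then show ?thesis by (simp add: len_eq)
qed

lemma inverse_lev_eq: "1 / real (lev m) = (1 / 8) * (1 / 2) ^ m"
  by (simp add: lev_def power_add power_one_over field_simps)

lemma eventually_lev_small: "0 < e \<Longrightarrow> \<forall>\<^sub>F m in sequentially. 1 / real (lev m) < e"
proof -
  assume "0 < e"
  have "(\<lambda>m. (1 / 8) * (1 / 2) ^ m) \<longlonglongrightarrow> (1 / 8) * (0::real)"
    by (intro tendsto_mult_left LIMSEQ_power_zero) auto
  then show ?thesis unfolding inverse_lev_eq using \<open>0 < e\<close> by (intro order_tendstoD(2)) auto
qed

lemma len_Suc: "len (Suc m) = len m / 32"
proof -
  have "real (lev (Suc m)) = 2 * real (lev m)" by (simp add: lev_def power_add)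
  then show ?thesis by (simp add: len_def power_mult_distrib)
qed

lemma finite_idx: "finite (idx m)"
proof (rule finite_subset)
  show "idx m \<subseteq> (\<Union>i\<in>{..<(lev m)^4}. {i} \<times> {\<lfloor>(0 - ypos m i 0) / per m\<rfloor>..\<lceil>(1 - ypos m i 0) / per m\<rceil>})"
  proof
    fix s assume "s \<in> idx m"
    obtain i j where sij: "s = (i, j)" by (cases s)
    then have "0 < xpos m i - len m \<and> xpos m i + len m < 1 \<and> 0 < ypos m i j - len m \<and> ypos m i j + 2 * len m < 1"
      using \<open>s \<in> idx m\<close> by (simp add: idx_def)
    then have s: "s = (i, j)" "xpos m i < 1" "0 < ypos m i j" "ypos m i j < 1"
      using sij len_pos[of m] by (simp, linarith, linarith, linarith)
    have "real i < real ((lev m)^4)" using s(2) by (simp add: xpos_def gap_def field_simps)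
    then have i: "i < (lev m)^4" by (simp only: of_nat_less_iff)
    have r: "ypos m i j = ypos m i 0 + per m * of_int j" by (simp add: ypos_def)
    have "(0 - ypos m i 0) / per m \<le> of_int j" "of_int j \<le> (1 - ypos m i 0) / per m"
      using s r by (simp_all add: field_simps)
    then have "\<lfloor>(0 - ypos m i 0) / per m\<rfloor> \<le> j" "j \<le> \<lceil>(1 - ypos m i 0) / per m\<rceil>"
      by linarith+
    then show "s \<in> (\<Union>i\<in>{..<(lev m)^4}. {i} \<times> {\<lfloor>(0 - ypos m i 0) / per m\<rfloor>..\<lceil>(1 - ypos m i 0) / per m\<rceil>})"
      using s i by auto
  qed
qed auto

lemma xpos_separated: "i \<noteq> i' \<Longrightarrow> gap m \<le> \<bar>xpos m i - xpos m i'\<bar>"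
proof -
  assume "i \<noteq> i'"
  then have "1 \<le> \<bar>real i - real i'\<bar>" by linarith
  then have "1 * gap m \<le> \<bar>real i - real i'\<bar> * gap m" by (intro mult_right_mono) (auto intro: less_imp_le)
  then show ?thesis by (simp add: xpos_def left_diff_distrib[symmetric] abs_mult less_imp_le)
qed

lemma ypos_separated: "j \<noteq> j' \<Longrightarrow> per m \<le> \<bar>ypos m i j - ypos m i j'\<bar>"
proof -
  assume "j \<noteq> j'"
  then have "1 \<le> \<bar>real_of_int j - real_of_int j'\<bar>" by linarith
  then have "per m * 1 \<le> per m * \<bar>real_of_int j - real_of_int j'\<bar>"
    by (intro mult_left_mono) (auto intro: less_imp_le)
  then show ?thesis by (simp add: ypos_def right_diff_distrib[symmetric] abs_mult less_imp_le)
qed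

text \<open>The direction \<open>\<mu> = 1\<close> falls into the last sector
  \<open>2 * lev m\<close>, which accounts for the odd number of kinds.\<close>

lemma sector_bounds:
  assumes "-1 \<le> \<mu>" "\<mu> \<le> 1"
  shows "sector m \<mu> < 2 * lev m + 1" "slp m (sector m \<mu>) \<le> \<mu>" "\<mu> \<le> slp m (sector m \<mu>) + 1 / real (lev m)"
proof -
  let ?t = "(\<mu> + 1) * real (lev m)"
  have t: "0 \<le> ?t" "?t \<le> 2 * real (lev m)" using assms by (auto intro: mult_right_mono)
  have a: "real (sector m \<mu>) = of_int \<lfloor>?t\<rfloor>" using t by (simp add: sector_def)
  then have b: "real (sector m \<mu>) \<le> ?t" "?t < real (sector m \<mu>) + 1" by linarith+
  from b(1) t(2) have "real (sector m \<mu>) \<le> 2 * real (lev m)" by linarith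
  then show "sector m \<mu> < 2 * lev m + 1" by linarith
  show "slp m (sector m \<mu>) \<le> \<mu>" using b(1) by (simp add: slp_def field_simps)
  show "\<mu> \<le> slp m (sector m \<mu>) + 1 / real (lev m)" using b(2) by (simp add: slp_def field_simps)
qed

lemma sector_neq:
  assumes "-1 \<le> \<mu>" "\<nu> \<le> 1" "1 / real (lev m) < \<nu> - \<mu>"
  shows "sector m \<mu> \<noteq> sector m \<nu>"
proof
  assume eq: "sector m \<mu> = sector m \<nu>"
  have "0 \<le> 1 / real (lev m)" by simp
  then have "\<mu> \<le> \<nu>" using assms(3) by linarith
  then have "\<mu> \<le> 1" "-1 \<le> \<nu>" using assms(1,2) by linarith+
  have "slp m (sector m \<mu>) = slp m (sector m \<nu>)" by (simp add: eq)
  then show False using assms sector_bounds(2)[OF assms(1) \<open>\<mu> \<le> 1\<close>, of m]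
      sector_bounds(3)[OF \<open>-1 \<le> \<nu>\<close> assms(2), of m] by linarith
qed

lemma ex_mod_eq_between:
  fixes n l q :: nat
  assumes "l < n"
  obtains q' where "q \<le> q'" "q' < q + n" "q' mod n = l"
proof (cases "q mod n \<le> l")
  case True
  have "(q + (l - q mod n)) mod n = l"
  proof -
    have "q + (l - q mod n) = n * (q div n) + l" using True mult_div_mod_eq[of n q] by linarith
    then show ?thesis using assms by simp
  qed
  then show ?thesis using True assms by (intro that[of "q + (l - q mod n)"]) auto
next
  case False
  have "(q + (n + l - q mod n)) mod n = l"
  proof -
    have "q mod n < n" using assms by simp
    moreover have "n * (q div n + 1) = n * (q div n) + n" by simp
    ultimately have "q + (n + l - q mod n) = n * (q div n + 1) + l"
      using mult_div_mod_eq[of n q] by linarith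
    then show ?thesis using assms by (simp only: mod_mult_self4 mod_less)
  qed
  then show ?thesis using False assms by (intro that[of "q + (n + l - q mod n)"]) auto
qed

text \<open>Within a strip of kind \<open>sector m \<mu>\<close> the quantity \<open>ypos + \<mu> xpos\<close> advances by between \<open>len m / 2\<close> and
  \<open>len m\<close> from one column to the next, hence by at least a full period \<open>per m\<close> over the strip.\<close>

lemma strip_covers:
  assumes \<mu>: "-1 \<le> \<mu>" "\<mu> \<le> 1" and x: "0 \<le> x"
  obtains i j where "kind m i = sector m \<mu>" "x \<le> xpos m i" "xpos m i \<le> x + 4 / real (lev m)"
    "ypos m i j + \<mu> * xpos m i \<le> z" "z \<le> ypos m i j + \<mu> * xpos m i + len m"
proof -
  define M where "M = lev m"
  have M: "8 \<le> real M" "0 < M" using lev_ge_8_real by (auto simp: M_def)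
  define q0 where "q0 = nat \<lceil>x * real M ^ 2\<rceil>"
  have q0: "x * real M ^ 2 \<le> real q0" "real q0 < x * real M ^ 2 + 1"
    using x unfolding q0_def by (simp_all add: of_nat_nat) linarith+
  \<comment> \<open>At most \<open>2 * M + 1\<close> strips, each of width
    \<open>1 / M\<^sup>2\<close>, are inspected to the right of \<open>x\<close> before the wanted
    kind appears; with the rounding in \<open>q0\<close> and the strip itself this stays below
    \<open>4 / M\<close>.\<close>
  obtain q where q: "q0 \<le> q" "q < q0 + (2 * M + 1)" "q mod (2 * M + 1) = sector m \<mu>"
    using ex_mod_eq_between[OF sector_bounds(1)[OF \<mu>, of m]] unfolding M_def by blast
  define l where "l = sector m \<mu>"
  define s where "s = gap m * (1 / real M - slp m l + \<mu>)"
  have sl: "0 \<le> \<mu> - slp m l" "\<mu> - slp m l \<le> 1 / real M"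
    using sector_bounds[OF \<mu>, of m] by (auto simp: l_def M_def)
  have s: "gap m / real M \<le> s" "s \<le> len m"
  proof -
    have "gap m * (1 / real M) \<le> s" unfolding s_def using sl by (intro mult_left_mono) (auto intro: less_imp_le)
    then show "gap m / real M \<le> s" by simp
    have "s \<le> gap m * (2 / real M)" unfolding s_def using sl by (intro mult_left_mono) (auto intro: less_imp_le)
    then show "s \<le> len m" by (simp add: len_eq M_def mult.commute)
  qed
  have s0: "0 < s" using s(1) M by (smt (verit) divide_pos_pos gap_pos of_nat_0_less_iff)
  \<comment> \<open>After the contribution of the start of the strip is removed, \<open>z\<close>
    consists of \<open>j\<close> full periods and a remainder \<open>r\<close> below
    \<open>per m\<close>; the remainder selects the column \<open>k\<close> within the
    strip.\<close>
  define z' where "z' = z - \<mu> * (real (q * M\<^sup>2) * gap m)"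
  define j where "j = \<lfloor>z' / per m\<rfloor>"
  define r where "r = z' - per m * of_int j"
  have r: "0 \<le> r" "r < per m"
  proof -
    have "of_int j \<le> z' / per m" "z' / per m < of_int j + 1" by (auto simp: j_def)
    then show "0 \<le> r" "r < per m" by (simp_all add: r_def field_simps)
  qed
  define k where "k = nat \<lfloor>r / s\<rfloor>"
  have k: "real k * s \<le> r" "r < real k * s + s"
  proof -
    have "0 \<le> r / s" using r s0 by simp
    then have "real k \<le> r / s" "r / s < real k + 1" unfolding k_def by linarith+
    then show "real k * s \<le> r" "r < real k * s + s" using s0 by (simp_all add: field_simps)
  qed
  have kM: "k < M\<^sup>2"
  proof -
    have "real k * (gap m / real M) \<le> real k * s" using s by (intro mult_left_mono) auto
    also have "\<dots> < per m" using k r by linarith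
    also have "per m = real (M\<^sup>2) * (gap m / real M)"
      using M by (simp add: per_eq M_def[symmetric] power2_eq_square)
    finally have "real k < real (M\<^sup>2)"
      using M(2) by (subst (asm) mult_less_cancel_right_pos) auto
    then show ?thesis by simp
  qed
  define i where "i = q * M\<^sup>2 + k"
  have idiv: "i div M\<^sup>2 = q" "i mod M\<^sup>2 = k" using kM M(2) by (auto simp: i_def div_mult_self3)
  have ty: "kind m i = l" unfolding kind_def M_def[symmetric] idiv l_def by (rule q(3))
  have ci: "xpos m i = (real q * real M ^ 2 + real k) / real M ^ 4"
    by (simp add: xpos_def i_def gap_def M_def)
  have cb: "real q / real M ^ 2 \<le> xpos m i" "xpos m i \<le> (real q + 1) / real M ^ 2"
  proof -
    have e: "real M ^ 4 = real M ^ 2 * real M ^ 2" by (simp add: power_add[symmetric])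
    have "real k \<le> real M ^ 2" using kM by (metis less_imp_le of_nat_le_iff of_nat_power)
    then have "(real q * real M ^ 2 + real k) / (real M ^ 2 * real M ^ 2) \<le> ((real q + 1) * real M ^ 2) / (real M ^ 2 * real M ^ 2)"
      by (intro divide_right_mono) (auto simp: algebra_simps)
    then show "xpos m i \<le> (real q + 1) / real M ^ 2" using M(2) unfolding ci e by (subst (asm) nonzero_mult_divide_mult_cancel_right) auto
    have "(real q * real M ^ 2) / (real M ^ 2 * real M ^ 2) \<le> (real q * real M ^ 2 + real k) / (real M ^ 2 * real M ^ 2)"
      by (intro divide_right_mono) auto
    then show "real q / real M ^ 2 \<le> xpos m i" using M(2) unfolding ci e by (subst (asm) nonzero_mult_divide_mult_cancel_right) auto
  qed
  show ?thesis
  proof (rule that[of i j])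
    show "kind m i = sector m \<mu>" using ty l_def by simp
    have "x \<le> real q / real M ^ 2"
      using q0(1) q(1) M(2) by (simp add: pos_le_divide_eq) 
    then show "x \<le> xpos m i" using cb(1) by linarith
    have "real q + 1 \<le> x * real M ^ 2 + 4 * real M"
      using q0(2) q(2) M(1) by linarith
    then have "(real q + 1) / real M ^ 2 \<le> (x * real M ^ 2 + 4 * real M) / real M ^ 2"
      by (intro divide_right_mono) auto
    also have "\<dots> = x + 4 / real M" using M(2) by (simp add: add_divide_distrib power2_eq_square)
    finally show "xpos m i \<le> x + 4 / real (lev m)" using cb(2) by (simp add: M_def)
    have "ypos m i j + \<mu> * xpos m i = real k * s + per m * of_int j + \<mu> * (real (q * M\<^sup>2) * gap m)"
    proof -
      have "ypos m i j = real k * gap m * (1 / real M - slp m l) + per m * of_int j"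
        by (simp only: ypos_def ty M_def[symmetric] idiv(2))
      moreover have "xpos m i = (real (q * M\<^sup>2) + real k) * gap m" by (simp add: xpos_def i_def)
      ultimately show ?thesis unfolding s_def by (simp add: algebra_simps)
    qed
    also have "\<dots> = z - r + real k * s" by (simp add: r_def z'_def)
    finally have e: "ypos m i j + \<mu> * xpos m i = z - r + real k * s" .
    show "ypos m i j + \<mu> * xpos m i \<le> z" using e k by linarith
    show "z \<le> ypos m i j + \<mu> * xpos m i + len m" using e k s by linarith
  qed
qed

section \<open>Pure unrectifiability\<close>

text \<open>Subtracting the uniform motion with velocity \<open>\<gamma>' r\<close> leaves a map
  with Lipschitz constant 1/2, so the curve deviates from unit speed along a line by at most half
  the elapsed time.\<close>

lemma near_isometric_of_close_derivative:
  fixes \<gamma> :: "real \<Rightarrow> 'a::real_normed_vector"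
  assumes \<gamma>: "\<And>t. t \<in> {p..q} \<Longrightarrow> (\<gamma> has_vector_derivative \<gamma>' t) (at t within {p..q})"
    and unit: "\<And>t. t \<in> {p..q} \<Longrightarrow> norm (\<gamma>' t) = 1"
    and close: "\<And>t r. t \<in> {p..q} \<Longrightarrow> r \<in> {p..q} \<Longrightarrow> norm (\<gamma>' t - \<gamma>' r) \<le> 1 / 2"
    and tr: "t \<in> {p..q}" "r \<in> {p..q}"
  shows "\<bar>t - r\<bar> \<le> 2 * dist (\<gamma> t) (\<gamma> r)" "dist (\<gamma> t) (\<gamma> r) \<le> 3 / 2 * \<bar>t - r\<bar>"
proof -
  have "norm ((\<gamma> t - t *\<^sub>R \<gamma>' r) - (\<gamma> r - r *\<^sub>R \<gamma>' r)) \<le> 1 / 2 * norm (t - r)"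
  proof (rule differentiable_bound[where f' = "\<lambda>x h. h *\<^sub>R (\<gamma>' x - \<gamma>' r)" and S = "{p..q}"])
    fix x assume x: "x \<in> {p..q}"
    have "((\<lambda>x. \<gamma> x - x *\<^sub>R \<gamma>' r) has_vector_derivative (\<gamma>' x - 1 *\<^sub>R \<gamma>' r)) (at x within {p..q})"
      by (intro has_vector_derivative_diff \<gamma> x has_vector_derivative_scaleR[of "\<lambda>x. x", where g' = 0, simplified] derivative_intros)
    then show "((\<lambda>x. \<gamma> x - x *\<^sub>R \<gamma>' r) has_derivative (\<lambda>h. h *\<^sub>R (\<gamma>' x - \<gamma>' r))) (at x within {p..q})"
      by (simp add: has_vector_derivative_def)
    show "onorm (\<lambda>h. h *\<^sub>R (\<gamma>' x - \<gamma>' r)) \<le> 1 / 2"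

    proof (rule onorm_bound)
      fix h :: real
      have "\<bar>h\<bar> * norm (\<gamma>' x - \<gamma>' r) \<le> \<bar>h\<bar> * (1 / 2)" using close[OF x tr(2)] by (intro mult_left_mono) auto
      then show "norm (h *\<^sub>R (\<gamma>' x - \<gamma>' r)) \<le> 1 / 2 * norm h" by simp
    qed simp
  qed (use tr in auto)
  then have *: "norm ((\<gamma> t - \<gamma> r) - (t - r) *\<^sub>R \<gamma>' r) \<le> 1 / 2 * \<bar>t - r\<bar>"
    by (simp add: algebra_simps)
  have n: "norm ((t - r) *\<^sub>R \<gamma>' r) = \<bar>t - r\<bar>" using unit[OF tr(2)] by simp
  show "\<bar>t - r\<bar> \<le> 2 * dist (\<gamma> t) (\<gamma> r)"
  proof -
    have "norm ((t - r) *\<^sub>R \<gamma>' r) - norm (\<gamma> t - \<gamma> r) \<le> 1 / 2 * \<bar>t - r\<bar>"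
      using * norm_triangle_ineq2 by (metis norm_minus_commute order_trans)
    then show ?thesis unfolding n dist_norm by simp
  qed
  show "dist (\<gamma> t) (\<gamma> r) \<le> 3 / 2 * \<bar>t - r\<bar>"
  proof -
    have "norm (\<gamma> t - \<gamma> r) \<le> norm ((\<gamma> t - \<gamma> r) - (t - r) *\<^sub>R \<gamma>' r) + norm ((t - r) *\<^sub>R \<gamma>' r)"
      by (rule norm_triangle_sub[of "\<gamma> t - \<gamma> r" "(t - r) *\<^sub>R \<gamma>' r", unfolded add.commute[of "norm ((t - r) *\<^sub>R \<gamma>' r)"]])
    then show ?thesis using * unfolding n dist_norm by simp
  qed
qed

lemma card_separated_reals_le:
  fixes T :: "real set"
  assumes "T \<subseteq> {p..q}" "0 < d" "\<And>s t. s \<in> T \<Longrightarrow> t \<in> T \<Longrightarrow> s \<noteq> t \<Longrightarrow> d \<le> \<bar>s - t\<bar>"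
    and "finite T" "p \<le> q"
  shows "real (card T) \<le> (q - p) / d + 1"
proof -
  let ?f = "\<lambda>t. nat \<lfloor>(t - p) / d\<rfloor>"
  have "inj_on ?f T"
  proof (rule inj_onI, rule ccontr)
    fix s t assume st: "s \<in> T" "t \<in> T" "?f s = ?f t" "s \<noteq> t"
    have "0 \<le> (s - p) / d" "0 \<le> (t - p) / d" using st(1,2) assms(1,2) by auto
    then have "\<lfloor>(s - p) / d\<rfloor> = \<lfloor>(t - p) / d\<rfloor>" using st(3) by (simp add: eq_nat_nat_iff)
    then have "\<bar>(s - p) / d - (t - p) / d\<bar> < 1" by linarith
    also have "(s - p) / d - (t - p) / d = (s - t) / d" by (simp add: diff_divide_distrib)
    finally have "\<bar>s - t\<bar> < d" using assms(2) by (simp add: abs_divide)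
    then show False using assms(3)[OF st(1,2,4)] by simp
  qed
  moreover have "?f ` T \<subseteq> {..nat \<lfloor>(q - p) / d\<rfloor>}"
    using assms(1,2) by (auto intro!: nat_mono floor_mono divide_right_mono)
  ultimately have "card T \<le> card {..nat \<lfloor>(q - p) / d\<rfloor>}" by (metis card_inj_on_le finite_atMost)
  then have "real (card T) \<le> real (nat \<lfloor>(q - p) / d\<rfloor>) + 1" by simp
  moreover have "0 \<le> (q - p) / d" using assms by simp
  ultimately show ?thesis by linarith
qed

text \<open>Visits to different sets are at least \<open>d\<close> apart in time, which bounds the
  number of sets visited, and all times spent in one set lie within \<open>2 * e\<close> of any one
  of them.\<close>

lemma emeasure_curve_in_separated_sets:
  fixes \<gamma> :: "real \<Rightarrow> 'a::metric_space" and R :: "'s \<Rightarrow> 'a set"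
  assumes \<gamma>: "\<And>t r. t \<in> {p..q} \<Longrightarrow> r \<in> {p..q} \<Longrightarrow> \<bar>t - r\<bar> \<le> 2 * dist (\<gamma> t) (\<gamma> r)"
      "\<And>t r. t \<in> {p..q} \<Longrightarrow> r \<in> {p..q} \<Longrightarrow> dist (\<gamma> t) (\<gamma> r) \<le> 3 / 2 * \<bar>t - r\<bar>"
    and S: "finite S" and R: "\<And>s. s \<in> S \<Longrightarrow> closed (R s)" "\<And>s x y. s \<in> S \<Longrightarrow> x \<in> R s \<Longrightarrow> y \<in> R s \<Longrightarrow> dist x y \<le> e"
      "\<And>s s' x y. s \<in> S \<Longrightarrow> s' \<in> S \<Longrightarrow> s \<noteq> s' \<Longrightarrow> x \<in> R s \<Longrightarrow> y \<in> R s' \<Longrightarrow> 3 / 2 * d \<le> dist x y"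
    and de: "0 < d" "0 \<le> e" and pq: "p \<le> q"
  shows "{t \<in> {p..q}. \<gamma> t \<in> (\<Union>s\<in>S. R s)} \<in> sets lborel"
    "emeasure lborel {t \<in> {p..q}. \<gamma> t \<in> (\<Union>s\<in>S. R s)} \<le> ennreal (((q - p) / d + 1) * (4 * e))"
proof -
  define T where "T s = {t \<in> {p..q}. \<gamma> t \<in> R s}" for s
  define S' where "S' = {s \<in> S. T s \<noteq> {}}"
  have fS': "finite S'" using S by (simp add: S'_def)
  have "(3/2)-lipschitz_on {p..q} \<gamma>" using \<gamma>(2) by (intro lipschitz_onI) (auto simp: dist_real_def)
  then have cont: "continuous_on {p..q} \<gamma>" by (rule lipschitz_on_continuous_on)
  have T: "closed (T s)" if "s \<in> S" for s
  proof -
    have "T s = {p..q} \<inter> \<gamma> -` R s" by (auto simp: T_def)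
    then show ?thesis using continuous_on_closed_vimage[of "{p..q}" \<gamma>] cont R(1)[OF that]
      by (auto simp: Int_commute)
  qed
  have eq: "{t \<in> {p..q}. \<gamma> t \<in> (\<Union>s\<in>S. R s)} = (\<Union>s\<in>S'. T s)" by (auto simp: T_def S'_def)
  have TS: "T s \<in> sets lborel" if "s \<in> S'" for s using T[of s] that by (auto simp: S'_def)
  show "{t \<in> {p..q}. \<gamma> t \<in> (\<Union>s\<in>S. R s)} \<in> sets lborel"
    unfolding eq using fS' TS by (intro sets.finite_UN) auto
  have "\<forall>s\<in>S'. \<exists>t. t \<in> T s" by (auto simp: S'_def)
  then obtain \<tau> where \<tau>: "\<And>s. s \<in> S' \<Longrightarrow> \<tau> s \<in> T s" by metis
  have sep: "d \<le> \<bar>\<tau> s - \<tau> s'\<bar>" if "s \<in> S'" "s' \<in> S'" "s \<noteq> s'" for s s'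
  proof -
    have "3 / 2 * d \<le> dist (\<gamma> (\<tau> s)) (\<gamma> (\<tau> s'))"
      using R(3)[of s s'] that \<tau>[of s] \<tau>[of s'] by (auto simp: S'_def T_def)
    also have "\<dots> \<le> 3 / 2 * \<bar>\<tau> s - \<tau> s'\<bar>"
      using \<tau>[OF that(1)] \<tau>[OF that(2)] by (intro \<gamma>(2)) (auto simp: T_def)
    finally show ?thesis by simp
  qed
  have "inj_on \<tau> S'" using sep de by (force simp: inj_on_def)
  then have "card S' = card (\<tau> ` S')" by (simp add: card_image)
  also have "real (card (\<tau> ` S')) \<le> (q - p) / d + 1"
    using \<tau> sep de pq fS' by (intro card_separated_reals_le) (auto simp: T_def)
  finally have card: "real (card S') \<le> (q - p) / d + 1" .
  have each: "emeasure lborel (T s) \<le> ennreal (4 * e)" if "s \<in> S'" for s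
  proof -
    have "T s \<subseteq> cball (\<tau> s) (2 * e)"
    proof
      fix t assume t: "t \<in> T s"
      have "\<bar>\<tau> s - t\<bar> \<le> 2 * dist (\<gamma> (\<tau> s)) (\<gamma> t)" using t \<tau>[OF that] by (intro \<gamma>(1)) (auto simp: T_def)
      also have "dist (\<gamma> (\<tau> s)) (\<gamma> t) \<le> e"
        using R(2)[of s] that t \<tau>[OF that] by (auto simp: S'_def T_def)
      finally show "t \<in> cball (\<tau> s) (2 * e)" by (simp add: dist_real_def)
    qed
    then have "emeasure lborel (T s) \<le> emeasure lborel (cball (\<tau> s) (2 * e))" by (intro emeasure_mono) auto
    then show ?thesis using de by (simp add: emeasure_lborel_cball_real)
  qed
  have "emeasure lborel (\<Union>s\<in>S'. T s) \<le> (\<Sum>s\<in>S'. emeasure lborel (T s))"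
    using fS' TS by (intro emeasure_subadditive_finite) auto
  also have "\<dots> \<le> (\<Sum>s\<in>S'. ennreal (4 * e))" by (intro sum_mono each)
  also have "\<dots> = ennreal (real (card S') * (4 * e))"
    using de by (simp add: ennreal_of_nat_eq_real_of_nat ennreal_mult[symmetric])
  also have "\<dots> \<le> ennreal (((q - p) / d + 1) * (4 * e))"
    using card de by (intro ennreal_leI mult_right_mono) auto
  finally show "emeasure lborel {t \<in> {p..q}. \<gamma> t \<in> (\<Union>s\<in>S. R s)} \<le> ennreal (((q - p) / d + 1) * (4 * e))"
    unfolding eq .
qed

text \<open>\<open>u\<close> is the direction of growth and \<open>v\<close> the perpendicular one.
  Both orientations are treated at once, because the pattern of one orientation serves the
  projections onto \<open>e\<close> with
  \<open>\<bar>e \<bullet> v\<bar> \<le> \<bar>e \<bullet> u\<bar>\<close>.\<close>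

locale frame =
  fixes u v :: "real^2"
  assumes frame: "u = axis 1 1 \<and> v = axis 2 1 \<or> u = axis 2 1 \<and> v = axis 1 1"
begin

definition pt :: "real \<Rightarrow> real \<Rightarrow> real^2" where "pt x y = x *\<^sub>R v + y *\<^sub>R u"

lemma inner_frame [simp]: "u \<bullet> u = 1" "v \<bullet> v = 1" "u \<bullet> v = 0" "v \<bullet> u = 0"
  using frame by (auto simp: inner_axis_axis)

lemma norm_frame [simp]: "norm u = 1" "norm v = 1"
  by (simp_all add: norm_eq_1)

lemma pt_inner [simp]: "pt x y \<bullet> v = x" "pt x y \<bullet> u = y"
  by (simp_all add: pt_def inner_add_left)

lemma inner_frame_index: "(p \<bullet> v = p $ 1 \<and> p \<bullet> u = p $ 2) \<or> (p \<bullet> v = p $ 2 \<and> p \<bullet> u = p $ 1)"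
proof -
  have ax: "p \<bullet> axis i (1::real) = p $ i" for i :: 2 by (simp add: inner_axis)
  from frame show ?thesis
  proof
    assume "u = axis 1 1 \<and> v = axis 2 1"
    then show ?thesis using ax[of 1] ax[of 2] by metis
  next
    assume "u = axis 2 1 \<and> v = axis 1 1"
    then show ?thesis using ax[of 1] ax[of 2] by metis
  qed
qed

lemma pt_inverse: "pt (p \<bullet> v) (p \<bullet> u) = p"
proof -
  have ax: "p \<bullet> axis i (1::real) = p $ i" for i :: 2 by (simp add: inner_axis)
  have e: "(p $ 1) *\<^sub>R axis 1 1 + (p $ 2) *\<^sub>R axis 2 1 = p"
    by (simp add: vec_eq_iff forall_2 axis_def)
  from frame show ?thesis
  proof
    assume "u = axis 1 1 \<and> v = axis 2 1"
    then show ?thesis using ax[of 1] ax[of 2] e unfolding pt_def by (metis add.commute)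
  next
    assume "u = axis 2 1 \<and> v = axis 1 1"
    then show ?thesis using ax[of 1] ax[of 2] e unfolding pt_def by metis
  qed
qed

lemma norm_le_frame: "norm p \<le> \<bar>p \<bullet> v\<bar> + \<bar>p \<bullet> u\<bar>"
  using norm_triangle_ineq[of "(p \<bullet> v) *\<^sub>R v" "(p \<bullet> u) *\<^sub>R u"] pt_inverse[of p] by (simp add: pt_def)

lemma dist_le_frame: "dist p q \<le> \<bar>p \<bullet> v - q \<bullet> v\<bar> + \<bar>p \<bullet> u - q \<bullet> u\<bar>"
  using norm_le_frame[of "p - q"] by (simp add: dist_norm inner_diff_left)

lemma frame_le_dist: "\<bar>p \<bullet> v - q \<bullet> v\<bar> \<le> dist p q" "\<bar>p \<bullet> u - q \<bullet> u\<bar> \<le> dist p q"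
  using Cauchy_Schwarz_ineq2[of "p - q" v] Cauchy_Schwarz_ineq2[of "p - q" u]
  by (simp_all add: dist_norm inner_diff_left)

lemma mem_interior_unit_square:
  "p \<in> interior unit_square \<longleftrightarrow> 0 < p \<bullet> v \<and> p \<bullet> v < 1 \<and> 0 < p \<bullet> u \<and> p \<bullet> u < 1"
  using inner_frame_index[of p] by (auto simp: unit_square_def interior_cbox mem_box_cart forall_2)

definition rect :: "nat \<Rightarrow> nat \<times> int \<Rightarrow> (real^2) set" where
  "rect m s = {p. \<bar>p \<bullet> v - xc m s\<bar> \<le> len m \<and>
     yc m s \<le> p \<bullet> u \<and> p \<bullet> u \<le> yc m s + len m}"

definition pattern :: "nat \<Rightarrow> (real^2) set" where "pattern m = (\<Union>s\<in>idx m. rect m s)"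

definition limit_pattern :: "(real^2) set" where "limit_pattern = (\<Inter>n. \<Union>m\<in>{n..}. pattern m)"

lemma dist_rect_le: "p \<in> rect m s \<Longrightarrow> q \<in> rect m s \<Longrightarrow> dist p q \<le> 3 * len m"
  using dist_le_frame[of p q] by (auto simp: rect_def)

lemma closed_rect: "closed (rect m s)"
  unfolding rect_def by (intro closed_Collect_conj closed_Collect_le continuous_intros)

lemma compact_rect: "compact (rect m s)"
proof (cases "rect m s = {}")
  case False
  then obtain p where "p \<in> rect m s" by blast
  then have "rect m s \<subseteq> cball p (3 * len m)" using dist_rect_le[of p m s] by (simp add: subset_iff)
  then show ?thesis using closed_rect bounded_cball bounded_subset compact_eq_bounded_closed by blast
qed simp

lemma ypos_or_xpos_separated:
  assumes "s \<noteq> s'"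
  shows "gap m \<le> \<bar>xc m s - xc m s'\<bar> \<or>
    fst s = fst s' \<and> per m \<le> \<bar>yc m s - yc m s'\<bar>"
  using assms xpos_separated ypos_separated by (metis prod_eqI)

lemma rect_separated:
  assumes "s \<noteq> s'" "p \<in> rect m s" "q \<in> rect m s'"
  shows "gap m / 2 \<le> dist p q"
  using ypos_or_xpos_separated[OF assms(1), of m]
proof
  assume "gap m \<le> \<bar>xc m s - xc m s'\<bar>"
  then show ?thesis using assms(2,3) frame_le_dist(1)[of p q] len_le[of m] gap_pos[of m] unfolding rect_def mem_Collect_eq by linarith
next
  assume *: "fst s = fst s' \<and> per m \<le> \<bar>yc m s - yc m s'\<bar>"
  then show ?thesis using assms(2,3) frame_le_dist(2)[of p q] len_le[of m] gap_le[of m] gap_pos[of m] unfolding rect_def mem_Collect_eq by linarith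
qed

lemma rect_disjoint: "s \<noteq> s' \<Longrightarrow> rect m s \<inter> rect m s' = {}"
  using rect_separated[of s s' _ m] gap_pos[of m] by (metis disjoint_iff dist_self half_gt_zero not_le)

lemma compact_pattern: "compact (pattern m)"
  unfolding pattern_def by (intro compact_UN finite_idx compact_rect)

lemma pattern_subset: "pattern m \<subseteq> interior unit_square"
  using len_pos[of m] by (auto simp: pattern_def rect_def idx_def mem_interior_unit_square)

lemma limit_pattern_subset: "limit_pattern \<subseteq> interior unit_square"
  using pattern_subset by (fastforce simp: limit_pattern_def)

lemma borel_limit_pattern: "limit_pattern \<in> sets borel"
  unfolding limit_pattern_def using compact_pattern
  by (intro sets.countable_INT' sets.countable_UN') (auto intro: borel_compact)

text \<open>There are about \<open>3 * (q - p) / gap m\<close> visits, each lasting at most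
  \<open>12 * len m\<close>, and \<open>36 * len m / gap m\<close> is \<open>72 / lev m\<close>.
  These bounds form a geometric series, so Borel-Cantelli applies.\<close>

lemma limit_pattern_null_on_near_isometric_curve:
  fixes \<gamma> :: "real \<Rightarrow> real^2"
  assumes \<gamma>: "\<And>t r. t \<in> {p..q} \<Longrightarrow> r \<in> {p..q} \<Longrightarrow> \<bar>t - r\<bar> \<le> 2 * dist (\<gamma> t) (\<gamma> r)"
      "\<And>t r. t \<in> {p..q} \<Longrightarrow> r \<in> {p..q} \<Longrightarrow> dist (\<gamma> t) (\<gamma> r) \<le> 3 / 2 * \<bar>t - r\<bar>" and pq: "p \<le> q"
  shows "{t \<in> {p..q}. \<gamma> t \<in> limit_pattern} \<in> null_sets lborel"
proof -
  define T where "T m = {t \<in> {p..q}. \<gamma> t \<in> pattern m}" for m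
  have sep: "3 / 2 * (gap m / 3) \<le> dist x y" if "s \<noteq> s'" "x \<in> rect m s" "y \<in> rect m s'" for s s' x y m
    using rect_separated[OF that] by simp
  have len0: "0 \<le> 3 * len m" "0 < gap m / 3" for m using less_imp_le[OF len_pos[of m]] gap_pos[of m] by simp_all
  have T: "T m \<in> sets lborel" "emeasure lborel (T m) \<le> ennreal (((q - p) / (gap m / 3) + 1) * (4 * (3 * len m)))" for m
    unfolding T_def pattern_def
    using emeasure_curve_in_separated_sets[OF \<gamma> finite_idx closed_rect dist_rect_le sep len0(2) len0(1) pq, of m]
    by auto
  have le: "((q - p) / (gap m / 3) + 1) * (4 * (3 * len m)) \<le> (72 * (q - p) + 12) * (1 / real (lev m))" for m
  proof -
    have "((q - p) / (gap m / 3) + 1) * (4 * (3 * len m)) = 72 * (q - p) * (1 / real (lev m)) + 12 * len m"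
      using gap_pos[of m, THEN less_imp_neq, symmetric] lev_pos[of m] by (simp add: len_eq field_simps)
    also have "\<dots> \<le> 72 * (q - p) * (1 / real (lev m)) + 12 * (1 / real (lev m))"
      using len_le_inverse_lev[of m] by linarith
    finally show ?thesis by (simp only: distrib_right)
  qed
  have T': "emeasure lborel (T m) \<le> ennreal ((72 * (q - p) + 12) * (1 / real (lev m)))" for m
    using T(2)[of m] ennreal_leI[OF le[of m]] by (rule order_trans)
  have "limsup T \<in> null_sets lborel"
  proof (rule borel_cantelli_limsup1)
    show "T m \<in> sets lborel" for m by (rule T)
    show "emeasure lborel (T m) < \<infinity>" for m using T'[of m] by (simp add: le_less_trans)
    show "summable (\<lambda>m. measure lborel (T m))"
    proof (rule summable_comparison_test')
      show "summable (\<lambda>m. (72 * (q - p) + 12) * (1 / real (lev m)))"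
        unfolding inverse_lev_eq by (intro summable_mult summable_geometric) auto
      show "norm (measure lborel (T m)) \<le> (72 * (q - p) + 12) * (1 / real (lev m))" if "0 \<le> m" for m
        using T'[of m] pq by (simp add: measure_def enn2real_leI)
    qed
  qed
  moreover have "{t \<in> {p..q}. \<gamma> t \<in> limit_pattern} = limsup T"
    by (auto simp: limsup_INF_SUP limit_pattern_def T_def)
  ultimately show ?thesis by simp
qed

lemma purely_unrectifiable_limit_pattern: "purely_unrectifiable limit_pattern"
  unfolding purely_unrectifiable_def
proof (intro conjI allI impI)
  show "limit_pattern \<in> sets borel" by (rule borel_limit_pattern)
  fix a b \<gamma> assume "C1_curve a b \<gamma>"
  then obtain \<gamma>' where ab: "a < b" and cont: "continuous_on {a..b} \<gamma>'"
    and \<gamma>: "\<And>t. t \<in> {a..b} \<Longrightarrow> (\<gamma> has_vector_derivative \<gamma>' t) (at t within {a..b})"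
    "\<And>t. t \<in> {a..b} \<Longrightarrow> norm (\<gamma>' t) = 1" by (auto simp: C1_curve_def)
  have "uniformly_continuous_on {a..b} \<gamma>'" using cont by (simp add: compact_uniformly_continuous)
  then obtain d where d: "d > 0" "\<And>t r. t \<in> {a..b} \<Longrightarrow> r \<in> {a..b} \<Longrightarrow> dist t r < d \<Longrightarrow> dist (\<gamma>' t) (\<gamma>' r) < 1 / 2"
    unfolding uniformly_continuous_on_def by (metis half_gt_zero_iff zero_less_one)
  \<comment> \<open>Blocks of length at most \<open>d / 2\<close>, on which the derivative moves by
    less than 1/2. Letting \<open>k\<close> range over all integers is harmless: blocks that miss
    \<open>{a..b}\<close> are empty.\<close>
  define I where "I k = {max a (of_int k * (d/2))..min b ((of_int k + 1) * (d/2))}" for k :: int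
  have "{t \<in> I k. \<gamma> t \<in> limit_pattern} \<in> null_sets lborel" for k
  proof (cases "max a (of_int k * (d/2)) \<le> min b ((of_int k + 1) * (d/2))")
    case True
    have sub: "I k \<subseteq> {a..b}" by (auto simp: I_def)
    have close: "norm (\<gamma>' t - \<gamma>' r) \<le> 1 / 2" if "t \<in> I k" "r \<in> I k" for t r
    proof -
      have "dist t r \<le> d / 2" using that unfolding I_def dist_real_def abs_le_iff
        by (simp add: algebra_simps)
      then show ?thesis using d(2)[of t r] that sub d(1) by (force simp: dist_norm)
    qed
    have der: "(\<gamma> has_vector_derivative \<gamma>' t) (at t within I k)" if "t \<in> I k" for t
      using has_vector_derivative_within_subset[OF \<gamma>(1) sub] that sub by blast
    show ?thesis
      using True near_isometric_of_close_derivative[of _ _ \<gamma> \<gamma>'] der close \<gamma>(2) sub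
      unfolding I_def by (intro limit_pattern_null_on_near_isometric_curve) blast+
  qed (auto simp: I_def)
  then have "(\<Union>k. {t \<in> I k. \<gamma> t \<in> limit_pattern}) \<in> null_sets lborel" by (intro null_sets_UN)
  moreover have "(\<Union>k. {t \<in> I k. \<gamma> t \<in> limit_pattern}) = {t \<in> {a..b}. \<gamma> t \<in> limit_pattern}"
  proof (intro equalityI subsetI)
    fix t assume t: "t \<in> {t \<in> {a..b}. \<gamma> t \<in> limit_pattern}"
    have "of_int \<lfloor>t / (d/2)\<rfloor> \<le> t / (d/2)" "t / (d/2) \<le> of_int \<lfloor>t / (d/2)\<rfloor> + 1" by linarith+
    then have "of_int \<lfloor>t / (d/2)\<rfloor> * (d/2) \<le> t" "t \<le> (of_int \<lfloor>t / (d/2)\<rfloor> + 1) * (d/2)"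
      using d(1) by (simp_all only: pos_le_divide_eq[of "d/2"] pos_divide_le_eq[of "d/2"] half_gt_zero)
    then show "t \<in> (\<Union>k. {t \<in> I k. \<gamma> t \<in> limit_pattern})" using t by (auto simp: I_def)
  qed (auto simp: I_def)
  ultimately show "{t \<in> {a..b}. \<gamma> t \<in> limit_pattern} \<in> null_sets lebesgue"
    by (simp add: null_sets_completionI)
qed

end

section \<open>Perturbation to slope 1 on thin cells\<close>

lemma lipschitz1_clamp_extension_family:
  fixes f :: "'a::metric_space \<Rightarrow> real" and p :: "'i \<Rightarrow> 'a" and c :: "'i \<Rightarrow> real"
  assumes f: "1-lipschitz_on S f" and p: "\<And>i. i \<in> I \<Longrightarrow> p i \<in> S"
    and c: "\<And>i j. i \<in> I \<Longrightarrow> j \<in> I \<Longrightarrow> \<bar>c i - c j\<bar> \<le> dist (p i) (p j)"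
    and d: "\<And>i. i \<in> I \<Longrightarrow> \<bar>c i - f (p i)\<bar> \<le> d" and d0: "0 \<le> d"
  obtains g where "1-lipschitz_on S g" "\<And>i. i \<in> I \<Longrightarrow> g (p i) = c i" "\<And>x. x \<in> S \<Longrightarrow> \<bar>g x - f x\<bar> \<le> d"
proof -
  \<comment> \<open>The family need not be injective, as neighbouring cells can share an edge. A
    point takes its value from some index representing it; the hypothesis on \<open>c\<close> makes
    the choice immaterial.\<close>
  define j where "j x = (SOME i. i \<in> I \<and> p i = x)" for x
  have j: "j (p i) \<in> I" "p (j (p i)) = p i" if "i \<in> I" for i
    using someI[of "\<lambda>k. k \<in> I \<and> p k = p i" i] that by (auto simp: j_def)
  have cj: "c (j (p i)) = c i" if "i \<in> I" for i
    using c[OF j(1)[OF that] that] j(2)[OF that] by simp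
  obtain g where "1-lipschitz_on S g" "\<And>x. x \<in> p ` I \<Longrightarrow> g x = c (j x)" "\<And>x. x \<in> S \<Longrightarrow> \<bar>g x - f x\<bar> \<le> d"
  proof (rule lipschitz1_clamp_extension[OF f, of "p ` I" "\<lambda>x. c (j x)" d])
    show "p ` I \<subseteq> S" using p by blast
    show "1-lipschitz_on (p ` I) (\<lambda>x. c (j x))"
      by (rule lipschitz_onI) (auto simp: cj dist_real_def intro: c)
    show "\<bar>c (j x) - f x\<bar> \<le> d" if "x \<in> p ` I" for x using that d by (auto simp: cj)
  qed (use d0 in auto)
  then show ?thesis using that cj by auto
qed

text \<open>The values \<open>w\<close> on a grid of mesh \<open>h\<close> are continued with slope 1 to the right of each grid point, and the
  remaining part of each mesh cell is just long enough to return to the next value with slope \<open>-1\<close>.\<close>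

lemma zigzag_lipschitz:
  fixes w :: "nat \<Rightarrow> real"
  assumes w: "\<And>i j. i \<le> j \<Longrightarrow> \<bar>w j - w i\<bar> \<le> (real j - real i) * h"
    and y: "a + k * h \<le> y" "y \<le> a + k * h + h - (h - (w (Suc k) - w k)) / 2"
    and y': "a + k' * h \<le> y'" "y' \<le> a + k' * h + h - (h - (w (Suc k') - w k')) / 2"
    and k: "k < k'"
  shows "\<bar>(w k' + (y' - (a + k' * h))) - (w k + (y - (a + k * h)))\<bar> \<le> y' - y"
proof -
  have "Suc k \<le> k'" using k by simp
  have 1: "\<bar>w k' - w k\<bar> \<le> (real k' - real k) * h" using w[of k k'] k by simp
  \<comment> \<open>The upper estimate uses only the bound between \<open>k\<close> and
    \<open>k'\<close>. In the lower one the shortened upper end of the cell of \<open>y\<close>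
    brings in \<open>w (Suc k)\<close>, hence this second comparison.\<close>
  have 2: "\<bar>w k' - w (Suc k)\<bar> \<le> (real k' - real (Suc k)) * h" by (rule w) fact
  have 1: "w k' - w k \<le> real k' * h - real k * h"
    using 1 by (simp add: abs_le_iff left_diff_distrib)
  have 2: "real k * h + h - real k' * h \<le> w k' - w (Suc k)"
    using 2 by (simp add: abs_le_iff algebra_simps)
  show ?thesis by (rule abs_leI) (use 1 2 y y' in argo)+
qed

text \<open>The total loss of projection at level \<open>m\<close> is of order \<open>card (idx m) * mu m * len m\<close>.\<close>

definition mu :: "nat \<Rightarrow> real" where "mu m = 1 / (100 * real (lev m) * (real (card (idx m)) + 1))"

lemma mu_pos [simp]: "0 < mu m"
  by (simp add: mu_def)

lemma card_mu_le: "real (card (idx m)) * mu m \<le> 1 / 800"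
proof -
  have "real (card (idx m)) * mu m \<le> (real (card (idx m)) + 1) * mu m"
    by (intro mult_right_mono) (auto intro: less_imp_le)
  also have "\<dots> = 1 / (100 * real (lev m))" by (simp add: mu_def)
  also have "\<dots> \<le> 1 / (100 * 8)" using lev_ge_8_real[of m] by (intro divide_left_mono) auto
  finally show ?thesis by simp
qed

lemma mu_le: "mu m \<le> 1 / (100 * real (lev m))"
proof -
  have "100 * real (lev m) * 1 \<le> 100 * real (lev m) * (real (card (idx m)) + 1)" by (intro mult_left_mono) auto
  then show ?thesis unfolding mu_def by (intro divide_left_mono) auto
qed

lemma mu_small: "mu m \<le> 1 / 800"
proof -
  have "1 / (100 * real (lev m)) \<le> 1 / (100 * 8)"
    using lev_ge_8_real[of m] by (intro divide_left_mono) auto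
  then show ?thesis using mu_le[of m] by linarith
qed

definition shadow :: "real \<Rightarrow> nat \<Rightarrow> nat \<times> int \<Rightarrow> real set" where
  "shadow \<nu> m s = {yc m s + \<nu> * xc m s..yc m s + \<nu> * xc m s + len m}"

abbreviation "mesh m N \<equiv> len m / real N"

text \<open>As \<open>k\<close> runs from 0 to \<open>3 * N\<close> the grid traverses the tripled
  segment. The segment itself is the middle third, the cells with \<open>N \<le> k < 2 * N\<close>;
  the outer thirds leave room for symmetric differences with steps up to
  \<open>len m / 2\<close>.\<close>

definition grid :: "nat \<Rightarrow> nat \<Rightarrow> nat \<times> int \<Rightarrow> nat \<Rightarrow> real" where
  "grid N m s k = yc m s - len m + real k * mesh m N"

text \<open>The discrete uncentred maximal function of \<open>d\<close> on \<open>{..<n}\<close>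
  exceeds \<open>c\<close> at \<open>k\<close>.\<close>

definition heavy :: "nat \<Rightarrow> (nat \<Rightarrow> real) \<Rightarrow> real \<Rightarrow> nat \<Rightarrow> bool" where
  "heavy n d c k \<longleftrightarrow> (\<exists>i\<le>k. \<exists>j>k. j \<le> n \<and> c * (real j - real i) < sum d {i..<j})"

context frame
begin

definition sample :: "(real^2 \<Rightarrow> real) \<Rightarrow> nat \<Rightarrow> nat \<Rightarrow> nat \<times> int \<Rightarrow> nat \<Rightarrow> real" where
  "sample f N m s k = f (pt (xc m s) (grid N m s k))"

text \<open>The growth missing from full speed over one mesh interval; nonnegative on the grid when
  \<open>f\<close> is 1-Lipschitz.\<close>

definition defect :: "(real^2 \<Rightarrow> real) \<Rightarrow> nat \<Rightarrow> nat \<Rightarrow> nat \<times> int \<Rightarrow> nat \<Rightarrow> real" where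
  "defect f N m s k = mesh m N - (sample f N m s (Suc k) - sample f N m s k)"

definition cell :: "(real^2 \<Rightarrow> real) \<Rightarrow> nat \<Rightarrow> nat \<Rightarrow> real \<Rightarrow> nat \<times> int \<Rightarrow> nat \<Rightarrow> (real^2) set" where
  "cell f N m w s k = {p. \<bar>p \<bullet> v - xc m s\<bar> \<le> w \<and> grid N m s k \<le> p \<bullet> u \<and>
     p \<bullet> u \<le> grid N m s k + mesh m N - defect f N m s k / 2}"

definition zigzag_on :: "(real^2 \<Rightarrow> real) \<Rightarrow> nat \<Rightarrow> nat \<Rightarrow> real \<Rightarrow> (nat \<times> int) set \<Rightarrow> (real^2 \<Rightarrow> real) \<Rightarrow> bool" where
  "zigzag_on f N m w S g \<longleftrightarrow> (\<forall>s\<in>S. \<forall>k<3 * N. \<forall>p\<in>cell f N m w s k. g p = sample f N m s k + (p \<bullet> u - grid N m s k))"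

abbreviation "heavy_cells f N m s \<equiv> {k. k < 3 * N \<and> heavy (3 * N) (defect f N m s) ((mu m)\<^sup>2 * mesh m N) k}"

lemma grid_bounds:
  assumes "0 < N" "k \<le> 3 * N"
  shows "yc m s - len m \<le> grid N m s k" "grid N m s k \<le> yc m s + 2 * len m"
proof -
  have "real k * mesh m N \<le> real (3 * N) * mesh m N"
    using assms(2) by (intro mult_right_mono) (auto simp: less_imp_le)
  also have "\<dots> = 3 * len m" using assms(1) by simp
  finally show "grid N m s k \<le> yc m s + 2 * len m" by (simp add: grid_def)
  show "yc m s - len m \<le> grid N m s k" by (simp add: grid_def less_imp_le)
qed

lemma ext_in_unit_square:
  assumes "s \<in> idx m" "\<bar>p \<bullet> v - xc m s\<bar> \<le> len m"
    "yc m s - len m \<le> p \<bullet> u" "p \<bullet> u \<le> yc m s + 2 * len m"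
  shows "p \<in> interior unit_square"
  using assms unfolding mem_interior_unit_square idx_def by auto

lemma sample_in_unit_square:
  assumes "s \<in> idx m" "0 < N" "k \<le> 3 * N"
  shows "pt (xc m s) (grid N m s k) \<in> unit_square"
  using ext_in_unit_square[OF assms(1), of "pt (xc m s) (grid N m s k)"] grid_bounds[OF assms(2,3), of m s]
    interior_subset[of unit_square] by (auto simp: less_imp_le)

lemma lipD: "C-lipschitz_on unit_square f \<Longrightarrow> p \<in> unit_square \<Longrightarrow> q \<in> unit_square \<Longrightarrow> \<bar>f p - f q\<bar> \<le> C * dist p q"
  using lipschitz_onD by (metis dist_real_def)

lemma dist_pt [simp]: "dist (pt x y) (pt x y') = \<bar>y - y'\<bar>"
proof -
  have "pt x y - pt x y' = (y - y') *\<^sub>R u" by (simp add: pt_def algebra_simps)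
  then show ?thesis by (simp add: dist_norm)
qed

lemma sample_lipschitz:
  assumes f: "1-lipschitz_on unit_square f" and s: "s \<in> idx m" and N: "0 < N" and ij: "i \<le> j" "j \<le> 3 * N"
  shows "\<bar>sample f N m s j - sample f N m s i\<bar> \<le> (real j - real i) * mesh m N"
proof -
  have "\<bar>sample f N m s j - sample f N m s i\<bar> \<le> 1 * \<bar>grid N m s j - grid N m s i\<bar>"
    unfolding sample_def using lipD[OF f sample_in_unit_square[OF s N ij(2)] sample_in_unit_square[OF s N, of i]] ij by simp
  also have "\<dots> = (real j - real i) * mesh m N"
  proof -
    have "grid N m s j - grid N m s i = (real j - real i) * mesh m N"
      by (simp add: grid_def left_diff_distrib diff_divide_distrib)
    moreover have "0 \<le> (real j - real i) * mesh m N"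
      using ij by (intro mult_nonneg_nonneg) (auto simp: less_imp_le)
    ultimately show ?thesis by (simp only: mult_1 abs_of_nonneg)
  qed
  finally show ?thesis .
qed

lemma defect_bounds:
  assumes f: "1-lipschitz_on unit_square f" and s: "s \<in> idx m" and N: "0 < N" and k: "k < 3 * N"
  shows "0 \<le> defect f N m s k" "defect f N m s k \<le> 2 * mesh m N"
  using sample_lipschitz[OF f s N, of k "Suc k"] k unfolding defect_def by (auto simp: abs_le_iff)

lemma sum_defect:
  assumes "i \<le> j"
  shows "sum (defect f N m s) {i..<j} = (real j - real i) * mesh m N - (sample f N m s j - sample f N m s i)"
proof -
  have "sum (defect f N m s) {i..<j} = (\<Sum>k=i..<j. mesh m N) - (\<Sum>k=i..<j. sample f N m s (Suc k) - sample f N m s k)"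
    unfolding defect_def by (rule sum_subtractf)
  then show ?thesis using assms sum_Suc_diff'[OF assms, of "sample f N m s"] by (simp add: of_nat_diff)
qed

lemma cell_subset:
  assumes f: "1-lipschitz_on unit_square f" and s: "s \<in> idx m" and N: "0 < N" and k: "k < 3 * N"
    and p: "p \<in> cell f N m w s k"
  shows "\<bar>p \<bullet> v - xc m s\<bar> \<le> w" "grid N m s k \<le> p \<bullet> u" "p \<bullet> u \<le> grid N m s k + mesh m N"
    "yc m s - len m \<le> p \<bullet> u" "p \<bullet> u \<le> yc m s + 2 * len m"
proof -
  show 1: "\<bar>p \<bullet> v - xc m s\<bar> \<le> w" and 2: "grid N m s k \<le> p \<bullet> u" using p by (auto simp: cell_def)
  show 3: "p \<bullet> u \<le> grid N m s k + mesh m N"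
    using p defect_bounds(1)[OF f s N k] by (auto simp: cell_def)
  have "grid N m s k + mesh m N = grid N m s (Suc k)" by (simp add: grid_def distrib_right add_divide_distrib)
  then show "p \<bullet> u \<le> yc m s + 2 * len m"
    using 3 grid_bounds(2)[OF N, of "Suc k" m s] k by simp
  show "yc m s - len m \<le> p \<bullet> u" using 2 grid_bounds(1)[OF N, of k m s] k by simp
qed

lemma ext_separated:
  assumes "s \<noteq> s'" 
    and p: "\<bar>p \<bullet> v - xc m s\<bar> \<le> len m" "yc m s - len m \<le> p \<bullet> u" "p \<bullet> u \<le> yc m s + 2 * len m"
    and q: "\<bar>q \<bullet> v - xc m s'\<bar> \<le> len m" "yc m s' - len m \<le> q \<bullet> u" "q \<bullet> u \<le> yc m s' + 2 * len m"
  shows "gap m / 2 \<le> dist p q"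
  using ypos_or_xpos_separated[OF assms(1), of m]
proof
  assume "gap m \<le> \<bar>xc m s - xc m s'\<bar>"
  then show ?thesis using p q frame_le_dist(1)[of p q] len_le[of m] gap_pos[of m] by linarith
next
  assume *: "fst s = fst s' \<and> per m \<le> \<bar>yc m s - yc m s'\<bar>"
  then show ?thesis using p q frame_le_dist(2)[of p q] len_le[of m] gap_le[of m] gap_pos[of m] by linarith
qed

text \<open>On one segment the prescribed values depend on the height only, and
  \<open>zigzag_lipschitz\<close> applies. Points of different segments are at least
  \<open>gap m / 2\<close> apart, and there the slack \<open>\<kappa>\<close> of \<open>f\<close>
  absorbs twice the perturbation \<open>w + 2 * mesh m N\<close>; the assumption
  \<open>small\<close> says this.\<close>

lemma zigzag_extension:
  assumes f: "(1 - \<kappa>)-lipschitz_on unit_square f" and \<kappa>: "0 < \<kappa>" "\<kappa> \<le> 1" and S: "S \<subseteq> idx m"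
    and N: "0 < N" and w: "0 < w" "w \<le> len m" and small: "w + 2 * mesh m N \<le> \<kappa> * gap m / 4"
  obtains g where "1-lipschitz_on unit_square g" "zigzag_on f N m w S g"
    "\<And>p. p \<in> unit_square \<Longrightarrow> \<bar>g p - f p\<bar> \<le> w + 2 * mesh m N"
proof -
  define h where "h = mesh m N"
  have h: "0 < h" using N by (simp add: h_def)
  have f1: "1-lipschitz_on unit_square f" using f \<kappa> by (auto intro: lipschitz_on_mono)
  define I where "I = (SIGMA s:S. SIGMA k:{..<3 * N}. cell f N m w s k)"
  define P where "P = (\<lambda>(s :: nat \<times> int, k :: nat, p :: real^2). p)"
  define c where "c = (\<lambda>(s, k, p). sample f N m s k + (p \<bullet> u - grid N m s k))"
  have sub: "p \<in> unit_square" "\<bar>p \<bullet> v - xc m s\<bar> \<le> len m" "yc m s - len m \<le> p \<bullet> u"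
      "p \<bullet> u \<le> yc m s + 2 * len m" "grid N m s k \<le> p \<bullet> u" "p \<bullet> u \<le> grid N m s k + h" 
      "\<bar>p \<bullet> v - xc m s\<bar> \<le> w"
    if "s \<in> S" "k < 3 * N" "p \<in> cell f N m w s k" for s k p
  proof -
    have s: "s \<in> idx m" using S that by auto
    note c = cell_subset[OF f1 s N that(2,3)]
    show "\<bar>p \<bullet> v - xc m s\<bar> \<le> len m" using c(1) w by simp
    then show "p \<in> unit_square" using ext_in_unit_square[OF s _ c(4,5)] interior_subset by blast
    show "yc m s - len m \<le> p \<bullet> u" "p \<bullet> u \<le> yc m s + 2 * len m"
      "grid N m s k \<le> p \<bullet> u" "p \<bullet> u \<le> grid N m s k + h" "\<bar>p \<bullet> v - xc m s\<bar> \<le> w" using c by (auto simp: h_def)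
  qed
  have close: "\<bar>(sample f N m s k + (p \<bullet> u - grid N m s k)) - f p\<bar> \<le> w + 2 * h"
    if "s \<in> S" "k < 3 * N" "p \<in> cell f N m w s k" for s k p
  proof -
    note c = sub[OF that]
    have s: "s \<in> idx m" using S that by auto
    have "\<bar>sample f N m s k - f p\<bar> \<le> 1 * dist (pt (xc m s) (grid N m s k)) p"
      unfolding sample_def using that N by (intro lipD[OF f1 sample_in_unit_square[OF s N] c(1)]) auto
    also have "\<dots> \<le> w + h"
      using dist_le_frame[of "pt (xc m s) (grid N m s k)" p] c(5,6,7) by simp
    finally show ?thesis using c(5,6) by linarith
  qed
  have lip: "\<bar>(sample f N m s k + (p \<bullet> u - grid N m s k)) - (sample f N m s' k' + (q \<bullet> u - grid N m s' k'))\<bar> \<le> dist p q"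
    if a: "s \<in> S" "k < 3 * N" "p \<in> cell f N m w s k" and b: "s' \<in> S" "k' < 3 * N" "q \<in> cell f N m w s' k'" for s k p s' k' q
  proof (cases "s = s'")
    case True
    have s: "s \<in> idx m" using S a by auto
    have grid_eq: "grid N m s k = grid N m s 0 + real k * h" for k by (simp add: grid_def h_def)
    have key: "\<bar>(sample f N m s k' + (q \<bullet> u - grid N m s k')) - (sample f N m s k + (p \<bullet> u - grid N m s k))\<bar> \<le> \<bar>p \<bullet> u - q \<bullet> u\<bar>"
      if "k < k'" "k' < 3 * N" "p \<in> cell f N m w s k" "q \<in> cell f N m w s k'" for k k' p q
    proof -
      \<comment> \<open>Samples are frozen beyond the end of the grid, so that the Lipschitz bound
        holds for all indices.\<close>
      define W where "W i = sample f N m s (min i (3 * N))" for i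
      have W: "W i = sample f N m s i" if "i \<le> 3 * N" for i using that by (simp add: W_def)
      have "\<bar>(W k' + (q \<bullet> u - (grid N m s 0 + real k' * h))) - (W k + (p \<bullet> u - (grid N m s 0 + real k * h)))\<bar> \<le> q \<bullet> u - p \<bullet> u"
      proof (rule zigzag_lipschitz)
        show "\<bar>W j - W i\<bar> \<le> (real j - real i) * h" if "i \<le> j" for i j
        proof -
          have "\<bar>W j - W i\<bar> \<le> (real (min j (3 * N)) - real (min i (3 * N))) * h"
            unfolding W_def h_def using that by (intro sample_lipschitz[OF f1 s N]) auto
          also have "\<dots> \<le> (real j - real i) * h" using that h by (intro mult_right_mono) auto
          finally show ?thesis .
        qed
        have W': "W k = sample f N m s k" "W (Suc k) = sample f N m s (Suc k)"
          "W k' = sample f N m s k'" "W (Suc k') = sample f N m s (Suc k')"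
          using that by (auto intro!: W)
        show "grid N m s 0 + real k * h \<le> p \<bullet> u" "grid N m s 0 + real k' * h \<le> q \<bullet> u"
          "p \<bullet> u \<le> grid N m s 0 + real k * h + h - (h - (W (Suc k) - W k)) / 2"
          "q \<bullet> u \<le> grid N m s 0 + real k' * h + h - (h - (W (Suc k') - W k')) / 2"
          using that(3,4) unfolding W' cell_def mem_Collect_eq grid_eq[of k] grid_eq[of k'] defect_def h_def[symmetric]
          by blast+
      qed (rule that)
      then show ?thesis using that W[of k] W[of k'] unfolding grid_eq[of k] grid_eq[of k'] by linarith
    qed
    consider "k < k'" | "k = k'" | "k' < k" by linarith
    then have "\<bar>(sample f N m s k + (p \<bullet> u - grid N m s k)) - (sample f N m s k' + (q \<bullet> u - grid N m s k'))\<bar> \<le> \<bar>p \<bullet> u - q \<bullet> u\<bar>"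
    proof cases
      case 1
      then show ?thesis using key[of k k' p q] a b True by (simp add: abs_minus_commute)
    next
      case 3
      then show ?thesis using key[of k' k q p] a b True by (simp add: abs_minus_commute)
    qed simp
    then show ?thesis using frame_le_dist(2)[of p q] True by simp
  next
    case False
    have "gap m / 2 \<le> dist p q" using sub[OF a] sub[OF b] by (intro ext_separated[OF False])
    then have "\<kappa> * (gap m / 2) \<le> \<kappa> * dist p q" using \<kappa> by (intro mult_left_mono) auto
    moreover have "\<bar>f p - f q\<bar> \<le> (1 - \<kappa>) * dist p q" using lipD[OF f] sub(1)[OF a] sub(1)[OF b] by blast
    moreover have "(1 - \<kappa>) * dist p q = dist p q - \<kappa> * dist p q" by (simp add: algebra_simps)
    ultimately show ?thesis using close[OF a] close[OF b] small unfolding h_def[symmetric] by linarith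
  qed
  obtain g where g: "1-lipschitz_on unit_square g" "\<And>i. i \<in> I \<Longrightarrow> g (P i) = c i"
     "\<And>x. x \<in> unit_square \<Longrightarrow> \<bar>g x - f x\<bar> \<le> w + 2 * h"
  proof (rule lipschitz1_clamp_extension_family[OF f1, of I P c "w + 2 * h"])
    show "P i \<in> unit_square" if "i \<in> I" for i using that sub(1) by (auto simp: I_def P_def)
    show "\<bar>c i - c j\<bar> \<le> dist (P i) (P j)" if "i \<in> I" "j \<in> I" for i j
      using that by (auto simp: I_def P_def c_def intro!: lip)
    show "\<bar>c i - f (P i)\<bar> \<le> w + 2 * h" if "i \<in> I" for i
      using that by (auto simp: I_def P_def c_def intro!: close)
  qed (use w h in auto)
  show ?thesis
  proof (rule that[OF g(1)])
    show "zigzag_on f N m w S g"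
      unfolding zigzag_on_def
    proof (intro ballI allI impI)
      fix s k p assume "s \<in> S" "k < 3 * N" "p \<in> cell f N m w s k"
      then show "g p = sample f N m s k + (p \<bullet> u - grid N m s k)"
        using g(2)[of "(s, k, p)"] by (auto simp: I_def P_def c_def)
    qed
  qed (use g(3) in \<open>auto simp: h_def\<close>)
qed

end

lemma card_heavy_le:
  assumes d: "\<And>k. k < n \<Longrightarrow> 0 \<le> d k" and c: "0 \<le> c"
  shows "c * card {k. k < n \<and> heavy n d c k} \<le> 4 * sum d {..<n}"
proof -
  \<comment> \<open>Extension by 0 provides the global nonnegativity that \<open>card_heavy\<close>
    asks for, without changing sums inside \<open>{..<n}\<close>.\<close>
  define d' where "d' k = (if k < n then d k else 0)" for k
  have eq: "sum d' {i..<j} = sum d {i..<j}" if "j \<le> n" for i j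
    using that by (intro sum.cong) (auto simp: d'_def)
  have eq0: "sum d' {..<n} = sum d {..<n}" by (intro sum.cong) (auto simp: d'_def)
  have "heavy n d c k \<longleftrightarrow> (\<exists>i\<le>k. \<exists>j>k. j \<le> n \<and> 2 * (c / 2) * (real j - real i) < sum d' {i..<j})" for k
    unfolding heavy_def by (simp add: eq cong: conj_cong)
  then have "(c / 2) * card {k. k < n \<and> heavy n d c k} \<le> 2 * sum d' {..<n}"
    using card_heavy[of d' "c / 2" n] d c by (simp add: d'_def)
  then show ?thesis using eq0 by simp
qed

section \<open>Segments of a finer level inside good cells\<close>

context frame
begin

text \<open>Once \<open>len m'\<close> is at most \<open>mu m * mesh m N\<close>, the two margins
  keep the tripled segment of \<open>s'\<close> inside cell \<open>k\<close>, where the perturbed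
  function has slope 1. The upper margin is larger because it also pays for the part of the cell cut
  off by the defect.\<close>

definition child :: "(real^2 \<Rightarrow> real) \<Rightarrow> nat \<Rightarrow> nat \<Rightarrow> real \<Rightarrow> nat \<times> int \<Rightarrow> nat \<Rightarrow> nat \<times> int \<Rightarrow> nat \<Rightarrow> bool" where
  "child f N m w s m' s' k \<longleftrightarrow> N \<le> k \<and> k < 2 * N \<and>
     \<not> heavy (3 * N) (defect f N m s) ((mu m)\<^sup>2 * mesh m N) k \<and>
     \<bar>xc m' s' - xc m s\<bar> + len m' \<le> w \<and>
     grid N m s k + mu m * mesh m N \<le> yc m' s' \<and>
     yc m' s' + len m' \<le> grid N m s k + (1 - 2 * mu m) * mesh m N"

abbreviation "children f N m w s m' l \<equiv> {s'. (\<exists>k. child f N m w s m' s' k) \<and> kind m' (fst s') = sector m' l}"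

lemma zigzag_exact:
  assumes g: "zigzag_on f N m w S g" and s: "s \<in> S" "k < 3 * N" and x: "\<bar>x - xc m s\<bar> \<le> w"
    and y: "grid N m s k \<le> y" "y \<le> grid N m s k + mesh m N - defect f N m s k / 2"
  shows "g (pt x y) = sample f N m s k + (y - grid N m s k)"
proof -
  have "pt x y \<in> cell f N m w s k" using x y by (simp add: cell_def)
  then show ?thesis using g s unfolding zigzag_on_def by fastforce
qed

lemma defect_le_not_heavy:
  assumes "\<not> heavy n (defect f N m s) c k" "k < n"
  shows "defect f N m s k \<le> c"
proof -
  have "\<not> c * (real (Suc k) - real k) < sum (defect f N m s) {k..<Suc k}"
    using assms unfolding heavy_def by (metis Suc_leI lessI order_refl)
  then show ?thesis by simp
qed

lemma mu_sq_le: "(mu m)\<^sup>2 \<le> mu m"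
  using mu_small[of m] mu_pos[of m] by (simp add: power2_eq_square mult_left_le_one_le less_imp_le)

text \<open>For \<open>t\<close> below \<open>mu m * mesh m N\<close> both points stay in the cell
  and the slope is 1. For larger \<open>t\<close> the enclosing grid interval has length at most
  \<open>2 * t + 2 * mesh m N\<close> and, \<open>k\<close> not being heavy, a defect of at most
  \<open>(mu m)\<^sup>2\<close> times that length. One factor \<open>mu m\<close> reduces the mesh
  to at most \<open>t\<close>, so the loss is at most \<open>4 * mu m * t\<close>; this is why
  heaviness is measured with \<open>(mu m)\<^sup>2\<close>.\<close>

lemma zigzag_slope:
  assumes f: "1-lipschitz_on unit_square f" and g: "1-lipschitz_on unit_square g" and z: "zigzag_on f N m w S g"
    and S: "s \<in> S" "S \<subseteq> idx m" and N: "4 \<le> N" and w: "w \<le> len m"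
    and k: "N \<le> k" "k < 2 * N" "\<not> heavy (3 * N) (defect f N m s) ((mu m)\<^sup>2 * mesh m N) k"
    and x: "\<bar>x - xc m s\<bar> \<le> w"
    and y: "grid N m s k + mu m * mesh m N \<le> y" "y \<le> grid N m s k + (1 - 2 * mu m) * mesh m N"
    and t: "0 < t" "t \<le> len m / 2"
  shows "2 * t * (1 - 2 * mu m) \<le> g (pt x (y + t)) - g (pt x (y - t))"
proof -
  define h where "h = mesh m N"
  define M where "M = mu m"
  have M: "0 < M" "M \<le> 1 / 800" "M\<^sup>2 \<le> M" using mu_small[of m] mu_sq_le[of m] by (auto simp: M_def)
  have N0: "0 < N" using N by simp
  have h: "0 < h" "real N * h = len m" using N0 by (auto simp: h_def)
  have s: "s \<in> idx m" using S by auto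
  have grid: "grid N m s i = yc m s - len m + real i * h" for i by (simp add: grid_def h_def)
  have kN: "real N * h \<le> real k * h" "real k * h + h \<le> 2 * (real N * h)"
  proof -
    show "real N * h \<le> real k * h" using k h by (intro mult_right_mono) auto
    have "(real k + 1) * h \<le> (2 * real N) * h" using k h by (intro mult_right_mono) auto
    then show "real k * h + h \<le> 2 * (real N * h)" by (simp add: algebra_simps)
  qed
  have Mh: "0 < M * h" "M * h \<le> h" "M\<^sup>2 * h \<le> M * h" using M h by (auto intro: mult_right_mono)
  have y1: "grid N m s k + M * h \<le> y" "y \<le> grid N m s k + h - 2 * (M * h)"
    using y unfolding M_def[symmetric] h_def[symmetric] by (simp_all add: algebra_simps)
  have vert: "g (pt x b) - g (pt x a) \<le> b - a"
    if "a \<le> b" "yc m s - len m \<le> a" "b \<le> yc m s + 2 * len m" for a b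
  proof -
    have "pt x a \<in> unit_square" "pt x b \<in> unit_square"
      using ext_in_unit_square[OF s, of "pt x a"] ext_in_unit_square[OF s, of "pt x b"] that x w interior_subset
      by auto
    then show ?thesis using lipD[OF g, of "pt x b" "pt x a"] that(1) by (simp add: abs_le_iff)
  qed
  show ?thesis
  proof (cases "t < M * h")
    case True
    have "defect f N m s k \<le> M\<^sup>2 * h"
      using defect_le_not_heavy[OF k(3)] k(2) unfolding M_def h_def by simp
    then have d: "defect f N m s k / 2 \<le> M * h" using Mh by linarith
    have "g (pt x (y + t)) = sample f N m s k + ((y + t) - grid N m s k)"
      using True y1 t d k(2) Mh by (intro zigzag_exact[OF z S(1) _ x]) (auto simp: h_def[symmetric])
    moreover have "g (pt x (y - t)) = sample f N m s k + ((y - t) - grid N m s k)"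
      using True y1 t d k(2) Mh by (intro zigzag_exact[OF z S(1) _ x]) (auto simp: h_def[symmetric])
    ultimately have "g (pt x (y + t)) - g (pt x (y - t)) = 2 * t" by simp
    moreover have "2 * t * (1 - 2 * M) \<le> 2 * t * 1" using t M by (intro mult_left_mono) auto
    ultimately show ?thesis by (simp add: M_def)
  next
    case False
    define i where "i = nat \<lfloor>(y - t - grid N m s 0) / h\<rfloor>"
    define j where "j = nat \<lceil>(y + t - grid N m s 0) / h\<rceil>"
    have lo: "0 \<le> y - t - grid N m s 0" using y1 Mh kN h t grid[of k] grid[of 0] by simp
    have hi: "y + t - grid N m s 0 \<le> 5 / 2 * (real N * h)" using y1 Mh kN h t grid[of k] grid[of 0] by simp
    have i: "real i * h \<le> y - t - grid N m s 0" "y - t - grid N m s 0 < real i * h + h"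
    proof -
      have "0 \<le> (y - t - grid N m s 0) / h" using lo h by simp
      then have "real i \<le> (y - t - grid N m s 0) / h" "(y - t - grid N m s 0) / h < real i + 1"
        unfolding i_def by linarith+
      then show "real i * h \<le> y - t - grid N m s 0" "y - t - grid N m s 0 < real i * h + h"
        using h(1) by (simp_all add: field_simps)
    qed
    have j: "y + t - grid N m s 0 \<le> real j * h" "real j * h < y + t - grid N m s 0 + h"
    proof -
      have "0 \<le> (y + t - grid N m s 0) / h" using lo t h by simp
      then have "(y + t - grid N m s 0) / h \<le> real j" "real j < (y + t - grid N m s 0) / h + 1"
        unfolding j_def by linarith+
      then show "y + t - grid N m s 0 \<le> real j * h" "real j * h < y + t - grid N m s 0 + h"
        using h(1) by (simp_all add: field_simps)
    qed
    \<comment> \<open>Here \<open>4 \<le> N\<close> enters: rounding up by one mesh interval beyond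
      \<open>5 / 2 * len m\<close> does not reach the end of the grid.\<close>
    have "real j * h < (3 * real N) * h"
    proof -
      have "real N * h \<ge> 4 * h" using N h by (intro mult_right_mono) auto
      moreover have "(3 * real N) * h = 3 * (real N * h)" by simp
      ultimately show ?thesis using j(2) hi h(1) by linarith
    qed
    then have "real j < 3 * real N" using h(1) by simp
    then have jN: "j < 3 * N" by linarith
    have "real i * h < (real k + 1) * h" using i(1) y1 Mh t grid[of k] grid[of 0] h by (simp add: algebra_simps)
    then have ik: "i \<le> k" using h(1) by simp
    have "grid N m s k = grid N m s 0 + real k * h" by (simp add: grid)
    then have "real k * h < real j * h" using j(1) y1(1) Mh(1) t(1) by linarith
    then have kj: "k < j" using h(1) by simp
    \<comment> \<open>A grid point is the lower end of its own cell, which is nonempty because a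
      defect is at most two mesh intervals.\<close>
    have exact: "g (pt x (grid N m s l)) = sample f N m s l" if "l < 3 * N" for l
      using zigzag_exact[OF z S(1) that x, of "grid N m s l"] defect_bounds(2)[OF f s N0 that] by (simp add: mult.commute)
    have "sum (defect f N m s) {i..<j} \<le> M\<^sup>2 * h * (real j - real i)"
      using k(3) ik kj jN unfolding heavy_def M_def h_def by (metis less_imp_le not_le)
    also have "\<dots> = M\<^sup>2 * (real j * h - real i * h)" by (simp add: algebra_simps)
    also have "\<dots> \<le> M\<^sup>2 * (2 * t + 2 * h)" using i j by (intro mult_left_mono) auto
    also have "\<dots> = M\<^sup>2 * (2 * t) + 2 * (M * (M * h))" by (simp add: power2_eq_square algebra_simps)
    also have "\<dots> \<le> M * (2 * t) + 2 * (M * t)"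
      using False M t by (intro add_mono mult_right_mono mult_left_mono) auto
    finally have sd: "sum (defect f N m s) {i..<j} \<le> 4 * (M * t)" by simp
    have eq: "sum (defect f N m s) {i..<j} = grid N m s j - grid N m s i - (sample f N m s j - sample f N m s i)"
      using sum_defect[of i j f N m s] ik kj by (simp add: grid h_def[symmetric] left_diff_distrib)
    have gj: "grid N m s j \<le> yc m s + 2 * len m" "yc m s - len m \<le> grid N m s i"
      using grid_bounds(2)[OF N0, of j m s] grid_bounds(1)[OF N0, of i m s] jN ik kj by auto
    have "g (pt x (grid N m s j)) - g (pt x (y + t)) \<le> grid N m s j - (y + t)"
      using gj j lo t by (intro vert) (auto simp: grid)
    moreover have "g (pt x (y - t)) - g (pt x (grid N m s i)) \<le> (y - t) - grid N m s i"
      using gj i hi t h by (intro vert) (auto simp: grid)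
    ultimately have "2 * t - 4 * (M * t) \<le> g (pt x (y + t)) - g (pt x (y - t))"
      using exact[OF jN] exact[of i] ik kj jN sd eq by linarith
    then show ?thesis unfolding M_def[symmetric] by (simp add: algebra_simps)
  qed
qed

text \<open>The exponent 4 in the hypothesis is two plus two: a total defect below
  \<open>3 * len m * mu m ^ 4\<close>, divided by the heaviness threshold
  \<open>(mu m)\<^sup>2\<close> in the maximal inequality, leaves a proportion of order
  \<open>(mu m)\<^sup>2\<close> of heavy cells.\<close>

lemma heavy_defect_le:
  assumes f: "1-lipschitz_on unit_square f" and s: "s \<in> idx m" and N: "0 < N"
    and steep: "3 * len m * (1 - mu m ^ 4) < f (pt (xc m s) (yc m s + 2 * len m)) -
      f (pt (xc m s) (yc m s - len m))"
  shows "real (card (heavy_cells f N m s)) * mesh m N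
    \<le> 12 * len m * (mu m)\<^sup>2"
proof -
  let ?c = "real (card (heavy_cells f N m s))"
  have "(mu m)\<^sup>2 * mesh m N * ?c \<le> 4 * sum (defect f N m s) {..<3 * N}"
    using defect_bounds(1)[OF f s N] by (intro card_heavy_le) (auto simp: less_imp_le)
  also have "sum (defect f N m s) {..<3 * N} = 3 * len m - (sample f N m s (3 * N) - sample f N m s 0)"
    using sum_defect[of 0 "3 * N" f N m s] N by (simp add: atLeast0LessThan)
  also have "sample f N m s (3 * N) - sample f N m s 0 =
      f (pt (xc m s) (yc m s + 2 * len m)) - f (pt (xc m s) (yc m s - len m))"
    using N by (simp add: sample_def grid_def add.commute)
  also have "4 * (3 * len m - \<dots>) \<le> (mu m)\<^sup>2 * (12 * len m * (mu m)\<^sup>2)"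
  proof -
    have "(mu m)\<^sup>2 * (12 * len m * (mu m)\<^sup>2) = 12 * len m * mu m ^ 4"
      by (simp add: power2_eq_square eval_nat_numeral)
    then show ?thesis using steep by (simp add: algebra_simps)
  qed
  finally have "(mu m)\<^sup>2 * (?c * mesh m N) \<le> (mu m)\<^sup>2 * (12 * len m * (mu m)\<^sup>2)"
    by (simp add: mult_ac)
  then show ?thesis using zero_less_power[OF mu_pos[of m], of 2] by (rule mult_left_le_imp_le)
qed

text \<open>What stays uncovered comes from heavy cells or from the ends of the other cells.
  Elsewhere \<open>strip_covers\<close>, started at the abscissa of \<open>s\<close>, supplies a
  segment of the right kind whose shadow contains the given point and which fits into the
  cell.\<close>

lemma shadow_covered:
  assumes N: "0 < N" and s: "s \<in> idx m" and \<lambda>: "-1 \<le> l" "l \<le> 1"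
    and hv: "real (card (heavy_cells f N m s)) * mesh m N
      \<le> 12 * len m * (mu m)\<^sup>2"
    and e: "5 / real (lev m') \<le> w" "12 * real N / real (lev m') \<le> mu m * len m"
  shows "emeasure lborel (shadow l m s - (\<Union>s'\<in>children f N m w s m' l. shadow l m' s'))
    \<le> ennreal (10 * mu m * len m)"
proof -
  define h where "h = mesh m N"
  define \<epsilon> where "\<epsilon> = 1 / real (lev m')"
  define M where "M = mu m"
  have M: "0 < M" "M \<le> 1 / 800" using mu_small[of m] by (auto simp: M_def)
  have h: "0 < h" "real N * h = len m" using N by (auto simp: h_def)
  have \<epsilon>: "0 < \<epsilon>" "len m' \<le> \<epsilon>" "5 * \<epsilon> \<le> w" "12 * real N * \<epsilon> \<le> M * len m"
    using len_le_inverse_lev[of m'] e by (auto simp: \<epsilon>_def M_def)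
  define bad where "bad k \<longleftrightarrow> heavy (3 * N) (defect f N m s) ((mu m)\<^sup>2 * mesh m N) k" for k
  define c where "c = l * xc m s"
  have Mh: "0 \<le> M * h" using M h by simp
  \<comment> \<open>\<open>6 * \<epsilon>\<close> allows for the new abscissa, at most
    \<open>4 * \<epsilon>\<close> away and weighted by a slope of at most 1, and for the length of
    the new segment, at most \<open>\<epsilon>\<close>. The multiples of \<open>M * h\<close> are
    the margins of \<open>child\<close>.\<close>
  define J where "J k = (if bad k then {grid N m s k + c..grid N m s k + c + h}
     else {grid N m s k + c..grid N m s k + c + (M * h + 6 * \<epsilon>)} \<union>
       {grid N m s k + c + h - (2 * (M * h) + 6 * \<epsilon>)..grid N m s k + c + h})" for k
  define b where "b k = (if bad k then h else 0) + (3 * (M * h) + 12 * \<epsilon>)" for k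
  have J: "J k \<in> sets lborel" "emeasure lborel (J k) \<le> ennreal (b k)" for k
  proof -
    show "J k \<in> sets lborel" by (simp add: J_def)
    show "emeasure lborel (J k) \<le> ennreal (b k)"
    proof (cases "bad k")
      case True
      then show ?thesis using h(1) Mh \<epsilon>(1) by (simp add: J_def b_def ennreal_leI)
    next
      case False
      have "emeasure lborel (J k) \<le> emeasure lborel {grid N m s k + c..grid N m s k + c + (M * h + 6 * \<epsilon>)} +
          emeasure lborel {grid N m s k + c + h - (2 * (M * h) + 6 * \<epsilon>)..grid N m s k + c + h}"
        using False unfolding J_def by (simp only: if_False) (intro emeasure_subadditive, auto)
      also have "\<dots> = ennreal (M * h + 6 * \<epsilon>) + ennreal (2 * (M * h) + 6 * \<epsilon>)"
        using Mh \<epsilon>(1) by simp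
      also have "\<dots> = ennreal (b k)"
        using False Mh \<epsilon>(1) by (simp add: b_def ennreal_plus[symmetric] del: ennreal_plus)
      finally show ?thesis .
    qed
  qed
  have grid: "grid N m s i = yc m s - len m + real i * h" for i by (simp add: grid_def h_def)
  have "shadow l m s - (\<Union>s'\<in>children f N m w s m' l. shadow l m' s') \<subseteq> (\<Union>k\<in>{N..<2*N}. J k)"
  proof (intro subsetI, rule ccontr)
    fix z assume z: "z \<in> shadow l m s - (\<Union>s'\<in>children f N m w s m' l. shadow l m' s')"
      and nJ: "z \<notin> (\<Union>k\<in>{N..<2*N}. J k)"
    define y where "y = z - c"
    have y: "yc m s \<le> y" "y \<le> yc m s + len m"
      using z by (auto simp: shadow_def y_def c_def)
    obtain k where k: "N \<le> k" "k < 2 * N" "grid N m s k \<le> y" "y \<le> grid N m s k + h"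
    proof -
      define q where "q = (y - grid N m s 0) / h"
      have q: "real N \<le> q" "q \<le> 2 * real N"
        using y h N unfolding q_def by (simp_all add: grid pos_le_divide_eq pos_divide_le_eq)
      \<comment> \<open>The minimum matters only at the upper end of the segment, where
        \<open>q\<close> equals \<open>2 * N\<close>.\<close>
      define k where "k = min (nat \<lfloor>q\<rfloor>) (2 * N - 1)"
      have "N \<le> nat \<lfloor>q\<rfloor>" using q by (simp add: le_nat_floor)
      then have k: "N \<le> k" "k < 2 * N" using N by (auto simp: k_def)
      have "real k \<le> q" using q unfolding k_def by (metis min.cobounded1 le_nat_iff nat_floor_neg of_nat_0_le_iff of_nat_floor of_nat_le_iff order_trans)
      moreover have "q \<le> real k + 1"
      proof (cases "nat \<lfloor>q\<rfloor> \<le> 2 * N - 1")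
        case True
        then have "k = nat \<lfloor>q\<rfloor>" by (simp add: k_def)
        then show ?thesis by linarith
      next
        case False
        then have "k = 2 * N - 1" by (simp add: k_def)
        then show ?thesis using q N by (simp add: of_nat_diff)
      qed
      ultimately have "real k * h \<le> y - grid N m s 0" "y - grid N m s 0 \<le> (real k + 1) * h"
        using h(1) unfolding q_def by (simp_all only: pos_le_divide_eq pos_divide_le_eq)
      then show ?thesis using that[OF k] by (simp add: grid algebra_simps)
    qed
    have "z \<notin> J k" using nJ k by auto
    then have nb: "\<not> bad k" and y1: "grid N m s k + (M * h + 6 * \<epsilon>) \<le> y" "y \<le> grid N m s k + h - (2 * (M * h) + 6 * \<epsilon>)"
      using k by (auto simp: J_def y_def split: if_splits)
    have x0: "0 \<le> xc m s" by (simp add: xpos_def less_imp_le)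
    obtain i j where ij: "kind m' i = sector m' l" "xc m s \<le> xpos m' i" "xpos m' i \<le> xc m s + 4 / real (lev m')"
        "ypos m' i j + l * xpos m' i \<le> z" "z \<le> ypos m' i j + l * xpos m' i + len m'"
      using strip_covers[OF \<lambda> x0] by blast
    have dx: "\<bar>l * xpos m' i - c\<bar> \<le> 4 * \<epsilon>"
    proof -
      have "\<bar>l * xpos m' i - c\<bar> = \<bar>l\<bar> * \<bar>xpos m' i - xc m s\<bar>"
        by (simp add: c_def abs_mult[symmetric] right_diff_distrib)
      also have "\<dots> \<le> 1 * (4 * \<epsilon>)" using \<lambda> ij(2,3) by (intro mult_mono) (auto simp: \<epsilon>_def)
      finally show ?thesis by simp
    qed
    have "child f N m w s m' (i, j) k"
      unfolding child_def fst_conv snd_conv M_def[symmetric] h_def[symmetric]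
    proof (intro conjI)
      show "\<not> heavy (3 * N) (defect f N m s) (M\<^sup>2 * h) k" using nb by (simp add: bad_def M_def h_def)
      show "\<bar>xpos m' i - xc m s\<bar> + len m' \<le> w" using ij(2,3) \<epsilon> by (simp add: \<epsilon>_def)
      show "grid N m s k + M * h \<le> ypos m' i j" using dx ij(4,5) y1 \<epsilon> by (simp add: y_def abs_le_iff)
      show "ypos m' i j + len m' \<le> grid N m s k + (1 - 2 * M) * h"
        using dx ij(4,5) y1 \<epsilon> by (simp add: y_def abs_le_iff algebra_simps)
    qed (use k in auto)
    moreover have "z \<in> shadow l m' (i, j)" using ij by (simp add: shadow_def)
    ultimately show False using z ij(1) by fastforce
  qed
  then have "emeasure lborel (shadow l m s - (\<Union>s'\<in>children f N m w s m' l. shadow l m' s'))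
      \<le> emeasure lborel (\<Union>k\<in>{N..<2*N}. J k)"
    using J by (intro emeasure_mono sets.finite_UN) auto
  also have "\<dots> \<le> (\<Sum>k\<in>{N..<2*N}. emeasure lborel (J k))"
    using J by (intro emeasure_subadditive_finite) auto
  also have "\<dots> \<le> (\<Sum>k\<in>{N..<2*N}. ennreal (b k))" by (intro sum_mono J)
  also have "\<dots> = ennreal (\<Sum>k\<in>{N..<2*N}. b k)"
    using h Mh \<epsilon>(1) by (intro sum_ennreal) (auto simp: b_def)
  also have "(\<Sum>k\<in>{N..<2*N}. b k) \<le> 10 * mu m * len m"
  proof -
    have "(\<Sum>k\<in>{N..<2*N}. b k) = (\<Sum>k\<in>{N..<2*N}. if bad k then h else 0) + real N * (3 * (M * h) + 12 * \<epsilon>)"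
      unfolding b_def sum.distrib by (simp add: distrib_left)
    also have "(\<Sum>k\<in>{N..<2*N}. if bad k then h else 0) = real (card {k\<in>{N..<2*N}. bad k}) * h"
      by (simp add: sum.inter_filter[symmetric])
    also have "\<dots> \<le> real (card {k. k < 3 * N \<and> bad k}) * h"
    proof -
      have "finite {k. k < 3 * N \<and> bad k}" by (rule finite_subset[of _ "{..<3*N}"]) auto
      then have "card {k\<in>{N..<2*N}. bad k} \<le> card {k. k < 3 * N \<and> bad k}" by (rule card_mono) auto
      then show ?thesis using h(1) by (intro mult_right_mono) auto
    qed
    also have "\<dots> \<le> 12 * len m * M\<^sup>2" using hv unfolding bad_def M_def h_def by simp
    also have "12 * len m * M\<^sup>2 \<le> M * len m"
    proof -
      have "(12 * M) * (M * len m) \<le> 1 * (M * len m)" using M by (intro mult_right_mono) (auto simp: less_imp_le)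
      then show ?thesis by (simp add: power2_eq_square mult_ac)
    qed
    also have "real N * (3 * (M * h) + 12 * \<epsilon>) \<le> 4 * (M * len m)"
    proof -
      have "real N * (3 * (M * h) + 12 * \<epsilon>) = 3 * (M * (real N * h)) + 12 * real N * \<epsilon>" by (simp add: algebra_simps)
      then show ?thesis using \<epsilon>(4) h(2) by simp
    qed
    finally have "(\<Sum>k\<in>{N..<2*N}. b k) \<le> 5 * (M * len m)" by simp
    also have "\<dots> \<le> 10 * M * len m" using M by (simp add: less_imp_le)
    finally show ?thesis by (simp add: M_def)
  qed
  finally show ?thesis by (simp add: ennreal_leI)
qed


section \<open>Open conditions and one refinement step\<close>

definition steep :: "nat \<Rightarrow> (nat \<times> int) set \<Rightarrow> (real^2 \<Rightarrow> real) set" where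
  "steep m S = {f \<in> mspace Lip1. \<forall>s\<in>S. 3 * len m * (1 - mu m ^ 4) <
     f (pt (xc m s) (yc m s + 2 * len m)) - f (pt (xc m s) (yc m s - len m))}"

text \<open>The slack \<open>\<eta>\<close> makes this an open condition on \<open>f\<close>.\<close>

definition linked :: "nat \<Rightarrow> nat \<Rightarrow> (nat \<times> int) set \<Rightarrow> (real^2 \<Rightarrow> real) set" where
  "linked m m' S' = {f \<in> mspace Lip1. \<exists>\<eta>>0. \<forall>s\<in>S'. \<forall>p\<in>rect m' s. \<forall>t. len m' / 2 \<le> t \<and> t \<le> len m / 2 \<longrightarrow>
     p + t *\<^sub>R u \<in> unit_square \<and> p - t *\<^sub>R u \<in> unit_square \<and>
     2 * t * (1 - 3 * mu m) + \<eta> \<le> f (p + t *\<^sub>R u) - f (p - t *\<^sub>R u)}"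

abbreviation "heirs m s m' S' l \<equiv> {s' \<in> S'. kind m' (fst s') = sector m' l \<and> rect m' s' \<subseteq> rect m s}"

text \<open>One set \<open>S'\<close> has to serve all directions \<open>l\<close> at once, each
  through its own heirs. No function occurs: the relation concerns the fixed pattern only.\<close>

definition refines :: "nat \<Rightarrow> (nat \<times> int) set \<Rightarrow> nat \<Rightarrow> (nat \<times> int) set \<Rightarrow> bool" where
  "refines m S m' S' \<longleftrightarrow> m < m' \<and> S' \<subseteq> idx m' \<and>
     (\<forall>s\<in>S. \<forall>l\<in>{-1..1}. emeasure lborel (shadow l m s -
       (\<Union>s'\<in>heirs m s m' S' l. shadow l m' s')) \<le> ennreal (10 * mu m * len m))"

lemma openin_steep:
  assumes "S \<subseteq> idx m"
  shows "openin (mtopology_of Lip1) (steep m S)"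
proof -
  have "finite S" using assms finite_idx finite_subset by blast
  then show ?thesis using assms
  proof (induction S)
    case empty
    have "steep m {} = topspace (mtopology_of Lip1)" by (simp add: steep_def)
    then show ?case by (metis openin_topspace)
  next
    case (insert s S)
    define a b where "a = pt (xc m s) (yc m s + 2 * len m)"
      and "b = pt (xc m s) (yc m s - len m)"
    have ab: "a \<in> unit_square" "b \<in> unit_square"
      using ext_in_unit_square[of s m a] ext_in_unit_square[of s m b] insert.prems interior_subset
      by (auto simp: a_def b_def less_imp_le)
    have "openin (mtopology_of Lip1) {f \<in> mspace Lip1. 3 * len m * (1 - mu m ^ 4) < f a - f b}"
    proof (rule openin_Lip1I)
      fix f assume f: "f \<in> {f \<in> mspace Lip1. 3 * len m * (1 - mu m ^ 4) < f a - f b}"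
      let ?r = "(f a - f b - 3 * len m * (1 - mu m ^ 4)) / 2"
      have "g \<in> {f \<in> mspace Lip1. 3 * len m * (1 - mu m ^ 4) < f a - f b}"
        if "g \<in> mspace Lip1" "\<forall>x\<in>unit_square. \<bar>g x - f x\<bar> < ?r" for g
      proof -
        have "\<bar>g a - f a\<bar> < ?r" "\<bar>g b - f b\<bar> < ?r" using that(2) ab by blast+
        then have "3 * len m * (1 - mu m ^ 4) < g a - g b" by argo
        then show ?thesis using that(1) by simp
      qed
      then show "\<exists>r>0. \<forall>g\<in>mspace Lip1. (\<forall>x\<in>unit_square. \<bar>g x - f x\<bar> < r) \<longrightarrow> g \<in> {f \<in> mspace Lip1. 3 * len m * (1 - mu m ^ 4) < f a - f b}"
        using f by (intro exI[of _ ?r]) auto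
    qed auto
    moreover have "steep m (insert s S) = {f \<in> mspace Lip1. 3 * len m * (1 - mu m ^ 4) < f a - f b} \<inter> steep m S"
      by (auto simp: steep_def a_def b_def)
    ultimately show ?case using insert by auto
  qed
qed

lemma openin_linked: "openin (mtopology_of Lip1) (linked m m' S')"
proof (rule openin_Lip1I)
  fix f assume "f \<in> linked m m' S'"
  then obtain \<eta> where \<eta>: "\<eta> > 0" "\<And>s p t. s \<in> S' \<Longrightarrow> p \<in> rect m' s \<Longrightarrow> len m' / 2 \<le> t \<Longrightarrow> t \<le> len m / 2 \<Longrightarrow>
     p + t *\<^sub>R u \<in> unit_square \<and> p - t *\<^sub>R u \<in> unit_square \<and>
     2 * t * (1 - 3 * mu m) + \<eta> \<le> f (p + t *\<^sub>R u) - f (p - t *\<^sub>R u)" by (auto simp: linked_def)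
  have "g \<in> linked m m' S'" if g: "g \<in> mspace Lip1" "\<forall>x\<in>unit_square. \<bar>g x - f x\<bar> < \<eta> / 4" for g
    unfolding linked_def mem_Collect_eq
  proof (intro conjI exI[of _ "\<eta> / 2"] ballI allI impI)
    fix s p t assume *: "s \<in> S'" "p \<in> rect m' s" "len m' / 2 \<le> t \<and> t \<le> len m / 2"
    note a = \<eta>(2)[OF *(1,2), of t]
    show "p + t *\<^sub>R u \<in> unit_square" "p - t *\<^sub>R u \<in> unit_square" using a * by auto
    then have "\<bar>g (p + t *\<^sub>R u) - f (p + t *\<^sub>R u)\<bar> < \<eta> / 4" "\<bar>g (p - t *\<^sub>R u) - f (p - t *\<^sub>R u)\<bar> < \<eta> / 4"
      using g(2) by blast+
    then show "2 * t * (1 - 3 * mu m) + \<eta> / 2 \<le> g (p + t *\<^sub>R u) - g (p - t *\<^sub>R u)" using a * by argo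
  qed (use g \<eta> in auto)
  then show "\<exists>r>0. \<forall>g\<in>mspace Lip1. (\<forall>x\<in>unit_square. \<bar>g x - f x\<bar> < r) \<longrightarrow> g \<in> linked m m' S'"
    using \<eta>(1) by (intro exI[of _ "\<eta> / 4"]) auto
qed (auto simp: linked_def)

lemma child_bounds:
  assumes c: "child f N m w s m' s' k" and N: "0 < N" and w: "w \<le> len m" and p: "p \<in> rect m' s'"
  shows "\<bar>p \<bullet> v - xc m s\<bar> \<le> w" "grid N m s k + mu m * mesh m N \<le> p \<bullet> u"
    "p \<bullet> u \<le> grid N m s k + (1 - 2 * mu m) * mesh m N"
    "yc m s < p \<bullet> u" "p \<bullet> u < yc m s + len m"
proof -
  define h where "h = mesh m N"
  have h: "0 < h" "real N * h = len m" using N by (auto simp: h_def)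
  have c': "N \<le> k" "k < 2 * N" "\<bar>xc m' s' - xc m s\<bar> + len m' \<le> w"
     "grid N m s k + mu m * h \<le> yc m' s'"
     "yc m' s' + len m' \<le> grid N m s k + (1 - 2 * mu m) * h"
    using c unfolding child_def h_def[symmetric] by blast+
  have p': "\<bar>p \<bullet> v - xc m' s'\<bar> \<le> len m'" "yc m' s' \<le> p \<bullet> u"
    "p \<bullet> u \<le> yc m' s' + len m'"
    using p unfolding rect_def by blast+
  show "\<bar>p \<bullet> v - xc m s\<bar> \<le> w" using c'(3) p'(1) by linarith
  show 1: "grid N m s k + mu m * mesh m N \<le> p \<bullet> u" using c'(4) p'(2) unfolding h_def by linarith
  show 2: "p \<bullet> u \<le> grid N m s k + (1 - 2 * mu m) * mesh m N"
    using order_trans[OF p'(3) c'(5)] unfolding h_def .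
  have g: "grid N m s k = yc m s - len m + real k * h" by (simp add: grid_def h_def)
  have mh: "0 < mu m * h" using h by simp
  have kl: "len m \<le> real k * h" unfolding h(2)[symmetric] using c'(1) h by (intro mult_right_mono) auto
  have "(real k + 1) * h \<le> (2 * real N) * h" using c'(2) h by (intro mult_right_mono) auto
  then have kr: "real k * h + h \<le> 2 * len m" using h(2) by (simp add: distrib_right mult.assoc)
  have 1: "grid N m s k + mu m * h \<le> p \<bullet> u" using 1 by (simp add: h_def)
  have 2: "p \<bullet> u \<le> grid N m s k + h - 2 * (mu m * h)" using 2 unfolding h_def[symmetric] by (simp add: algebra_simps)
  show "yc m s < p \<bullet> u" using 1 mh kl g by linarith
  show "p \<bullet> u < yc m s + len m" using 2 mh kr g by linarith
qed

lemma corner_in_rect: "pt (xc m s) (yc m s) \<in> rect m s"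
  "pt (xc m s) (yc m s + len m) \<in> rect m s"
  by (auto simp: rect_def less_imp_le)

lemma child_rect_subset:
  assumes "child f N m w s m' s' k" "0 < N" "w \<le> len m"
  shows "rect m' s' \<subseteq> rect m s"
proof
  fix p assume "p \<in> rect m' s'"
  note b = child_bounds[OF assms this]
  show "p \<in> rect m s" using b(1,4,5) assms(3) by (simp add: rect_def)
qed

lemma child_idx:
  assumes c: "child f N m w s m' s' k" and N: "0 < N" and w: "w \<le> len m" and s: "s \<in> idx m" and m': "len m' \<le> len m"
  shows "s' \<in> idx m'"
proof -
  have "yc m s < yc m' s'"
    "yc m' s' + len m' < yc m s + len m"
    using child_bounds(4)[OF c N w corner_in_rect(1)] child_bounds(5)[OF c N w corner_in_rect(2)] by simp_all
  moreover have "\<bar>xc m' s' - xc m s\<bar> + len m' \<le> len m" using c w unfolding child_def by linarith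
  moreover have "0 < xc m s - len m \<and> xc m s + len m < 1 \<and> 0 < yc m s - len m \<and>
      yc m s + 2 * len m < 1" using s unfolding idx_def by auto
  ultimately have "0 < xc m' s' - len m' \<and> xc m' s' + len m' < 1 \<and>
      0 < yc m' s' - len m' \<and> yc m' s' + 2 * len m' < 1" using m' by argo
  then show ?thesis unfolding idx_def by (simp add: case_prod_beta)
qed

text \<open>Shrinking by the factor \<open>1 - \<kappa>\<close> produces the slack that
  \<open>zigzag_extension\<close> spends between different segments.\<close>

lemma scale_down:
  assumes f: "f \<in> mspace Lip1" and r: "0 < r"
  obtains f0 \<kappa> where "0 < \<kappa>" "\<kappa> \<le> 1" "f0 \<in> mspace Lip1" "(1 - \<kappa>)-lipschitz_on unit_square f0"
    "\<And>x. x \<in> unit_square \<Longrightarrow> \<bar>f0 x - f x\<bar> \<le> r"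
proof -
  have lf: "1-lipschitz_on unit_square f" using f by (simp add: mspace_Lip1_iff)
  have "bounded (f ` unit_square)"
    by (intro compact_imp_bounded compact_continuous_image compact_unit_square lipschitz_on_continuous_on[OF lf])
  then obtain B where B: "B > 0" "\<And>x. x \<in> unit_square \<Longrightarrow> \<bar>f x\<bar> \<le> B"
    unfolding bounded_pos by auto
  define \<kappa> where "\<kappa> = min 1 (r / B)"
  have \<kappa>: "0 < \<kappa>" "\<kappa> \<le> 1" "\<kappa> * B \<le> r" using r B(1) by (auto simp: \<kappa>_def min_def field_simps)
  define f0 where "f0 = restrict (\<lambda>x. (1 - \<kappa>) * f x) unit_square"
  have lip: "(1 - \<kappa>)-lipschitz_on unit_square f0"
  proof (rule lipschitz_onI)
    fix x y assume xy: "x \<in> unit_square" "y \<in> unit_square"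
    have "\<bar>(1 - \<kappa>) * f x - (1 - \<kappa>) * f y\<bar> = (1 - \<kappa>) * \<bar>f x - f y\<bar>"
      using \<kappa> by (simp add: right_diff_distrib[symmetric] abs_mult)
    also have "\<dots> \<le> (1 - \<kappa>) * dist x y" using \<kappa> lipD[OF lf xy] by (intro mult_left_mono) auto
    finally show "dist (f0 x) (f0 y) \<le> (1 - \<kappa>) * dist x y" using xy by (simp add: f0_def dist_real_def)
  qed (use \<kappa> in simp)
  show ?thesis
  proof (rule that[OF \<kappa>(1,2) _ lip])
    show "f0 \<in> mspace Lip1" unfolding mspace_Lip1_iff
      using lipschitz_on_mono[OF lip, of unit_square 1] \<kappa> by (auto simp: f0_def)
    show "\<bar>f0 x - f x\<bar> \<le> r" if "x \<in> unit_square" for x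
    proof -
      have "\<bar>f0 x - f x\<bar> = \<kappa> * \<bar>f x\<bar>" using that \<kappa> by (simp add: f0_def left_diff_distrib abs_mult)
      also have "\<dots> \<le> \<kappa> * B" using B(2)[OF that] \<kappa> by (intro mult_left_mono) auto
      finally show ?thesis using \<kappa>(3) by simp
    qed
  qed
qed

text \<open>The order of the choices matters: the contraction is slight enough to preserve
  steepness, mesh and width are then small against the slack \<open>\<kappa> * gap m\<close>, and
  only afterwards is \<open>m'\<close> taken, fine against mesh and width. All children are kept, of
  whatever kind, so that every direction is served.\<close>

lemma refinement_dense:
  assumes f: "f \<in> steep m S" and S: "S \<subseteq> idx m" and r: "0 < r"
  obtains g m' S' where "g \<in> mspace Lip1" "\<forall>x\<in>unit_square. \<bar>g x - f x\<bar> \<le> r"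
    "refines m S m' S'" "g \<in> steep m' S'" "g \<in> linked m m' S'"
proof -
  have fL: "f \<in> mspace Lip1" using f by (simp add: steep_def)
  obtain r' where r': "r' > 0" "\<And>g. g \<in> mspace Lip1 \<Longrightarrow> (\<And>x. x \<in> unit_square \<Longrightarrow> \<bar>g x - f x\<bar> \<le> r') \<Longrightarrow> g \<in> steep m S"
    using openin_Lip1D[OF openin_steep[OF S] f] by blast
  obtain f0 \<kappa> where \<kappa>: "0 < \<kappa>" "\<kappa> \<le> 1" and f0: "f0 \<in> mspace Lip1" "(1 - \<kappa>)-lipschitz_on unit_square f0"
    "\<And>x. x \<in> unit_square \<Longrightarrow> \<bar>f0 x - f x\<bar> \<le> min r' (r / 2)"
    by (rule scale_down[OF fL, of "min r' (r/2)"]) (use r r'(1) in auto)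
  have f0s: "f0 \<in> steep m S" using r'(2)[OF f0(1)] f0(3) by fastforce
  have f01: "1-lipschitz_on unit_square f0" using f0(1) by (simp add: mspace_Lip1_iff)
  define \<delta> where "\<delta> = min (r / 2) (\<kappa> * gap m / 4)"
  have \<delta>: "0 < \<delta>" using r \<kappa> by (simp add: \<delta>_def)
  obtain N0 :: nat where N0: "4 * len m / \<delta> < real N0" using reals_Archimedean2 by blast
  define N where "N = max 4 N0"
  have N: "4 \<le> N" "0 < N" "4 * len m / \<delta> < real N" using N0 by (auto simp: N_def)
  define h where "h = mesh m N"
  have h: "0 < h" "real N * h = len m" using N by (auto simp: h_def)
  have "4 * h \<le> \<delta>" using N(3) \<delta> N(2) by (simp add: h_def field_simps)
  \<comment> \<open>The admissible perturbation \<open>\<delta>\<close> is shared equally between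
    the width and \<open>2 * h\<close>.\<close>
  define w where "w = min (len m) (\<delta> / 2)"
  have w: "0 < w" "w \<le> len m" "w + 2 * h \<le> \<delta>" using \<delta> \<open>4 * h \<le> \<delta>\<close> by (auto simp: w_def)
  obtain g0 where g0: "1-lipschitz_on unit_square g0" "zigzag_on f0 N m w S g0"
    "\<And>p. p \<in> unit_square \<Longrightarrow> \<bar>g0 p - f0 p\<bar> \<le> w + 2 * h"
    using zigzag_extension[OF f0(2) \<kappa> S N(2) w(1,2)] w(3) unfolding h_def \<delta>_def by auto
  define g where "g = restrict g0 unit_square"
  have gg: "g p = g0 p" if "p \<in> unit_square" for p using that by (simp add: g_def)
  have g1: "1-lipschitz_on unit_square g" using g0(1) gg by (simp add: lipschitz_on_def)
  have gL: "g \<in> mspace Lip1" using g1 by (simp add: mspace_Lip1_iff g_def)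
  have z: "zigzag_on f0 N m w S g"
    unfolding zigzag_on_def
  proof (intro ballI allI impI)
    fix s k p assume *: "s \<in> S" "k < 3 * N" "p \<in> cell f0 N m w s k"
    have s: "s \<in> idx m" using S * by auto
    note c = cell_subset[OF f01 s N(2) *(2,3)]
    have "p \<in> unit_square" using ext_in_unit_square[OF s _ c(4,5)] c(1) w interior_subset by fastforce
    then show "g p = sample f0 N m s k + (p \<bullet> u - grid N m s k)" using g0(2) * gg by (auto simp: zigzag_on_def)
  qed
  have "\<forall>\<^sub>F m' in sequentially. m < m' \<and> 1 / real (lev m') < min (w / 5) (mu m * len m / (12 * real N))"
    using w N by (intro eventually_conj eventually_gt_at_top eventually_lev_small) auto
  then obtain m' where m': "m < m'" "1 / real (lev m') < min (w / 5) (mu m * len m / (12 * real N))"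
    using eventually_happens by fastforce
  have e: "5 / real (lev m') \<le> w" "12 * real N / real (lev m') \<le> mu m * len m"
  proof -
    have "1 / real (lev m') < w / 5" "1 / real (lev m') < mu m * len m / (12 * real N)" using m'(2) by auto
    then have "5 * (1 / real (lev m')) \<le> w" "(12 * real N) * (1 / real (lev m')) \<le> mu m * len m"
      using N(2) by (simp, simp only: pos_less_divide_eq[of "12 * real N"] mult.commute less_imp_le, simp add: mult.commute less_imp_le pos_less_divide_eq)
    then show "5 / real (lev m') \<le> w" "12 * real N / real (lev m') \<le> mu m * len m" by simp_all
  qed
  have l': "len m' \<le> mu m * h" "len m' \<le> len m"
  proof -
    have "12 * real N * len m' \<le> 12 * real N * (1 / real (lev m'))"
      by (intro mult_left_mono len_le_inverse_lev) auto
    also have "\<dots> \<le> mu m * (real N * h)" using e(2) h(2) by simp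
    finally have "real N * (12 * len m') \<le> real N * (mu m * h)" by (simp add: mult_ac)
    then have "12 * len m' \<le> mu m * h" using N(2) by simp
    then show a: "len m' \<le> mu m * h" using len_pos[of m'] by linarith
    have "len m' \<le> 1 / real (lev m')" by (rule len_le_inverse_lev)
    also have "\<dots> \<le> 5 / real (lev m')" by (intro divide_right_mono) auto
    also have "\<dots> \<le> w" by (rule e(1))
    finally show "len m' \<le> len m" using w(2) by simp
  qed
  define S' where "S' = {s'. \<exists>s\<in>S. \<exists>k. child f0 N m w s m' s' k}"
  have S': "S' \<subseteq> idx m'" using child_idx[OF _ N(2) w(2) _ l'(2)] S by (auto simp: S'_def)
  show ?thesis
  proof (rule that[OF gL])
    show "\<forall>x\<in>unit_square. \<bar>g x - f x\<bar> \<le> r"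
    proof
      fix x assume that: "x \<in> unit_square"
      have "\<bar>g x - f0 x\<bar> \<le> r / 2" using g0(3)[OF that] gg[OF that] w(3) by (simp add: \<delta>_def)
      moreover have "\<bar>f0 x - f x\<bar> \<le> r / 2" using f0(3)[OF that] by simp
      ultimately show "\<bar>g x - f x\<bar> \<le> r" by linarith
    qed
    show "refines m S m' S'"
      unfolding refines_def
    proof (intro conjI m'(1) S' ballI)
      fix s l assume s: "s \<in> S" and l: "l \<in> {-1..1::real}"
      have si: "s \<in> idx m" using s S by auto
      have hv: "real (card (heavy_cells f0 N m s)) * mesh m N
        \<le> 12 * len m * (mu m)\<^sup>2"
        using f0s s by (intro heavy_defect_le[OF f01 si N(2)]) (auto simp: steep_def)
      have "children f0 N m w s m' l \<subseteq>
          heirs m s m' S' l"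
        using child_rect_subset[OF _ N(2) w(2)] s unfolding S'_def by blast
      then have sub: "shadow l m s - (\<Union>s'\<in>heirs m s m' S' l. shadow l m' s')
          \<subseteq> shadow l m s - (\<Union>s'\<in>children f0 N m w s m' l. shadow l m' s')"
        by blast
      have fin: "finite (children f0 N m w s m' l)"
        using S' s by (intro finite_subset[OF _ finite_idx[of m']]) (auto simp: S'_def)
      have "emeasure lborel (shadow l m s - (\<Union>s'\<in>heirs m s m' S' l. shadow l m' s'))
        \<le> emeasure lborel (shadow l m s - (\<Union>s'\<in>children f0 N m w s m' l. shadow l m' s'))"
        using fin by (intro emeasure_mono[OF sub] sets.Diff sets.finite_UN) (auto simp: shadow_def)
      also have "\<dots> \<le> ennreal (10 * mu m * len m)"
        using l by (intro shadow_covered[OF N(2) si _ _ hv e]) auto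
      finally show "emeasure lborel (shadow l m s - (\<Union>s'\<in>heirs m s m' S' l. shadow l m' s'))
        \<le> ennreal (10 * mu m * len m)" .
    qed
    show "g \<in> steep m' S'"
      unfolding steep_def mem_Collect_eq
    proof (intro conjI gL ballI)
      fix s' assume "s' \<in> S'"
      then obtain s k where sk: "s \<in> S" "child f0 N m w s m' s' k" by (auto simp: S'_def)
      have k: "k < 3 * N" "\<not> heavy (3 * N) (defect f0 N m s) ((mu m)\<^sup>2 * h) k" using sk(2) by (auto simp: child_def h_def)
      define x y where "x = xc m' s'" and "y = yc m' s'"
      have c: "\<bar>x - xc m s\<bar> \<le> w" "grid N m s k + mu m * h \<le> y" "y + len m' \<le> grid N m s k + (1 - 2 * mu m) * h"
        using sk(2) len_pos[of m'] unfolding child_def x_def y_def h_def by linarith+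
      have "(mu m)\<^sup>2 * h \<le> mu m * h" using mu_sq_le h by (intro mult_right_mono) auto
      then have d: "defect f0 N m s k \<le> mu m * h" using defect_le_not_heavy[OF k(2,1)] by simp
      have c3: "y + len m' \<le> grid N m s k + h - 2 * (mu m * h)" using c(3) by (simp add: algebra_simps)
      have mh: "0 < mu m * h" using h by simp
      have yb: "grid N m s k \<le> y + 2 * len m'" "y + 2 * len m' \<le> grid N m s k + h - defect f0 N m s k / 2"
        "grid N m s k \<le> y - len m'" "y - len m' \<le> grid N m s k + h - defect f0 N m s k / 2"
        using c(2) c3 d mh l'(1) len_pos[of m'] by linarith+
      have "g (pt x (y + 2 * len m')) = sample f0 N m s k + (y + 2 * len m' - grid N m s k)"
        using yb unfolding h_def by (intro zigzag_exact[OF z sk(1) k(1) c(1)])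
      moreover have "g (pt x (y - len m')) = sample f0 N m s k + (y - len m' - grid N m s k)"
        using yb unfolding h_def by (intro zigzag_exact[OF z sk(1) k(1) c(1)])
      \<comment> \<open>The tripled segment lies in a single cell, so the increase is the largest
        possible one and the strict condition at level \<open>m'\<close> holds for any positive
        \<open>mu m'\<close>.\<close>
      ultimately have "g (pt x (y + 2 * len m')) - g (pt x (y - len m')) = 3 * len m'" by simp
      moreover have "3 * len m' * (1 - mu m' ^ 4) < 3 * len m' * 1"
        using zero_less_power[OF mu_pos[of m'], of 4] len_pos[of m'] by (intro mult_strict_left_mono) linarith+
      ultimately show "3 * len m' * (1 - mu m' ^ 4) < g (pt (xc m' s') (yc m' s' + 2 * len m')) -
          g (pt (xc m' s') (yc m' s' - len m'))" unfolding x_def y_def by linarith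
    qed
    show "g \<in> linked m m' S'"
      unfolding linked_def mem_Collect_eq
    \<comment> \<open>\<open>zigzag_slope\<close> loses \<open>2 * mu m\<close> and
      \<open>linked\<close> permits \<open>3 * mu m\<close>; as \<open>2 * t\<close> is at least
      \<open>len m'\<close>, the difference leaves room for this slack.\<close>
    proof (intro conjI gL exI[of _ "mu m * len m'"] ballI allI impI)
      fix s' p t assume "s' \<in> S'" and p: "p \<in> rect m' s'" and t: "len m' / 2 \<le> t \<and> t \<le> len m / 2"
      then obtain s k where sk: "s \<in> S" "child f0 N m w s m' s' k" by (auto simp: S'_def)
      have t': "0 < t" "t \<le> len m / 2" using t len_pos[of m'] by linarith+
      note b = child_bounds[OF sk(2) N(2) w(2) p]
      have k: "N \<le> k" "k < 2 * N" "\<not> heavy (3 * N) (defect f0 N m s) ((mu m)\<^sup>2 * mesh m N) k"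
        using sk(2) by (auto simp: child_def)
      have pp: "p + t *\<^sub>R u = pt (p \<bullet> v) (p \<bullet> u + t)" "p - t *\<^sub>R u = pt (p \<bullet> v) (p \<bullet> u - t)"
        using pt_inverse[of p] by (simp_all add: pt_def scaleR_add_left scaleR_diff_left)
      have si: "s \<in> idx m" using sk S by auto
      have "pt (p \<bullet> v) y \<in> unit_square" if "\<bar>y - p \<bullet> u\<bar> \<le> t" for y
      proof (rule subsetD[OF interior_subset], rule ext_in_unit_square[OF si])
        show "\<bar>pt (p \<bullet> v) y \<bullet> v - xc m s\<bar> \<le> len m" using b(1) w(2) unfolding pt_inner by linarith
        show "yc m s - len m \<le> pt (p \<bullet> v) y \<bullet> u" "pt (p \<bullet> v) y \<bullet> u \<le> yc m s + 2 * len m"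
          using b(4,5) that t' len_pos[of m] unfolding pt_inner by linarith+
      qed
      then show "p + t *\<^sub>R u \<in> unit_square" "p - t *\<^sub>R u \<in> unit_square"
        unfolding pp using t' by simp_all
      have "2 * t * (1 - 2 * mu m) \<le> g (p + t *\<^sub>R u) - g (p - t *\<^sub>R u)"
        unfolding pp by (rule zigzag_slope[OF f01 g1 z sk(1) S N(1) w(2) k b(1,2,3) t'])
      moreover have "mu m * len m' \<le> mu m * (2 * t)" using t by (intro mult_left_mono) (auto simp: less_imp_le)
      moreover have "2 * t * (1 - 3 * mu m) + mu m * (2 * t) = 2 * t * (1 - 2 * mu m)" by (simp add: algebra_simps)
      ultimately show "2 * t * (1 - 3 * mu m) + mu m * len m' \<le> g (p + t *\<^sub>R u) - g (p - t *\<^sub>R u)"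
        by linarith
    qed simp
  qed
qed

end

section \<open>Limits of refinements\<close>

lemma len_le_power:
  assumes m: "strict_mono (m :: nat \<Rightarrow> nat)"
  shows "len (m n) \<le> len (m 0) * (1 / 32) ^ n"
proof -
  have dec: "len b \<le> len a" if "a \<le> b" for a b
  proof (rule lift_Suc_antimono_le[OF _ that])
    show "len (Suc n) \<le> len n" for n using len_pos[of n] unfolding len_Suc by linarith
  qed
  show ?thesis
  proof (induction n)
    case (Suc n)
    have "len (m (Suc n)) \<le> len (Suc (m n))" using strict_monoD[OF m, of n "Suc n"] by (intro dec) auto
    also have "\<dots> = len (m n) / 32" by (rule len_Suc)
    also have "\<dots> \<le> len (m 0) * (1 / 32) ^ Suc n" using Suc by simp
    finally show ?case .
  qed simp
qed

lemma len_tendsto_0: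
  assumes m: "strict_mono (m :: nat \<Rightarrow> nat)"
  shows "(\<lambda>n. len (m n)) \<longlonglongrightarrow> 0"
proof (rule tendsto_sandwich[of "\<lambda>_. 0"])
  show "\<forall>\<^sub>F n in sequentially. len (m n) \<le> len (m 0) * (1 / 32) ^ n" using len_le_power[OF m] by simp
  have "(\<lambda>n. len (m 0) * (1 / 32) ^ n) \<longlonglongrightarrow> len (m 0) * (0::real)"
    by (intro tendsto_mult_left LIMSEQ_power_zero) auto
  then show "(\<lambda>n. len (m 0) * (1 / 32) ^ n) \<longlonglongrightarrow> 0" by simp
qed (auto simp: less_imp_le)

context frame
begin

definition proj :: "real \<Rightarrow> real^2 \<Rightarrow> real" where "proj l p = p \<bullet> u + l * (p \<bullet> v)"

lemma continuous_proj: "continuous_on A (proj l)"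
  unfolding proj_def by (intro continuous_intros)

lemma dist_proj: "\<bar>l\<bar> \<le> 1 \<Longrightarrow> dist (proj l p) (proj l q) \<le> 2 * dist p q"
proof -
  assume l: "\<bar>l\<bar> \<le> 1"
  have "\<bar>l * (p \<bullet> v - q \<bullet> v)\<bar> \<le> 1 * dist p q"
    unfolding abs_mult using l frame_le_dist(1)[of p q] by (intro mult_mono) auto
  then show ?thesis
    using frame_le_dist(2)[of p q] by (simp add: proj_def dist_real_def right_diff_distrib)
qed

lemma shadow_subset_proj_rect: "shadow l m s \<subseteq> proj l ` rect m s"
proof
  fix z assume z: "z \<in> shadow l m s"
  have "pt (xc m s) (z - l * xc m s) \<in> rect m s"
    using z by (auto simp: rect_def shadow_def less_imp_le)
  moreover have "z = proj l (pt (xc m s) (z - l * xc m s))" by (simp add: proj_def)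
  ultimately show "z \<in> proj l ` rect m s" by blast
qed

context
  fixes f :: "real^2 \<Rightarrow> real" and m :: "nat \<Rightarrow> nat" and S :: "nat \<Rightarrow> (nat \<times> int) set" and s0 :: "nat \<times> int"
  assumes S0: "S 0 = {s0}" and S_idx: "\<And>n. S n \<subseteq> idx (m n)"
    and ref: "\<And>n. refines (m n) (S n) (m (Suc n)) (S (Suc n))" and link: "\<And>n. f \<in> linked (m n) (m (Suc n)) (S (Suc n))"
begin

text \<open>The selection for one direction: after the initial segment only the kind belonging to
  \<open>l\<close> is kept at each level, and every rectangle lies in one of the previous stage. The
  first property separates different directions, the second makes the stages decrease.\<close>

primrec branch :: "real \<Rightarrow> nat \<Rightarrow> (nat \<times> int) set" where
  "branch l 0 = {s0}"
| "branch l (Suc n) = {s' \<in> S (Suc n). kind (m (Suc n)) (fst s') = sector (m (Suc n)) l \<and>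
     (\<exists>s\<in>branch l n. rect (m (Suc n)) s' \<subseteq> rect (m n) s)}"

definition stage :: "real \<Rightarrow> nat \<Rightarrow> (real^2) set" where "stage l n = (\<Union>s\<in>branch l n. rect (m n) s)"
definition limit_set :: "real \<Rightarrow> (real^2) set" where "limit_set l = (\<Inter>n. stage l n)"

lemma strict_mono_m: "strict_mono m"
  using ref unfolding refines_def by (auto intro: strict_monoI_Suc)

lemma m_ge: "n \<le> m n"
  by (rule seq_suble[OF strict_mono_m])

lemma branch_subset: "branch l n \<subseteq> S n"
  by (cases n) (auto simp: S0)

lemma finite_branch: "finite (branch l n)"
  using branch_subset[of l n] S_idx[of n] finite_idx[of "m n"] by (meson finite_subset)

lemma compact_stage: "compact (stage l n)"
  unfolding stage_def by (intro compact_UN finite_branch compact_rect)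

lemma decseq_stage: "decseq (stage l)"
  by (intro decseq_SucI) (fastforce simp: stage_def)

lemma compact_limit_set: "compact (limit_set l)"
  unfolding limit_set_def using compact_Inter[of "range (stage l)"] compact_stage by auto

text \<open>At most \<open>card (idx (m n))\<close> segments lose
  \<open>10 * mu (m n) * len (m n)\<close> each, in total at most \<open>len (m n) / 80\<close> by
  the choice of \<open>mu\<close>. As lengths shrink by a factor of at least 32 per stage, all
  losses together stay below half of \<open>len (m 0)\<close>; the term
  \<open>(1 / 2) ^ Suc n\<close> is the reserve for losses still to come.\<close>

lemma measure_shadows_ge:
  assumes l: "l \<in> {-1..1}"
  shows "len (m 0) * (1 / 2 + (1 / 2) ^ Suc n) \<le> measure lborel (\<Union>s\<in>branch l n. shadow l (m n) s)"
proof (induction n)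
  case 0
  show ?case by (simp add: shadow_def)
next
  case (Suc n)
  define C where "C n = (\<Union>s\<in>branch l n. shadow l (m n) s)" for n
  have C: "compact (C n)" for n unfolding C_def by (intro compact_UN finite_branch) (auto simp: shadow_def)
  have lost: "emeasure lborel (C n - C (Suc n)) \<le> ennreal (len (m n) / 80)"
  proof -
    define D where "D s = shadow l (m n) s - (\<Union>s'\<in>{s'\<in>S (Suc n). kind (m (Suc n)) (fst s') = sector (m (Suc n)) l \<and>
        rect (m (Suc n)) s' \<subseteq> rect (m n) s}. shadow l (m (Suc n)) s')" for s
    have Dm: "D s \<in> sets lborel" for s
      unfolding D_def using finite_subset[OF S_idx finite_idx]
      by (intro sets.Diff sets.finite_UN) (auto simp: shadow_def)
    have D: "emeasure lborel (D s) \<le> ennreal (10 * mu (m n) * len (m n))" if "s \<in> branch l n" for s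
      using ref[of n] branch_subset[of l n] that l unfolding refines_def D_def by blast
    have "C n - C (Suc n) \<subseteq> (\<Union>s\<in>branch l n. D s)"
    proof
      fix z assume z: "z \<in> C n - C (Suc n)"
      then obtain s where s: "s \<in> branch l n" "z \<in> shadow l (m n) s" by (auto simp: C_def)
      have "z \<notin> shadow l (m (Suc n)) s'" if "s' \<in> S (Suc n)" "kind (m (Suc n)) (fst s') = sector (m (Suc n)) l"
        "rect (m (Suc n)) s' \<subseteq> rect (m n) s" for s'
      proof -
        have "s' \<in> branch l (Suc n)" unfolding branch.simps using that s(1) by blast
        then show ?thesis using z unfolding C_def by blast
      qed
      then have "z \<in> D s" using s(2) unfolding D_def by blast
      then show "z \<in> (\<Union>s\<in>branch l n. D s)" using s(1) by blast
    qed
    then have "emeasure lborel (C n - C (Suc n)) \<le> emeasure lborel (\<Union>s\<in>branch l n. D s)"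
      using Dm finite_branch by (intro emeasure_mono sets.finite_UN) auto
    also have "\<dots> \<le> (\<Sum>s\<in>branch l n. emeasure lborel (D s))"
      using Dm finite_branch by (intro emeasure_subadditive_finite) auto
    also have "\<dots> \<le> (\<Sum>s\<in>branch l n. ennreal (10 * mu (m n) * len (m n)))" by (intro sum_mono D)
    also have "\<dots> = ennreal (real (card (branch l n)) * (10 * mu (m n) * len (m n)))"
      by (simp add: ennreal_of_nat_eq_real_of_nat ennreal_mult[symmetric] less_imp_le)
    also have "\<dots> \<le> ennreal (len (m n) / 80)"
    proof (rule ennreal_leI)
      have "card (branch l n) \<le> card (idx (m n))"
        using branch_subset[of l n] S_idx[of n] finite_idx[of "m n"] by (meson card_mono order_trans)
      then have "real (card (branch l n)) * mu (m n) \<le> real (card (idx (m n))) * mu (m n)"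
        by (intro mult_right_mono) (auto simp: less_imp_le)
      also have "\<dots> \<le> 1 / 800" by (rule card_mu_le)
      finally have "(real (card (branch l n)) * mu (m n)) * (10 * len (m n)) \<le> 1 / 800 * (10 * len (m n))"
        by (intro mult_right_mono) (auto simp: less_imp_le)
      then show "real (card (branch l n)) * (10 * mu (m n) * len (m n)) \<le> len (m n) / 80" by (simp add: mult_ac)
    qed
    finally show ?thesis .
  qed
  have Cs: "C k \<in> sets lborel" for k using borel_compact[OF C[of k]] by simp
  have fm: "C k \<in> fmeasurable lborel" for k
    using Cs emeasure_compact_finite[OF C[of k]] by (intro fmeasurableI) auto
  have "measure lborel (C n - C (Suc n)) \<le> len (m n) / 80"
    unfolding measure_def using lost by (intro enn2real_leI) (auto simp: less_imp_le)
  moreover have "measure lborel (C n) \<le> measure lborel (C (Suc n)) + measure lborel (C n - C (Suc n))"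
  proof -
    have "measure lborel (C n) \<le> measure lborel (C (Suc n) \<union> (C n - C (Suc n)))"
      by (rule measure_mono_fmeasurable[OF _ Cs fmeasurable.Un[OF fm fmeasurable.Diff[OF fm fm]]]) blast
    also have "\<dots> \<le> measure lborel (C (Suc n)) + measure lborel (C n - C (Suc n))"
      by (rule measure_Un_le[OF Cs sets.Diff[OF Cs Cs]])
    finally show ?thesis .
  qed
  moreover have "len (m n) / 80 \<le> len (m 0) * (1 / 2) ^ Suc (Suc n)"
  proof -
    have "(1 / 32 :: real) ^ n \<le> (1 / 2) ^ n" by (intro power_mono) auto
    then have "len (m 0) * (1 / 32) ^ n \<le> len (m 0) * (1 / 2) ^ n" by (intro mult_left_mono) (auto simp: less_imp_le)
    then have "len (m n) \<le> len (m 0) * (1 / 2) ^ n" using len_le_power[OF strict_mono_m, of n] by linarith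
    moreover have "0 \<le> len (m 0) * (1 / 2) ^ n" by (simp add: less_imp_le)
    ultimately have "len (m n) / 80 \<le> len (m 0) * (1 / 2) ^ n / 4" by linarith
    then show ?thesis by simp
  qed
  moreover have "len (m 0) * (1 / 2 + (1 / 2) ^ Suc n) \<le> measure lborel (C n)" using Suc by (simp add: C_def)
  moreover have "len (m 0) * (1 / 2 + (1 / 2) ^ Suc n) = len (m 0) * (1 / 2 + (1 / 2) ^ Suc (Suc n)) + len (m 0) * (1 / 2) ^ Suc (Suc n)"
    by (simp add: field_simps)
  ultimately show ?case unfolding C_def[symmetric] by linarith
qed

text \<open>Projection commutes with the decreasing intersection of the compact stages, measure is
  continuous from above, and each stage projects onto a set containing its shadows.\<close>

lemma emeasure_proj_limit_set:
  assumes l: "l \<in> {-1..1}"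
  shows "ennreal (len (m 0) / 2) \<le> emeasure lborel (proj l ` limit_set l)"
proof -
  have comp: "compact (proj l ` stage l n)" for n
    by (intro compact_continuous_image continuous_proj compact_stage)
  have "proj l ` limit_set l = (\<Inter>n. proj l ` stage l n)"
    unfolding limit_set_def by (intro image_INT_decseq_compact continuous_proj compact_stage decseq_stage)
  then have "emeasure lborel (proj l ` limit_set l) = emeasure lborel (\<Inter>n. proj l ` stage l n)" by simp
  also have "\<dots> = (INF n. emeasure lborel (proj l ` stage l n))"
  proof (rule INF_emeasure_decseq[symmetric])
    show "range (\<lambda>n. proj l ` stage l n) \<subseteq> sets lborel" using comp by (auto intro: borel_compact)
    show "decseq (\<lambda>n. proj l ` stage l n)" using decseq_stage[of l] unfolding decseq_def by blast
    show "emeasure lborel (proj l ` stage l n) \<noteq> \<infinity>" for n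
      using emeasure_compact_finite[OF comp[of n]] by (simp add: less_top)
  qed
  also have "ennreal (len (m 0) / 2) \<le> \<dots>"
  proof (rule INF_greatest)
    fix n
    define C where "C = (\<Union>s\<in>branch l n. shadow l (m n) s)"
    have C: "compact C" unfolding C_def by (intro compact_UN finite_branch) (auto simp: shadow_def)
    have "C \<subseteq> proj l ` stage l n" unfolding C_def stage_def image_UN
      by (intro UN_mono shadow_subset_proj_rect order_refl)
    then have le: "emeasure lborel C \<le> emeasure lborel (proj l ` stage l n)"
      using comp by (intro emeasure_mono) (auto intro: borel_compact)
    have "len (m 0) / 2 \<le> len (m 0) * (1 / 2 + (1 / 2) ^ Suc n)"
      by (simp add: distrib_left less_imp_le)
    also have "\<dots> \<le> measure lborel C" unfolding C_def by (rule measure_shadows_ge[OF l])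
    finally have "ennreal (len (m 0) / 2) \<le> ennreal (measure lborel C)" by (rule ennreal_leI)
    also have "\<dots> = emeasure lborel C"
      using emeasure_compact_finite[OF C] by (intro emeasure_eq_ennreal_measure[symmetric]) auto
    finally show "ennreal (len (m 0) / 2) \<le> emeasure lborel (proj l ` stage l n)" using le by (rule order_trans)
  qed
  finally show ?thesis .
qed

lemma limit_set_subset_limit_pattern: "limit_set l \<subseteq> limit_pattern"
proof
  fix x assume x: "x \<in> limit_set l"
  have "x \<in> pattern (m n)" for n
    using x branch_subset[of l n] S_idx[of n] unfolding limit_set_def stage_def pattern_def by blast
  then show "x \<in> limit_pattern" using m_ge unfolding limit_pattern_def by blast
qed

text \<open>At a level where \<open>1 / lev\<close> is below \<open>l' - l\<close> the two
  directions belong to different sectors, so they use different, hence disjoint, rectangles.\<close>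

lemma limit_set_disjoint:
  assumes l: "l \<in> {-1..1}" "l' \<in> {-1..1}" "l < l'"
  shows "limit_set l \<inter> limit_set l' = {}"
proof -
  have "\<forall>\<^sub>F k in sequentially. 1 / real (lev k) < l' - l" using l by (intro eventually_lev_small) auto
  then obtain k0 where "\<And>k. k \<ge> k0 \<Longrightarrow> 1 / real (lev k) < l' - l" by (auto simp: eventually_sequentially)
  then have "1 / real (lev (m (Suc k0))) < l' - l" using m_ge[of "Suc k0"] by simp
  then have ne: "sector (m (Suc k0)) l \<noteq> sector (m (Suc k0)) l'" using l by (intro sector_neq) auto
  show ?thesis
  proof (rule ccontr)
    assume "limit_set l \<inter> limit_set l' \<noteq> {}"
    then obtain x where "x \<in> stage l (Suc k0)" "x \<in> stage l' (Suc k0)" unfolding limit_set_def by blast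
    then obtain s s' where "x \<in> rect (m (Suc k0)) s" "x \<in> rect (m (Suc k0)) s'"
      "kind (m (Suc k0)) (fst s) = sector (m (Suc k0)) l" "kind (m (Suc k0)) (fst s') = sector (m (Suc k0)) l'"
      unfolding stage_def by auto
    moreover then have "s \<noteq> s'" using ne by auto
    ultimately show False using rect_disjoint[of s s' "m (Suc k0)"] by blast
  qed
qed

text \<open>The ranges of \<open>t\<close> in consecutive \<open>linked\<close> conditions abut at
  \<open>len (m (Suc n)) / 2\<close>, so together they cover all small \<open>t\<close>, while the
  permitted loss \<open>3 * mu (m n)\<close> tends to 0. This is the hypothesis of
  \<open>has_derivative_of_maximal_slope\<close>.\<close>

lemma limit_set_subset_Diff: "limit_set l \<subseteq> Diff f"
proof
  fix x assume x: "x \<in> limit_set l"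
  have int: "x \<in> interior unit_square" using x limit_set_subset_limit_pattern limit_pattern_subset by blast
  have lip: "1-lipschitz_on unit_square f" using link[of 0] by (simp add: linked_def mspace_Lip1_iff)
  have slope: "2 * t * (1 - 3 * mu (m n)) \<le> f (x + t *\<^sub>R u) - f (x - t *\<^sub>R u)"
    if "len (m (Suc n)) / 2 \<le> t" "t \<le> len (m n) / 2" for n t
  proof -
    have "x \<in> stage l (Suc n)" using x by (auto simp: limit_set_def)
    then obtain s where "s \<in> S (Suc n)" "x \<in> rect (m (Suc n)) s" unfolding stage_def by auto
    moreover obtain \<eta> where "\<eta> > 0" "\<forall>s\<in>S (Suc n). \<forall>p\<in>rect (m (Suc n)) s. \<forall>t. len (m (Suc n)) / 2 \<le> t \<and> t \<le> len (m n) / 2 \<longrightarrow>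
      p + t *\<^sub>R u \<in> unit_square \<and> p - t *\<^sub>R u \<in> unit_square \<and>
      2 * t * (1 - 3 * mu (m n)) + \<eta> \<le> f (p + t *\<^sub>R u) - f (p - t *\<^sub>R u)"
      using link[of n] unfolding linked_def by blast
    ultimately have "2 * t * (1 - 3 * mu (m n)) + \<eta> \<le> f (x + t *\<^sub>R u) - f (x - t *\<^sub>R u)"
      using that by blast
    then show ?thesis using \<open>\<eta> > 0\<close> by simp
  qed
  have "(f has_derivative (\<lambda>w. w \<bullet> u)) (at x)"
  proof (rule has_derivative_of_maximal_slope[OF lip int])
    fix e :: real assume "0 < e"
    have "\<forall>\<^sub>F k in sequentially. 1 / real (lev k) < e" using \<open>0 < e\<close> by (rule eventually_lev_small)
    then obtain k0 where k0: "\<And>k. k \<ge> k0 \<Longrightarrow> 1 / real (lev k) < e" by (auto simp: eventually_sequentially)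
    have mu_e: "3 * mu (m n) \<le> e" if "n \<ge> k0" for n
    proof -
      have "1 / real (lev (m n)) < e" using that m_ge[of n] by (intro k0) simp
      moreover have "mu (m n) \<le> 1 / (100 * real (lev (m n)))" by (rule mu_le)
      moreover have "1 / (100 * real (lev (m n))) = (1 / 100) * (1 / real (lev (m n)))" by simp
      ultimately show ?thesis using \<open>0 < e\<close> by linarith
    qed
    show "\<exists>r>0. \<forall>t. 0 < t \<and> t \<le> r \<longrightarrow> 2 * t * (1 - e) \<le> f (x + t *\<^sub>R u) - f (x - t *\<^sub>R u)"
    proof (intro exI[of _ "len (m k0) / 2"] conjI allI impI)
      fix t assume t: "0 < t \<and> t \<le> len (m k0) / 2"
      have "\<forall>\<^sub>F n in sequentially. len (m n) < 2 * t"
        using order_tendstoD(2)[OF len_tendsto_0[OF strict_mono_m], of "2 * t"] t by simp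
      then obtain N where N: "\<And>n. n \<ge> N \<Longrightarrow> len (m n) < 2 * t" by (auto simp: eventually_sequentially)
      have ex: "k0 \<le> max N k0 \<and> len (m (Suc (max N k0))) / 2 \<le> t" using N[OF le_SucI[OF max.cobounded1], of k0] by simp
      \<comment> \<open>The first stage from \<open>k0\<close> on whose range of steps reaches down
        to \<open>t\<close>; minimality yields the upper bound \<open>len (m n) / 2\<close> for
        \<open>t\<close>.\<close>
      define n where "n = (LEAST n. k0 \<le> n \<and> len (m (Suc n)) / 2 \<le> t)"
      have n: "k0 \<le> n" "len (m (Suc n)) / 2 \<le> t"
        using LeastI[of "\<lambda>n. k0 \<le> n \<and> len (m (Suc n)) / 2 \<le> t", OF ex] by (auto simp: n_def)
      have "t \<le> len (m n) / 2"
      proof (cases "n = k0")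
        case False
        then obtain n' where n': "n = Suc n'" "k0 \<le> n'" using n(1) by (cases n) auto
        then have "\<not> (k0 \<le> n' \<and> len (m (Suc n')) / 2 \<le> t)"
          using not_less_Least[of n' "\<lambda>n. k0 \<le> n \<and> len (m (Suc n)) / 2 \<le> t"] by (simp add: n_def)
        then show ?thesis using n' by simp
      qed (use t in simp)
      then have "2 * t * (1 - 3 * mu (m n)) \<le> f (x + t *\<^sub>R u) - f (x - t *\<^sub>R u)" using slope n by blast
      moreover have "2 * t * (1 - e) \<le> 2 * t * (1 - 3 * mu (m n))" using t mu_e[OF n(1)] by (intro mult_left_mono) auto
      ultimately show "2 * t * (1 - e) \<le> f (x + t *\<^sub>R u) - f (x - t *\<^sub>R u)" by linarith
    qed simp
  qed simp
  then have "f differentiable (at x within unit_square)"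
    by (meson differentiableI differentiable_at_withinI)
  then show "x \<in> Diff f" using int interior_subset by (auto simp: Diff_def)
qed

end

text \<open>The outcome of the construction for one frame. Compactness of the sets makes their
  projections measurable and provides the positive distances for the Hausdorff measure
  estimate.\<close>

definition rich :: "(real^2 \<Rightarrow> real) \<Rightarrow> bool" where
  "rich f \<longleftrightarrow> (\<exists>A. disjoint_family_on A {-1..1::real} \<and>
     (\<forall>l\<in>{-1..1}. compact (A l) \<and> A l \<subseteq> Diff f \<inter> limit_pattern \<and> 0 < emeasure lborel (proj l ` A l)))"

lemma rich_chain:
  assumes "S 0 = {s0}" "\<And>n. S n \<subseteq> idx (m n)" "\<And>n. refines (m n) (S n) (m (Suc n)) (S (Suc n))"
    "\<And>n. f \<in> linked (m n) (m (Suc n)) (S (Suc n))"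
  shows "rich f"
  unfolding rich_def
proof (intro exI[of _ "limit_set m S s0"] conjI ballI)
  show "disjoint_family_on (limit_set m S s0) {-1..1}"
    unfolding disjoint_family_on_def
  proof (intro ballI impI)
    fix l l' :: real assume "l \<in> {-1..1}" "l' \<in> {-1..1}" "l \<noteq> l'"
    then show "limit_set m S s0 l \<inter> limit_set m S s0 l' = {}"
      using limit_set_disjoint[where m=m and S=S and ?s0.0=s0 and f=f, OF assms, of l l'] limit_set_disjoint[where m=m and S=S and ?s0.0=s0 and f=f, OF assms, of l' l] by (cases "l < l'") auto
  qed
  fix l :: real assume l: "l \<in> {-1..1}"
  show "compact (limit_set m S s0 l)" by (rule compact_limit_set[where m=m and S=S and ?s0.0=s0 and f=f, OF assms])
  show "limit_set m S s0 l \<subseteq> Diff f \<inter> limit_pattern"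
    using limit_set_subset_Diff[where m=m and S=S and ?s0.0=s0 and f=f, OF assms] limit_set_subset_limit_pattern[where m=m and S=S and ?s0.0=s0 and f=f, OF assms] by blast
  show "0 < emeasure lborel (proj l ` limit_set m S s0 l)"
    using emeasure_proj_limit_set[where m=m and S=S and ?s0.0=s0 and f=f, OF assms l] by (rule less_le_trans[rotated]) simp
qed

end

section \<open>The typical function\<close>

lemma residual_in_mono:
  assumes "residual_in X A" "A \<subseteq> B" "B \<subseteq> topspace X"
  shows "residual_in X B"
proof -
  obtain U where U: "\<forall>n::nat. openin X (U n) \<and> X closure_of (U n) = topspace X" "(\<Inter>n. U n) \<subseteq> A"
    using assms(1) unfolding residual_in_def by (elim conjE exE)
  have "(\<Inter>n. U n) \<subseteq> B" using U(2) assms(2) by (rule subset_trans)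
  then show ?thesis unfolding residual_in_def using U(1) assms(3) by (intro conjI exI)
qed

lemma residual_in_Int:
  assumes "residual_in X A" "residual_in X B"
  shows "residual_in X (A \<inter> B)"
proof -
  obtain U V where U: "\<And>n::nat. openin X (U n)" "\<And>n. X closure_of (U n) = topspace X" "(\<Inter>n. U n) \<subseteq> A"
    and V: "\<And>n::nat. openin X (V n)" "\<And>n. X closure_of (V n) = topspace X" "(\<Inter>n. V n) \<subseteq> B"
    using assms unfolding residual_in_def by metis
  define W where "W n = (if even n then U (n div 2) else V (n div 2))" for n
  have "(\<Inter>n. W n) \<subseteq> A \<inter> B"
  proof
    fix x assume x: "x \<in> (\<Inter>n. W n)"
    have "x \<in> U n" "x \<in> V n" for n
      using INT_D[OF x, of "2 * n"] INT_D[OF x, of "2 * n + 1"] by (auto simp: W_def)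
    then show "x \<in> A \<inter> B" using U(3) V(3) by blast
  qed
  moreover have "openin X (W n) \<and> X closure_of (W n) = topspace X" for n by (simp add: W_def U V)
  ultimately show ?thesis using assms unfolding residual_in_def by blast
qed

context frame
begin

lemma idx_large: "\<exists>k. \<forall>m\<ge>k. idx m \<noteq> {}"
proof -
  have "\<forall>\<^sub>F m in sequentially. 1 / real (lev m) < 1 / 40" by (intro eventually_lev_small) auto
  then obtain k where k: "\<And>m. m \<ge> k \<Longrightarrow> 1 / real (lev m) < 1 / 40" by (auto simp: eventually_sequentially)
  have "idx m \<noteq> {}" if "m \<ge> k" for m
  proof -
    obtain i j where ij: "1 / 2 \<le> xpos m i" "xpos m i \<le> 1 / 2 + 4 / real (lev m)"
      "ypos m i j + 0 * xpos m i \<le> 1 / 2" "1 / 2 \<le> ypos m i j + 0 * xpos m i + len m"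
      by (rule strip_covers[of 0 "1 / 2" m "1 / 2"]) auto
    have "4 / real (lev m) = 4 * (1 / real (lev m))" by simp
    then have "4 / real (lev m) < 1 / 10" "len m < 1 / 40"
      using k[OF that] len_le_inverse_lev[of m] by linarith+
    then have "0 < xpos m i - len m \<and> xpos m i + len m < 1 \<and> 0 < ypos m i j - len m \<and> ypos m i j + 2 * len m < 1"
      using ij by (intro conjI) linarith+
    then have "(i, j) \<in> idx m" by (simp add: idx_def)
    then show ?thesis by blast
  qed
  then show ?thesis by blast
qed

text \<open>Prescribing slope 1 along one tripled segment, starting from the value at its lower end,
  changes \<open>f\<close> by at most \<open>6 * len m\<close>: old and new values each vary by at
  most \<open>3 * len m\<close>.\<close>

lemma steep_somewhere_dense:
  assumes f: "f \<in> mspace Lip1" and r: "0 < r"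
  obtains g m s where "g \<in> mspace Lip1" "\<forall>x\<in>unit_square. \<bar>g x - f x\<bar> \<le> r" "s \<in> idx m" "g \<in> steep m {s}"
proof -
  obtain k where k: "\<And>m. m \<ge> k \<Longrightarrow> idx m \<noteq> {}" using idx_large by blast
  have "\<forall>\<^sub>F m in sequentially. k \<le> m \<and> 1 / real (lev m) < r / 6"
    using r by (intro eventually_conj eventually_ge_at_top eventually_lev_small) auto
  then obtain m where m: "k \<le> m" "1 / real (lev m) < r / 6" using eventually_happens by fastforce
  obtain s where s: "s \<in> idx m" using k[OF m(1)] by blast
  define x y where "x = xc m s" and "y = yc m s"
  have lr: "6 * len m \<le> r" using len_le_inverse_lev[of m] m(2) by linarith
  have lf: "1-lipschitz_on unit_square f" using f by (simp add: mspace_Lip1_iff)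
  define I where "I = {y - len m..y + 2 * len m}"
  have len0: "0 \<le> len m" using len_pos[of m] by linarith
  have inI: "pt x t \<in> unit_square" if "t \<in> I" for t
    using ext_in_unit_square[OF s, of "pt x t"] that interior_subset len0 by (auto simp: I_def x_def y_def)
  have ends: "y - len m \<in> I" "y + 2 * len m \<in> I" using len0 by (simp_all add: I_def)
  obtain g0 where g0: "1-lipschitz_on unit_square g0" "\<And>t. t \<in> I \<Longrightarrow> g0 (pt x t) = f (pt x (y - len m)) + (t - (y - len m))"
    "\<And>p. p \<in> unit_square \<Longrightarrow> \<bar>g0 p - f p\<bar> \<le> r"
  proof (rule lipschitz1_clamp_extension_family[OF lf, of I "pt x" "\<lambda>t. f (pt x (y - len m)) + (t - (y - len m))" r])
    show "\<bar>f (pt x (y - len m)) + (t - (y - len m)) - f (pt x t)\<bar> \<le> r" if "t \<in> I" for t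
    proof -
      have "\<bar>f (pt x (y - len m)) - f (pt x t)\<bar> \<le> 1 * dist (pt x (y - len m)) (pt x t)"
        by (rule lipD[OF lf inI[OF ends(1)] inI[OF that]])
      then have "\<bar>f (pt x (y - len m)) - f (pt x t)\<bar> \<le> \<bar>(y - len m) - t\<bar>" by simp
      moreover have "\<bar>(y - len m) - t\<bar> \<le> 3 * len m" using that by (simp add: I_def)
      ultimately show ?thesis using lr by linarith
    qed
  qed (use inI r in auto)
  define g where "g = restrict g0 unit_square"
  have gg: "g p = g0 p" if "p \<in> unit_square" for p using that by (simp add: g_def)
  have gL: "g \<in> mspace Lip1" using g0(1) gg unfolding mspace_Lip1_iff by (simp add: g_def lipschitz_on_def)
  show ?thesis
  proof (rule that[OF gL _ s])
    show "\<forall>p\<in>unit_square. \<bar>g p - f p\<bar> \<le> r" using g0(3) gg by simp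
    have "g (pt x (y + 2 * len m)) - g (pt x (y - len m)) = 3 * len m"
      using gg[OF inI[OF ends(1)]] gg[OF inI[OF ends(2)]] g0(2)[OF ends(1)] g0(2)[OF ends(2)] by simp
    moreover have "3 * len m * (1 - mu m ^ 4) < 3 * len m * 1"
      using zero_less_power[OF mu_pos[of m], of 4] len_pos[of m] by (intro mult_strict_left_mono) linarith+
    ultimately have "3 * len m * (1 - mu m ^ 4) < g (pt x (y + 2 * len m)) - g (pt x (y - len m))" by linarith
    then show "g \<in> steep m {s}" using gL by (simp add: steep_def x_def y_def)
  qed
qed

definition steep_next :: "nat \<times> (nat \<times> int) set \<Rightarrow> (real^2 \<Rightarrow> real) set" where
  "steep_next c = (\<Union>(m', S')\<in>{(m', S'). refines (fst c) (snd c) m' S'}. steep m' S' \<inter> linked (fst c) m' S')"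

text \<open>Dense and open: near a function outside the closure of \<open>steep\<close> nothing is required.\<close>

definition steep_game :: "nat \<times> (nat \<times> int) set \<Rightarrow> (real^2 \<Rightarrow> real) set" where
  "steep_game c = steep_next c \<union> (mspace Lip1 - mtopology_of Lip1 closure_of (steep (fst c) (snd c)))"

lemma openin_steep_game: "openin (mtopology_of Lip1) (steep_game c)"
proof -
  have "openin (mtopology_of Lip1) (steep_next c)"
    unfolding steep_next_def by (intro openin_Union) (auto simp: refines_def intro!: openin_Int openin_steep openin_linked)
  moreover have "openin (mtopology_of Lip1) (mspace Lip1 - mtopology_of Lip1 closure_of (steep (fst c) (snd c)))"
    using openin_diff[OF openin_topspace closedin_closure_of] by (metis topspace_mtopology_of)
  ultimately show ?thesis unfolding steep_game_def by (rule openin_Un)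
qed

lemma dense_steep_game:
  assumes c: "snd c \<subseteq> idx (fst c)"
  shows "mtopology_of Lip1 closure_of (steep_game c) = topspace (mtopology_of Lip1)"
  unfolding dense_intersects_open
proof (intro allI impI)
  fix T assume T: "openin (mtopology_of Lip1) T \<and> T \<noteq> {}"
  show "steep_game c \<inter> T \<noteq> {}"
  proof (cases "T \<inter> steep (fst c) (snd c) = {}")
    case True
    then have "T \<inter> mtopology_of Lip1 closure_of (steep (fst c) (snd c)) = {}"
      using T by (simp add: openin_Int_closure_of_eq_empty)
    moreover have "T \<subseteq> mspace Lip1" using T openin_subset by fastforce
    ultimately show ?thesis using T unfolding steep_game_def by blast
  next
    case False
    then obtain f where f: "f \<in> T" "f \<in> steep (fst c) (snd c)" by blast
    obtain r where r: "r > 0" "\<And>g. g \<in> mspace Lip1 \<Longrightarrow> (\<And>x. x \<in> unit_square \<Longrightarrow> \<bar>g x - f x\<bar> \<le> r) \<Longrightarrow> g \<in> T"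
      using openin_Lip1D[of T f] T f by blast
    obtain g m' S' where "g \<in> mspace Lip1" "\<forall>x\<in>unit_square. \<bar>g x - f x\<bar> \<le> r"
      "refines (fst c) (snd c) m' S'" "g \<in> steep m' S'" "g \<in> linked (fst c) m' S'"
      by (rule refinement_dense[OF f(2) c r(1)])
    then have "g \<in> T" "g \<in> steep_next c" using r(2) unfolding steep_next_def by blast+
    then show ?thesis unfolding steep_game_def by blast
  qed
qed

definition steep_start :: "(real^2 \<Rightarrow> real) set" where
  "steep_start = (\<Union>(m, s)\<in>{(m, s). s \<in> idx m}. steep m {s})"

lemma openin_steep_start: "openin (mtopology_of Lip1) steep_start"
  unfolding steep_start_def
proof (intro openin_Union, elim imageE, safe)
  fix m i j assume "(i, j) \<in> idx m"
  then show "openin (mtopology_of Lip1) (steep m {(i, j)})" by (intro openin_steep) simp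
qed

lemma dense_steep_start: "mtopology_of Lip1 closure_of steep_start = topspace (mtopology_of Lip1)"
  unfolding dense_intersects_open
proof (intro allI impI)
  fix T assume T: "openin (mtopology_of Lip1) T \<and> T \<noteq> {}"
  then obtain f where f: "f \<in> T" by blast
  then have fL: "f \<in> mspace Lip1" using T openin_subset by fastforce
  obtain r where r: "r > 0" "\<And>g. g \<in> mspace Lip1 \<Longrightarrow> (\<And>x. x \<in> unit_square \<Longrightarrow> \<bar>g x - f x\<bar> \<le> r) \<Longrightarrow> g \<in> T"
    using openin_Lip1D[of T f] T f by blast
  obtain g m s where "g \<in> mspace Lip1" "\<forall>x\<in>unit_square. \<bar>g x - f x\<bar> \<le> r" "s \<in> idx m" "g \<in> steep m {s}"
    by (rule steep_somewhere_dense[OF fL r(1)])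
  then have "g \<in> T" "g \<in> steep_start" using r(2) unfolding steep_start_def by blast+
  then show "steep_start \<inter> T \<noteq> {}" by blast
qed

text \<open>Membership in \<open>steep\<close> excludes the complement of its closure, so each game
  forces a next position at which \<open>f\<close> is again steep, and dependent choice yields an
  infinite chain.\<close>

lemma rich_of_steep_game:
  assumes start: "f \<in> steep_start" and game: "\<And>m S. S \<subseteq> idx m \<Longrightarrow> f \<in> steep_game (m, S)"
  shows "rich f"
proof -
  obtain m0 s0 where 0: "s0 \<in> idx m0" "f \<in> steep m0 {s0}" using start unfolding steep_start_def by blast
  have "\<exists>c. \<forall>n. (snd (c n) \<subseteq> idx (fst (c n)) \<and> f \<in> steep (fst (c n)) (snd (c n)) \<and> (n = 0 \<longrightarrow> snd (c n) = {s0})) \<and>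
      (refines (fst (c n)) (snd (c n)) (fst (c (Suc n))) (snd (c (Suc n))) \<and>
       f \<in> linked (fst (c n)) (fst (c (Suc n))) (snd (c (Suc n))))"
  proof (rule dependent_nat_choice)
    show "\<exists>c. snd c \<subseteq> idx (fst c) \<and> f \<in> steep (fst c) (snd c) \<and> ((0::nat) = 0 \<longrightarrow> snd c = {s0})"
      using 0 by (intro exI[of _ "(m0, {s0})"]) auto
    fix c :: "nat \<times> (nat \<times> int) set" and n :: nat
    assume c: "snd c \<subseteq> idx (fst c) \<and> f \<in> steep (fst c) (snd c) \<and> (n = 0 \<longrightarrow> snd c = {s0})"
    have sub: "steep (fst c) (snd c) \<subseteq> mtopology_of Lip1 closure_of (steep (fst c) (snd c))"
      by (intro closure_of_subset) (auto simp: steep_def)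
    have "f \<in> steep_game (fst c, snd c)" using c by (intro game) auto
    then have "f \<in> steep_next c" using c sub unfolding steep_game_def by auto
    then obtain m' S' where "refines (fst c) (snd c) m' S'" "f \<in> steep m' S'" "f \<in> linked (fst c) m' S'"
      unfolding steep_next_def by blast
    then show "\<exists>c'. (snd c' \<subseteq> idx (fst c') \<and> f \<in> steep (fst c') (snd c') \<and> (Suc n = 0 \<longrightarrow> snd c' = {s0})) \<and>
        (refines (fst c) (snd c) (fst c') (snd c') \<and> f \<in> linked (fst c) (fst c') (snd c'))"
      by (intro exI[of _ "(m', S')"]) (auto simp: refines_def)
  qed
  then obtain c where c: "\<And>n. snd (c n) \<subseteq> idx (fst (c n))" "snd (c 0) = {s0}"
    "\<And>n. refines (fst (c n)) (snd (c n)) (fst (c (Suc n))) (snd (c (Suc n)))"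
    "\<And>n. f \<in> linked (fst (c n)) (fst (c (Suc n))) (snd (c (Suc n)))" by blast
  show ?thesis
    by (rule rich_chain[where S = "\<lambda>n. snd (c n)" and m = "\<lambda>n. fst (c n)", OF c(2,1,3,4)])
qed

text \<open>The games range over all pairs of a level and a set of its segments, whether or not they
  arise for a given function. Finiteness of each \<open>idx m\<close> makes these countably many, as
  a residual set requires.\<close>

lemma residual_rich: "residual_in (mtopology_of Lip1) {f \<in> mspace Lip1. rich f}"
proof -
  define Q where "Q = (SIGMA m:UNIV. Pow (idx m))"
  define q where "q = from_nat_into Q"
  have "countable Q" unfolding Q_def by (intro countable_SIGMA) (auto intro: countable_finite simp: finite_idx)
  moreover have "Q \<noteq> {}" by (auto simp: Q_def)
  ultimately have q: "range q = Q" unfolding q_def by (intro range_from_nat_into)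
  define U where "U n = (case n of 0 \<Rightarrow> steep_start | Suc k \<Rightarrow> steep_game (q k))" for n
  have qQ: "snd (q k) \<subseteq> idx (fst (q k))" for k
  proof -
    have "q k \<in> Q" using rangeI[of q k] unfolding q .
    then have "(fst (q k), snd (q k)) \<in> Q" by simp
    then show ?thesis unfolding Q_def by (simp only: mem_Sigma_iff Pow_iff)
  qed
  have U0: "U 0 = steep_start" and US: "U (Suc k) = steep_game (q k)" for k by (simp_all add: U_def)
  have U: "openin (mtopology_of Lip1) (U n) \<and> mtopology_of Lip1 closure_of (U n) = topspace (mtopology_of Lip1)" for n
  proof (cases n)
    case 0
    then show ?thesis unfolding 0 U0 using openin_steep_start dense_steep_start by blast
  next
    case (Suc k)
    then show ?thesis unfolding Suc US using openin_steep_game dense_steep_game[OF qQ] by blast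
  qed
  have "(\<Inter>n. U n) \<subseteq> {f \<in> mspace Lip1. rich f}"
  proof
    fix f assume f: "f \<in> (\<Inter>n. U n)"
    have "f \<in> U 0" using f by blast
    then have start: "f \<in> steep_start" unfolding U0 .
    have "f \<in> steep_game (m, S)" if "S \<subseteq> idx m" for m S
    proof -
      have "(m, S) \<in> range q" using that q by (auto simp: Q_def)
      then obtain k where "(m, S) = q k" by (rule rangeE)
      moreover have "f \<in> U (Suc k)" using f by blast
      ultimately show ?thesis unfolding US by simp
    qed
    then have "rich f" using start by (rule rich_of_steep_game[rotated])
    moreover have "f \<in> mspace Lip1" using start by (auto simp: steep_start_def steep_def)
    ultimately show "f \<in> {f \<in> mspace Lip1. rich f}" by blast
  qed
  moreover have "{f \<in> mspace Lip1. rich f} \<subseteq> topspace (mtopology_of Lip1)" by auto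
  ultimately show ?thesis unfolding residual_in_def
    by (intro conjI exI[of _ U] allI U[THEN conjunct1] U[THEN conjunct2])
qed

text \<open>Both \<open>limit_pattern\<close> and, at interior points, differentiability are
  countable intersections of countable unions of compact sets. \<open>prod_decode\<close> merges the
  two unions, over the level and over the second index of \<open>approx_diff\<close>, into
  one.\<close>

lemma sets_lebesgue_image_Diff_limit_pattern:
  fixes p :: "real^2 \<Rightarrow> real"
  assumes f: "1-lipschitz_on unit_square f" and p: "continuous_on UNIV p"
  shows "p ` (Diff f \<inter> limit_pattern) \<in> sets lebesgue"
proof -
  define C where "C n k = (if n \<le> fst (prod_decode k)
    then pattern (fst (prod_decode k)) \<inter> approx_diff f unit_square n (snd (prod_decode k)) else {})" for n k
  have ac: "compact (approx_diff f unit_square n k)" for n k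
    using lipschitz_on_continuous_on[OF f] compact_unit_square by (rule compact_approx_diff)
  have "Diff f \<inter> limit_pattern = (\<Inter>n. \<Union>k. C n k)"
  proof (intro equalityI subsetI)
    fix x assume x: "x \<in> Diff f \<inter> limit_pattern"
    then have int: "x \<in> interior unit_square" using limit_pattern_subset by blast
    then have "f differentiable (at x)" using x at_within_interior[OF int] by (simp add: Diff_def)
    then have a: "x \<in> (\<Inter>n. \<Union>k. approx_diff f unit_square n k)" by (rule approx_diff_differentiable[OF f int])
    have "x \<in> (\<Union>k. C n k)" for n
    proof -
      obtain m where m: "n \<le> m" "x \<in> pattern m" using x by (auto simp: limit_pattern_def)
      obtain k where "x \<in> approx_diff f unit_square n k" using a by blast
      then have "x \<in> C n (prod_encode (m, k))" using m by (simp add: C_def)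
      then show ?thesis by blast
    qed
    then show "x \<in> (\<Inter>n. \<Union>k. C n k)" by blast
  next
    fix x assume x: "x \<in> (\<Inter>n. \<Union>k. C n k)"
    have m: "\<exists>m k. n \<le> m \<and> x \<in> pattern m \<and> x \<in> approx_diff f unit_square n k" for n
    proof -
      obtain k where "x \<in> C n k" using x by blast
      then show ?thesis by (auto simp: C_def split: if_splits)
    qed
    then have "x \<in> limit_pattern" unfolding limit_pattern_def by fastforce
    moreover have "f differentiable (at x within unit_square)" using m by (intro differentiable_approx_diff) blast
    moreover have "x \<in> unit_square" using m[of 0] unfolding approx_diff_def by blast
    ultimately show "x \<in> Diff f \<inter> limit_pattern" by (simp add: Diff_def)
  qed
  moreover have "p ` (\<Inter>n. \<Union>k. C n k) \<in> sets lebesgue"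
  proof (rule sets_lebesgue_image_Fsigma_delta[OF p])
    show "compact (C n k)" for n k using ac compact_pattern by (simp add: C_def compact_Int)
    show "C n k \<subseteq> unit_square" for n k by (auto simp: C_def approx_diff_def)
  qed (rule compact_unit_square)
  ultimately show ?thesis by simp
qed

lemma rich_not_sigma_finite:
  assumes "rich f" "Diff f \<inter> limit_pattern \<subseteq> D"
  shows "\<not> sigma_finite_hausdorff1 D"
proof -
  obtain A where A: "disjoint_family_on A {-1..1::real}"
     "\<And>l. l \<in> {-1..1} \<Longrightarrow> compact (A l)" "\<And>l. l \<in> {-1..1} \<Longrightarrow> A l \<subseteq> Diff f \<inter> limit_pattern"
     "\<And>l. l \<in> {-1..1} \<Longrightarrow> 0 < emeasure lborel (proj l ` A l)" using assms(1) unfolding rich_def by blast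
  show ?thesis
  proof (rule not_sigma_finite_hausdorff1I[where I = "{-1..1}" and A = A and p = proj and L = 2])
    show "uncountable {-1..1::real}" by (simp add: uncountable_closed_interval)
    show "dist (proj l x) (proj l y) \<le> 2 * dist x y" if "l \<in> {-1..1}" for l x y using that by (intro dist_proj) auto
    show "outer_measure_of lborel (proj l ` A l) \<noteq> 0" if l: "l \<in> {-1..1}" for l
    proof -
      have "compact (proj l ` A l)" by (intro compact_continuous_image continuous_proj A(2)[OF l])
      then show ?thesis using A(4)[OF l] by (simp add: borel_compact)
    qed
    show "A l \<subseteq> D" if "l \<in> {-1..1}" for l using A(3)[OF that] assms(2) by blast
  qed (use A in auto)
qed

text \<open>For \<open>l = (e \<bullet> v) / (e \<bullet> u)\<close> the map \<open>proj l\<close>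
  is the projection onto \<open>e\<close> divided by \<open>e \<bullet> u\<close>, so a null
  projection onto \<open>e\<close> would give a null image under \<open>proj l\<close>. The
  condition on \<open>e\<close> amounts to \<open>\<bar>l\<bar> \<le> 1\<close>.\<close>

lemma rich_projection_positive:
  assumes f: "1-lipschitz_on unit_square f" and rich: "rich f" and e: "\<bar>e \<bullet> v\<bar> \<le> \<bar>e \<bullet> u\<bar>" "e \<noteq> 0"
  shows "0 < emeasure lebesgue ((\<lambda>x. x \<bullet> e) ` (Diff f \<inter> limit_pattern))"
proof -
  define l where "l = (e \<bullet> v) / (e \<bullet> u)"
  have eu: "e \<bullet> u \<noteq> 0"
  proof
    assume "e \<bullet> u = 0"
    then have "norm e \<le> 0" using e(1) norm_le_frame[of e] by simp
    then show False using e(2) by simp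
  qed
  have l: "l \<in> {-1..1}"
  proof -
    have "\<bar>l\<bar> \<le> 1" using e(1) eu by (simp add: l_def abs_divide divide_le_eq_1)
    then show ?thesis by auto
  qed
  obtain A where A: "compact A" "A \<subseteq> Diff f \<inter> limit_pattern" "0 < emeasure lborel (proj l ` A)"
    using rich l unfolding rich_def by blast
  have pe: "proj l x = (x \<bullet> e) / (e \<bullet> u)" for x
  proof -
    have "x \<bullet> e = x \<bullet> pt (e \<bullet> v) (e \<bullet> u)" by (simp only: pt_inverse)
    also have "\<dots> = (e \<bullet> v) * (x \<bullet> v) + (e \<bullet> u) * (x \<bullet> u)" unfolding pt_def inner_add_right inner_scaleR_right by simp
    finally show ?thesis using eu by (simp add: proj_def l_def field_simps)
  qed
  have m: "(\<lambda>x. x \<bullet> e) ` (Diff f \<inter> limit_pattern) \<in> sets lebesgue"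
    by (intro sets_lebesgue_image_Diff_limit_pattern f continuous_intros)
  have "emeasure lebesgue ((\<lambda>x. x \<bullet> e) ` (Diff f \<inter> limit_pattern)) \<noteq> 0"
  proof
    assume "emeasure lebesgue ((\<lambda>x. x \<bullet> e) ` (Diff f \<inter> limit_pattern)) = 0"
    then have "negligible ((\<lambda>x. x \<bullet> e) ` (Diff f \<inter> limit_pattern))"
      using m by (simp add: negligible_iff_null_sets null_setsI)
    then have "negligible ((\<lambda>z. z / (e \<bullet> u)) ` ((\<lambda>x. x \<bullet> e) ` (Diff f \<inter> limit_pattern)))"
      by (rule negligible_differentiable_image_negligible[OF order_refl])
        (auto intro!: derivative_intros simp: differentiable_on_def eu)
    then have "negligible (proj l ` A)"
      by (rule negligible_subset) (use A(2) pe in \<open>auto simp: image_image\<close>)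
    moreover have "compact (proj l ` A)" by (intro compact_continuous_image continuous_proj A(1))
    ultimately have "emeasure lborel (proj l ` A) = 0"
      by (auto simp: negligible_iff_null_sets null_sets_def borel_compact)
    then show False using A(3) by simp
  qed
  then show ?thesis by (simp add: zero_less_iff_neq_zero)
qed

end

lemma purely_unrectifiable_Un:
  assumes "purely_unrectifiable P" "purely_unrectifiable Q"
  shows "purely_unrectifiable (P \<union> Q)"
  unfolding purely_unrectifiable_def
proof (intro conjI allI impI)
  show "P \<union> Q \<in> sets borel" using assms by (auto simp: purely_unrectifiable_def)
  fix a b \<gamma> assume "C1_curve a b \<gamma>"
  then have "{t \<in> {a..b}. \<gamma> t \<in> P} \<union> {t \<in> {a..b}. \<gamma> t \<in> Q} \<in> null_sets lebesgue"
    using assms by (intro null_sets.Un) (auto simp: purely_unrectifiable_def)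
  moreover have "{t \<in> {a..b}. \<gamma> t \<in> P} \<union> {t \<in> {a..b}. \<gamma> t \<in> Q} = {t \<in> {a..b}. \<gamma> t \<in> P \<union> Q}" by blast
  ultimately show "{t \<in> {a..b}. \<gamma> t \<in> P \<union> Q} \<in> null_sets lebesgue" by simp
qed

theorem theorem1p1:
  shows "\<exists>P :: (real^2) set. P \<subseteq> unit_square \<and> purely_unrectifiable P \<and>
    residual_in (mtopology_of Lip1)
      {f \<in> mspace Lip1.
         Diff f \<inter> P \<noteq> {} \<and>
         \<not> sigma_finite_hausdorff1 (Diff f \<inter> P) \<and>
         (\<forall>e :: real^2. norm e = 1 \<longrightarrow> emeasure lebesgue ((\<lambda>x. x \<bullet> e) ` (Diff f \<inter> P)) > 0)}"
proof -
  interpret F: frame "axis 1 1" "axis 2 1" by (rule frame.intro) simp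
  interpret G: frame "axis 2 1" "axis 1 1" by (rule frame.intro) simp
  define P where "P = F.limit_pattern \<union> G.limit_pattern"
  have good: "Diff f \<inter> P \<noteq> {} \<and> \<not> sigma_finite_hausdorff1 (Diff f \<inter> P) \<and>
      (\<forall>e :: real^2. norm e = 1 \<longrightarrow> emeasure lebesgue ((\<lambda>x. x \<bullet> e) ` (Diff f \<inter> P)) > 0)"
    if f: "f \<in> mspace Lip1" "F.rich f" "G.rich f" for f
  proof (intro conjI allI impI)
    have lip: "1-lipschitz_on unit_square f" using f by (simp add: mspace_Lip1_iff)
    have split: "p ` (Diff f \<inter> P) = p ` (Diff f \<inter> F.limit_pattern) \<union> p ` (Diff f \<inter> G.limit_pattern)" for p :: "real^2 \<Rightarrow> real"
      unfolding P_def by blast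
    show sf: "\<not> sigma_finite_hausdorff1 (Diff f \<inter> P)"
      using f(2) by (rule F.rich_not_sigma_finite) (auto simp: P_def)
    show pos: "emeasure lebesgue ((\<lambda>x. x \<bullet> e) ` (Diff f \<inter> P)) > 0" if e: "norm e = 1" for e :: "real^2"
    proof -
      have e0: "e \<noteq> 0" using e by auto
      have m: "(\<lambda>x. x \<bullet> e) ` (Diff f \<inter> F.limit_pattern) \<in> sets lebesgue" "(\<lambda>x. x \<bullet> e) ` (Diff f \<inter> G.limit_pattern) \<in> sets lebesgue"
        by (intro F.sets_lebesgue_image_Diff_limit_pattern G.sets_lebesgue_image_Diff_limit_pattern lip continuous_intros)+
      show ?thesis
      \<comment> \<open>The larger coordinate of \<open>e\<close> decides which of the two frames
        has \<open>e\<close> in its cone.\<close>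
      proof (cases "\<bar>e \<bullet> axis 2 1\<bar> \<le> \<bar>e \<bullet> axis 1 1\<bar>")
        case True
        then have "0 < emeasure lebesgue ((\<lambda>x. x \<bullet> e) ` (Diff f \<inter> F.limit_pattern))"
          using e0 f(2) lip by (intro F.rich_projection_positive)
        also have "\<dots> \<le> emeasure lebesgue ((\<lambda>x. x \<bullet> e) ` (Diff f \<inter> P))"
          using m unfolding split by (intro emeasure_mono sets.Un) auto
        finally show ?thesis .
      next
        case False
        then have "0 < emeasure lebesgue ((\<lambda>x. x \<bullet> e) ` (Diff f \<inter> G.limit_pattern))"
          using e0 f(3) lip by (intro G.rich_projection_positive) auto
        also have "\<dots> \<le> emeasure lebesgue ((\<lambda>x. x \<bullet> e) ` (Diff f \<inter> P))"
          using m unfolding split by (intro emeasure_mono sets.Un) auto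
        finally show ?thesis .
      qed
    qed
    show "Diff f \<inter> P \<noteq> {}" using pos[OF F.norm_frame(1)] by auto
  qed
  have "residual_in (mtopology_of Lip1) ({f \<in> mspace Lip1. F.rich f} \<inter> {f \<in> mspace Lip1. G.rich f})"
    by (intro residual_in_Int F.residual_rich G.residual_rich)
  then have "residual_in (mtopology_of Lip1)
      {f \<in> mspace Lip1. Diff f \<inter> P \<noteq> {} \<and> \<not> sigma_finite_hausdorff1 (Diff f \<inter> P) \<and>
         (\<forall>e :: real^2. norm e = 1 \<longrightarrow> emeasure lebesgue ((\<lambda>x. x \<bullet> e) ` (Diff f \<inter> P)) > 0)}"
    by (rule residual_in_mono) (use good in auto)
  moreover have "purely_unrectifiable P"
    unfolding P_def by (intro purely_unrectifiable_Un F.purely_unrectifiable_limit_pattern G.purely_unrectifiable_limit_pattern)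
  moreover have "P \<subseteq> unit_square"
    using F.limit_pattern_subset G.limit_pattern_subset interior_subset unfolding P_def by blast
  ultimately show ?thesis by blast
qed

end
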